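(* Let $q>0$, $q\ne1$, $M\in\mathbb N$, $\vec k=(k_1,\dots,k_M)$ with all $k_j>0$, $\lambda,\rho\in\mathbb R$, and $v\in\mathbb C\setminus\{0\}$. For $y,x\in\mathbb Z_{\ge0}$ define the 1-site function $$p_{\mathrm{AW}}(y,x;\lambda,\rho,v,k;q)=(vq^{\rho+\lambda+k+1};q^2)_x\,(vq^{-\rho-\lambda-k-1};q^{-2})_y\;{}_4\varphi_3\left(\begin{matrix}q^{-2y},q^{2y+2\lambda+2k},q^{-2x},q^{2x+2\rho+2k}\\ q^{2k},vq^{\rho+\lambda+k+1},v^{-1}q^{\rho+\lambda+k+1}\end{matrix};q^2,q^2\right).$$ Then the function $$P^v_{\mathrm{AW}}(\zeta,\xi)=\prod_{j=1}^Mp_{\mathrm{AW}}\big(\zeta_j,\xi_j;h^-_{j-1}(\zeta),h^+_{j+1}(\xi),v,k_j;q\big)$$ is a duality function between $\mathrm{ASIP}_{\mathsf L}(q,\vec k,\lambda)$ and $\mathrm{ASIP}_{\mathsf R}(q,\vec k,\rho)$, i.e. for all $\zeta\in\mathcal S_\lambda$ and $\xi\in\mathcal S_\rho$, $$\big[L^{\mathrm{ASIP}_{\mathsf L}}_{q,\vec k,\lambda}P^v_{\mathrm{AW}}(\cdot,\xi)\big](\zeta)=\big[L^{\mathrm{ASIP}_{\mathsf R}}_{q,\vec k,\rho}P^v_{\mathrm{AW}}(\zeta,\cdot)\big](\xi).$$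
   Context: Notation: $X_d=\mathbb Z_{\ge0}^M$; $|\eta|=\sum_j\eta_j$; $[a]_q=\frac{q^a-q^{-a}}{q-q^{-1}}$; $(a;q)_n=\prod_{i=0}^{n-1}(1-aq^i)$; ${}_{4}\varphi_3(a_1,\dots,a_4;b_1,b_2,b_3;q,z)=\sum_{n\ge0}\frac{\prod_i(a_i;q)_n}{\prod_i(b_i;q)_n}\frac{z^n}{(q;q)_n}$, a finite sum over $n\le N$ when an upper parameter equals $q^{-N}$, $N\in\mathbb Z_{\ge0}$. The product of prefactor and ${}_4\varphi_3$ defining $p_{\mathrm{AW}}$ is a polynomial in $v$; it is extended by continuity to those $v$ for which a denominator parameter of the ${}_4\varphi_3$ gives a zero. $\eta^{j,m}$ is $\eta$ with one particle moved from site $j$ to $m$ if $\eta_j\ge1$, and $\eta$ otherwise. For $a\in\mathbb R$: $\mathcal S_a=X_d$ if $a>-1$, and $\mathcal S_a=\{\eta\in X_d:2|\eta|+|\vec k|+a<0\}$ if $a\le-1$. Height functions: $h^-_0=\lambda$, $h^-_j(\zeta)=\lambda+\sum_{i=1}^j(2\zeta_i+k_i)$; $h^+_{M+1}=\rho$, $h^+_j(\xi)=\rho+\sum_{i=j}^M(2\xi_i+k_i)$. Left dynamic ASIP, $\mathrm{ASIP}_{\mathsf L}(q,\vec k,\lambda)$ on $\mathcal S_\lambda$: $$[L^{\mathrm{ASIP}_{\mathsf L}}_{q,\vec k,\lambda}f](\zeta)=\sum_{j=1}^{M-1}C_j^{\mathsf L,+}[f(\zeta^{j,j+1})-f(\zeta)]+C_{j+1}^{\mathsf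 L,-}[f(\zeta^{j+1,j})-f(\zeta)],$$ $$C_j^{\mathsf L,+}=[\zeta_j]_q[\zeta_{j+1}+k_{j+1}]_q\frac{[h^-_{j-1}+\zeta_j]_q[h^-_j+\zeta_{j+1}]_q}{[h^-_j]_q[h^-_j-1]_q},\quad C_j^{\mathsf L,-}=[\zeta_j]_q[\zeta_{j-1}+k_{j-1}]_q\frac{[h^-_{j-1}-\zeta_{j-1}]_q[h^-_j-\zeta_j]_q}{[h^-_{j-1}]_q[h^-_{j-1}+1]_q}.$$ Right dynamic ASIP, $\mathrm{ASIP}_{\mathsf R}(q,\vec k,\rho)$ on $\mathcal S_\rho$: $$[L^{\mathrm{ASIP}_{\mathsf R}}_{q,\vec k,\rho}f](\xi)=\sum_{j=1}^{M-1}C_j^{\mathsf R,+}[f(\xi^{j,j+1})-f(\xi)]+C_{j+1}^{\mathsf R,-}[f(\xi^{j+1,j})-f(\xi)],$$ $$C_j^{\mathsf R,+}=[\xi_j]_q[\xi_{j+1}+k_{j+1}]_q\frac{[h^+_j-\xi_j]_q[h^+_{j+1}-\xi_{j+1}]_q}{[h^+_{j+1}]_q[h^+_{j+1}+1]_q},\quad C_j^{\mathsf R,-}=[\xi_j]_q[\xi_{j-1}+k_{j-1}]_q\frac{[h^+_j+\xi_{j-1}]_q[h^+_{j+1}+\xi_j]_q}{[h^+_j]_q[h^+_j-1]_q}.$$ Here $h^\pm_i$ are evaluated at the current state. Conventions: a rate is $0$ when the departing site $j$ is empty; $[h^-_{j-1}-\zeta_{j-1}]_q/[h^-_{j-1}]_q$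 is read as $1$ when $\zeta_{j-1}=0$, and $[h^+_{j+1}-\xi_{j+1}]_q/[h^+_{j+1}]_q$ is read as $1$ when $\xi_{j+1}=0$. *)

theory Defs
  imports Complex_Main
begin

section \<open>\<open>q\<close>-calculus\<close>

definition qnum :: "real \<Rightarrow> real \<Rightarrow> real" where
  "qnum q a = (q powr a - q powr (- a)) / (q - 1 / q)"

definition qpow :: "real \<Rightarrow> real \<Rightarrow> complex" where
  "qpow q a = complex_of_real (q powr a)"

definition qpoch :: "complex \<Rightarrow> complex \<Rightarrow> nat \<Rightarrow> complex" where
  "qpoch a b n = (\<Prod>i<n. 1 - a * b ^ i)"

text \<open>
  If some upper parameter is \<open>b powi (- N)\<close>, all terms with \<open>n > N\<close> have numerator zero, hence are
  zero here (also where a denominator vanishes, since \<open>0 / 0 = 0\<close>), and the series is the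
  terminating sum over \<open>n \<le> N\<close>; no condition on the modulus of the base \<open>b\<close> is then needed.
\<close>

definition phi43 ::
  "complex \<Rightarrow> complex \<Rightarrow> complex \<Rightarrow> complex \<Rightarrow> complex \<Rightarrow> complex \<Rightarrow> complex \<Rightarrow>
   complex \<Rightarrow> complex \<Rightarrow> complex" where
  "phi43 a1 a2 a3 a4 b1 b2 b3 b z =
     (\<Sum>n. (qpoch a1 b n * qpoch a2 b n * qpoch a3 b n * qpoch a4 b n) /
           (qpoch b1 b n * qpoch b2 b n * qpoch b3 b n) * (z ^ n / qpoch b b n))"


section \<open>Configurations and height functions\<close>

text \<open>
  The sites are \<open>1, \<dots>, M\<close>. An element of \<open>X\<^sub>d\<close> is a function on \<^typ>\<open>nat\<close> that vanishes outside
  the sites, so that configurations correspond bijectively to \<open>M\<close>-tuples.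
\<close>

type_synonym config = "nat \<Rightarrow> nat"

definition configs :: "nat \<Rightarrow> config set" where
  "configs M = {\<eta>. \<forall>j. j \<notin> {1..M} \<longrightarrow> \<eta> j = 0}"

definition state_space :: "nat \<Rightarrow> (nat \<Rightarrow> real) \<Rightarrow> real \<Rightarrow> config set" where
  "state_space M k a =
     (if a > - 1 then configs M
      else {\<eta> \<in> configs M. 2 * real (\<Sum>j=1..M. \<eta> j) + (\<Sum>j=1..M. k j) + a < 0})"

definition move :: "nat \<Rightarrow> nat \<Rightarrow> config \<Rightarrow> config" where
  "move j m \<eta> =
     (if \<eta> j \<ge> 1 then (let \<eta>' = \<eta>(j := \<eta> j - 1) in \<eta>'(m := \<eta>' m + 1)) else \<eta>)"

definition h_minus :: "(nat \<Rightarrow> real) \<Rightarrow> real \<Rightarrow> config \<Rightarrow> nat \<Rightarrow> real" where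
  "h_minus k lam \<zeta> j = lam + (\<Sum>i=1..j. 2 * real (\<zeta> i) + k i)"

definition h_plus :: "nat \<Rightarrow> (nat \<Rightarrow> real) \<Rightarrow> real \<Rightarrow> config \<Rightarrow> nat \<Rightarrow> real" where
  "h_plus M k \<rho> \<xi> j = \<rho> + (\<Sum>i=j..M. 2 * real (\<xi> i) + k i)"


section \<open>The generators\<close>

text \<open>
  In the rates below, the test for an empty departing site, and the replacement of
  \<open>[h - \<eta>] / [h]\<close> by 1 when \<open>\<eta> = 0\<close>, fix the values of the quotients that could be \<open>0 / 0\<close>.
\<close>

definition rate_L_plus :: "real \<Rightarrow> (nat \<Rightarrow> real) \<Rightarrow> real \<Rightarrow> config \<Rightarrow> nat \<Rightarrow> real" where
  "rate_L_plus q k lam \<zeta> j =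
     (let h = h_minus k lam \<zeta> in
      if \<zeta> j = 0 then 0
      else qnum q (\<zeta> j) * qnum q (\<zeta> (j + 1) + k (j + 1)) *
           ((qnum q (h (j - 1) + \<zeta> j) * qnum q (h j + \<zeta> (j + 1))) /
            (qnum q (h j) * qnum q (h j - 1))))"

definition rate_L_minus :: "real \<Rightarrow> (nat \<Rightarrow> real) \<Rightarrow> real \<Rightarrow> config \<Rightarrow> nat \<Rightarrow> real" where
  "rate_L_minus q k lam \<zeta> j =
     (let h = h_minus k lam \<zeta> in
      if \<zeta> j = 0 then 0
      else qnum q (\<zeta> j) * qnum q (\<zeta> (j - 1) + k (j - 1)) *
           (if \<zeta> (j - 1) = 0 then 1
            else qnum q (h (j - 1) - \<zeta> (j - 1)) / qnum q (h (j - 1))) *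
           (qnum q (h j - \<zeta> j) / qnum q (h (j - 1) + 1)))"

definition rate_R_plus :: "nat \<Rightarrow> real \<Rightarrow> (nat \<Rightarrow> real) \<Rightarrow> real \<Rightarrow> config \<Rightarrow> nat \<Rightarrow> real" where
  "rate_R_plus M q k \<rho> \<xi> j =
     (let h = h_plus M k \<rho> \<xi> in
      if \<xi> j = 0 then 0
      else qnum q (\<xi> j) * qnum q (\<xi> (j + 1) + k (j + 1)) *
           (if \<xi> (j + 1) = 0 then 1
            else qnum q (h (j + 1) - \<xi> (j + 1)) / qnum q (h (j + 1))) *
           (qnum q (h j - \<xi> j) / qnum q (h (j + 1) + 1)))"

definition rate_R_minus :: "nat \<Rightarrow> real \<Rightarrow> (nat \<Rightarrow> real) \<Rightarrow> real \<Rightarrow> config \<Rightarrow> nat \<Rightarrow> real" where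
  "rate_R_minus M q k \<rho> \<xi> j =
     (let h = h_plus M k \<rho> \<xi> in
      if \<xi> j = 0 then 0
      else qnum q (\<xi> j) * qnum q (\<xi> (j - 1) + k (j - 1)) *
           ((qnum q (h j + \<xi> (j - 1)) * qnum q (h (j + 1) + \<xi> j)) /
            (qnum q (h j) * qnum q (h j - 1))))"

text \<open>
  The jumps conserve the number of particles, so at a configuration of the state space the generators
  only use the values of \<open>f\<close> on the state space.
\<close>

definition ASIP_L ::
  "nat \<Rightarrow> real \<Rightarrow> (nat \<Rightarrow> real) \<Rightarrow> real \<Rightarrow> (config \<Rightarrow> complex) \<Rightarrow> config \<Rightarrow> complex" where
  "ASIP_L M q k lam f \<zeta> =
     (\<Sum>j=1..M-1.
        complex_of_real (rate_L_plus q k lam \<zeta> j) * (f (move j (j + 1) \<zeta>) - f \<zeta>) +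
        complex_of_real (rate_L_minus q k lam \<zeta> (j + 1)) * (f (move (j + 1) j \<zeta>) - f \<zeta>))"

definition ASIP_R ::
  "nat \<Rightarrow> real \<Rightarrow> (nat \<Rightarrow> real) \<Rightarrow> real \<Rightarrow> (config \<Rightarrow> complex) \<Rightarrow> config \<Rightarrow> complex" where
  "ASIP_R M q k \<rho> f \<xi> =
     (\<Sum>j=1..M-1.
        complex_of_real (rate_R_plus M q k \<rho> \<xi> j) * (f (move j (j + 1) \<xi>) - f \<xi>) +
        complex_of_real (rate_R_minus M q k \<rho> \<xi> (j + 1)) * (f (move (j + 1) j \<xi>) - f \<xi>))"

definition duality_function ::
  "'a set \<Rightarrow> (('a \<Rightarrow> complex) \<Rightarrow> 'a \<Rightarrow> complex) \<Rightarrow>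
   'b set \<Rightarrow> (('b \<Rightarrow> complex) \<Rightarrow> 'b \<Rightarrow> complex) \<Rightarrow> ('a \<Rightarrow> 'b \<Rightarrow> complex) \<Rightarrow> bool" where
  "duality_function S L S' L' D \<longleftrightarrow>
     (\<forall>\<zeta>\<in>S. \<forall>\<xi>\<in>S'. L (\<lambda>\<zeta>'. D \<zeta>' \<xi>) \<zeta> = L' (\<lambda>\<xi>'. D \<zeta> \<xi>') \<xi>)"


section \<open>The Askey--Wilson duality function\<close>

definition p_AW_formula ::
  "nat \<Rightarrow> nat \<Rightarrow> real \<Rightarrow> real \<Rightarrow> complex \<Rightarrow> real \<Rightarrow> real \<Rightarrow> complex" where
  "p_AW_formula y x lam \<rho> v k q =
     qpoch (v * qpow q (\<rho> + lam + k + 1)) (qpow q 2) x *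
     qpoch (v * qpow q (- \<rho> - lam - k - 1)) (qpow q (- 2)) y *
     phi43 (qpow q (- 2 * y)) (qpow q (2 * y + 2 * lam + 2 * k))
           (qpow q (- 2 * x)) (qpow q (2 * x + 2 * \<rho> + 2 * k))
           (qpow q (2 * k)) (v * qpow q (\<rho> + lam + k + 1)) (inverse v * qpow q (\<rho> + lam + k + 1))
           (qpow q 2) (qpow q 2)"

text \<open>
  As a function of \<open>v\<close> the formula is only valid where no denominator vanishes; at the other \<open>v\<close>,
  which are isolated away from 0, the value is the limit of the formula over the punctured
  neighbourhoods of \<open>v\<close>. The lower parameter \<open>qpow q (2 * k)\<close> gives no zero when \<open>k > 0\<close>.
\<close>

definition p_AW ::
  "nat \<Rightarrow> nat \<Rightarrow> real \<Rightarrow> real \<Rightarrow> complex \<Rightarrow> real \<Rightarrow> real \<Rightarrow> complex" where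
  "p_AW y x lam \<rho> v k q =
     (if \<exists>n. qpoch (v * qpow q (\<rho> + lam + k + 1)) (qpow q 2) n = 0 \<or>
             qpoch (inverse v * qpow q (\<rho> + lam + k + 1)) (qpow q 2) n = 0
      then Lim (at v) (\<lambda>w. p_AW_formula y x lam \<rho> w k q)
      else p_AW_formula y x lam \<rho> v k q)"

definition P_AW ::
  "nat \<Rightarrow> real \<Rightarrow> (nat \<Rightarrow> real) \<Rightarrow> real \<Rightarrow> real \<Rightarrow> complex \<Rightarrow> config \<Rightarrow> config \<Rightarrow> complex" where
  "P_AW M q k lam \<rho> v \<zeta> \<xi> =
     (\<Prod>j=1..M. p_AW (\<zeta> j) (\<xi> j) (h_minus k lam \<zeta> (j - 1)) (h_plus M k \<rho> \<xi> (j + 1)) v (k j) q)"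

end

theory Submission
  imports Defs "HOL-Analysis.Analysis"
begin

text \<open>
  The generators are sums over bonds, and a jump across a bond changes only the height between the
  two sites, so it suffices to prove an identity for two sites. All one-site functions occurring in it
  are contiguous to one balanced \<open>4\<phi>3\<close> and hence lie in a two-dimensional space, spanned by the
  function with parameter \<open>v\<close> and the one with parameter \<open>v q\<^sup>2\<close> (on the second site: \<open>v q\<^sup>-\<^sup>2\<close>);
  the three relations needed come from telescoping sums. In these bases the left generator
  becomes a bilinear form with four explicit coefficients, and these are invariant under exchanging the
  two sites together with the roles of \<open>(\<zeta>, \<lambda>)\<close> and \<open>(\<xi>, \<rho>)\<close>, which turns the left generator into
  the right one. Nonreal \<open>v\<close> and generic \<open>\<lambda>, \<rho>\<close> avoid all spurious poles; the remaining
  cases follow by continuity, since the duality function is polynomial in \<open>v\<close>.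
\<close>

section \<open>Contiguous relations for balanced \<open>4\<phi>3\<close> series\<close>

text \<open>The two generators act on different variables: the left one changes the parameters built
  from \<open>y\<close>, the right one those built from \<open>x\<close>, so the shifted functions
  on the two sides are not the same. Shifting \<open>v\<close> moves a factor \<open>Q\<close>
  between the two lower parameters and leaves all upper ones alone; it is neutral between
  \<open>y\<close> and \<open>x\<close>, which is why it supplies a common basis. In the contiguous
  relations the shifted functions carry many factors. A jump rate times the change of the prefactors
  of \<open>p_AW\<close> supplies them, so each jump contributes a product of two linear forms over
  an explicit denominator. These denominators contain \<open>H - 1\<close>, \<open>1 - H * Q\<close>
  and \<open>H - Q\<close>, which have no counterpart on the other side. In three of the four
  coefficients they cancel; in the fourth they are removed by the diagonal part of the generator,
  the total jump rate times the unshifted product. Exchanging the sites replaces \<open>v\<close> by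
  its inverse. The series do not notice this; the prefactors do, but their quotients along a jump do
  not.\<close>

lemma qpoch_0 [simp]: "qpoch a b 0 = 1"
  by (simp add: qpoch_def)

lemma qpoch_Suc: "qpoch a b (Suc n) = qpoch a b n * (1 - a * b ^ n)"
  by (simp add: qpoch_def)

lemma qpoch_shift: "(1 - a) * qpoch (a * b) b n = qpoch a b n * (1 - a * b ^ n)"
proof (induction n)
  case (Suc n)
  have "(1 - a) * qpoch (a * b) b (Suc n) = (1 - a) * qpoch (a * b) b n * (1 - a * b ^ Suc n)"
    by (simp add: qpoch_Suc mult_ac)
  also have "\<dots> = qpoch a b (Suc n) * (1 - a * b ^ Suc n)"
    unfolding Suc.IH by (simp add: qpoch_Suc)
  finally show ?case .
qed simp

lemma qpoch_nonzero: "(\<And>n. a * b ^ n \<noteq> 1) \<Longrightarrow> qpoch a b n \<noteq> 0"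
  by (simp add: qpoch_def)

lemma qpoch_eq_0_mono: "qpoch a b N = 0 \<Longrightarrow> N \<le> n \<Longrightarrow> qpoch a b n = 0"
  by (auto simp: qpoch_def)

definition aw_term ::
  "complex \<Rightarrow> complex \<Rightarrow> complex \<Rightarrow> complex \<Rightarrow> complex \<Rightarrow> complex \<Rightarrow> complex \<Rightarrow> complex \<Rightarrow> nat \<Rightarrow> complex" where
  "aw_term Q a b c d e f g n =
     (qpoch a Q n * qpoch b Q n * qpoch c Q n * qpoch d Q n) /
     (qpoch e Q n * qpoch f Q n * qpoch g Q n) * (Q ^ n / qpoch Q Q n)"

abbreviation aw_phi where
  "aw_phi Q a b c d e f g \<equiv> phi43 a b c d e f g Q Q"

lemma aw_phi_eq_sum:
  assumes "\<And>n. n \<ge> N \<Longrightarrow> qpoch a Q n * qpoch b Q n * qpoch c Q n * qpoch d Q n = 0"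
  shows "aw_phi Q a b c d e f g = (\<Sum>n<N. aw_term Q a b c d e f g n)"
  unfolding phi43_def aw_term_def
  by (rule suminf_finite) (use assms in \<open>auto simp: not_less\<close>)

text \<open>
  The summand is \<open>T (n + 1) - T n\<close>; multiplying a term of the series by a polynomial in \<open>Q ^ n\<close> shifts
  its parameters, so every choice of \<open>\<tau>\<close> gives a linear relation between contiguous series.
\<close>

lemma sum_telescope_aw:
  fixes \<tau> :: "nat \<Rightarrow> complex"
  assumes nz: "\<And>n. e * Q ^ n \<noteq> 1" "\<And>n. f * Q ^ n \<noteq> 1" "\<And>n. g * Q ^ n \<noteq> 1" "\<And>n. Q * Q ^ n \<noteq> 1"
    and "Q \<noteq> 0"
    and N: "qpoch a Q N * qpoch b Q N * qpoch c Q N * qpoch d Q N = 0"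
  shows "(\<Sum>n<N. aw_term Q a b c d e f g n *
           (((1 - a * Q ^ n) * (1 - b * Q ^ n) * (1 - c * Q ^ n) * (1 - d * Q ^ n) * \<tau> (Suc n) -
             (1 - e * Q ^ n / Q) * (1 - f * Q ^ n / Q) * (1 - g * Q ^ n / Q) * (1 - Q ^ n) * \<tau> n) / Q ^ n)) = 0"
proof -
  \<comment> \<open>The factor \<open>1 - Q ^ n\<close> makes \<open>T 0\<close> vanish and
    termination makes \<open>T N\<close> vanish. All four factors lie one step before those of the
    denominators, so they cancel when \<open>T\<close> is taken at \<open>Suc n\<close>.\<close>
  define T where "T n = aw_term Q a b c d e f g n *
     ((1 - e * Q ^ n / Q) * (1 - f * Q ^ n / Q) * (1 - g * Q ^ n / Q) * (1 - Q ^ n) * \<tau> n / Q ^ n)" for n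
  have T_Suc: "T (Suc n) = aw_term Q a b c d e f g n *
     ((1 - a * Q ^ n) * (1 - b * Q ^ n) * (1 - c * Q ^ n) * (1 - d * Q ^ n) * \<tau> (Suc n) / Q ^ n)" for n
  proof -
    have "1 - e * Q ^ n \<noteq> 0" "1 - f * Q ^ n \<noteq> 0" "1 - g * Q ^ n \<noteq> 0" "1 - Q * Q ^ n \<noteq> 0"
      using nz[of n] by auto
    moreover have "qpoch e Q n \<noteq> 0" "qpoch f Q n \<noteq> 0" "qpoch g Q n \<noteq> 0" "qpoch Q Q n \<noteq> 0"
      using nz by (auto intro!: qpoch_nonzero)
    ultimately show ?thesis
      using \<open>Q \<noteq> 0\<close> by (simp add: T_def aw_term_def qpoch_Suc)
  qed
  have diff: "T (Suc n) - T n = aw_term Q a b c d e f g n *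
     (((1 - a * Q ^ n) * (1 - b * Q ^ n) * (1 - c * Q ^ n) * (1 - d * Q ^ n) * \<tau> (Suc n) -
       (1 - e * Q ^ n / Q) * (1 - f * Q ^ n / Q) * (1 - g * Q ^ n / Q) * (1 - Q ^ n) * \<tau> n) / Q ^ n)" for n
    unfolding T_Suc unfolding T_def by (simp flip: diff_divide_distrib right_diff_distrib)
  have "(\<Sum>n<N. T (Suc n) - T n) = T N - T 0"
    by (rule sum_lessThan_telescope)
  also have "T N = 0" using N by (auto simp: T_def aw_term_def)
  also have "T 0 = 0" by (simp add: T_def)
  finally have "(\<Sum>n<N. T (Suc n) - T n) = 0" by simp
  then show ?thesis
    by (simp only: diff)
qed

text \<open>
  Parametrizes the balancing relation by free variables: polynomial identities modulo the
  relation become plain polynomial identities, which \<open>algebra\<close> decides much faster.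
\<close>

lemma balanced_cases:
  fixes a b c d e f g k :: complex
  assumes "e * f * g = k * a * b * c * d" "a \<noteq> 0" "b \<noteq> 0" "e \<noteq> 0" "f \<noteq> 0"
  obtains A F B where "a = e * A" "f = A * F" "b = F * B" "g = k * B * c * d"
proof
  show "a = e * (a / e)" "f = (a / e) * (e * f / a)" "b = (e * f / a) * (a * b / (e * f))"
    "g = k * (a * b / (e * f)) * c * d"
    using assms by (simp_all add: field_simps)
qed

text \<open>Here \<open>z\<close> stands for \<open>Q ^ n\<close> and the multiplier
  \<open>\<tau>\<close> is constant. On the right the constant terms cancel, and the balancing
  relation cancels the \<open>z ^ 4\<close> terms; what remains is \<open>z\<close> times a
  quadratic, expanded in the three quadratics by which the series of \<open>aw_phi_shift\<close>
  differ from a common one. At \<open>z = 1 / a\<close> and \<open>z = 1 / f\<close> only one of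
  these survives, so the first two coefficients factor.\<close>

lemma telescoping_poly_shift:
  fixes a b c d e f g Q z :: complex
  assumes "e * f * g = Q * a * b * c * d" "Q \<noteq> 0" "a \<noteq> 0" "b \<noteq> 0" "e \<noteq> 0" "f \<noteq> 0"
  shows "z * ((1 - a) * (f - g) * (a * Q - e) * (a * Q - g * Q) * b * f * (1 - b * z) * (1 - f * z)
     - a * Q * (- b * Q * (f - c) * (f - d) * (f - b) * (a - b)) * (1 - a * z) * (1 - g * z)
     - a * Q * ((f - g) * f * (1 - b) * (b * Q - e) * (b - g)
               + b * (f - c) * (f - d) * (g - b) * (a - b) * Q) * (1 - a * z) * (1 - f * z))
   = Q^2 * a * b * f * (a - b) * (f - g) * ((1 - a*z)*(1-b*z)*(1-c*z)*(1-d*z) - (1-e*z/Q)*(1-f*z)*(1-g*z)*(1-z))"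
proof -
  obtain A F B where AFB: "a = e * A" "f = A * F" "b = F * B" "g = Q * B * c * d"
    using assms by (elim balanced_cases)
  have "z * ((1 - a) * (f - g) * (a * Q - e) * (a * Q - g * Q) * b * f * (1 - b * z) * (1 - f * z)
     - a * Q * (- b * Q * (f - c) * (f - d) * (f - b) * (a - b)) * (1 - a * z) * (1 - g * z)
     - a * Q * ((f - g) * f * (1 - b) * (b * Q - e) * (b - g)
               + b * (f - c) * (f - d) * (g - b) * (a - b) * Q) * (1 - a * z) * (1 - f * z))
   = Q * a * b * f * (a - b) * (f - g) * (Q*(1 - a*z)*(1-b*z)*(1-c*z)*(1-d*z) - (Q-e*z)*(1-f*z)*(1-g*z)*(1-z))"
    unfolding AFB by algebra
  also have "Q - e * z = Q * (1 - e * z / Q)"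
    using assms(2) by (simp add: right_diff_distrib)
  also have "Q * a * b * f * (a - b) * (f - g) * (Q * (1 - a*z)*(1-b*z)*(1-c*z)*(1-d*z) - Q * x *(1-f*z)*(1-g*z)*(1-z)) =
    Q^2 * a * b * f * (a - b) * (f - g) * ((1 - a*z)*(1-b*z)*(1-c*z)*(1-d*z) - x *(1-f*z)*(1-g*z)*(1-z))" for x
    by (simp add: power2_eq_square mult.assoc flip: right_diff_distrib)
  finally show ?thesis .
qed

text \<open>The same count of degrees, for a common series with lower parameters
  \<open>f * Q\<close> and \<open>g * Q * Q\<close>. At \<open>z = 1 / (g * Q)\<close> only the
  first quadratic survives, which explains its coefficient.\<close>

lemma telescoping_poly_raise:
  fixes a b c d e f g Q z :: complex
  assumes "e * f * g = a * b * c * d" "Q \<noteq> 0" "a \<noteq> 0" "b \<noteq> 0" "e \<noteq> 0" "f \<noteq> 0"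
  shows "z * ((1 - c * z) * (1 - d * z) * (g * Q - a) * (g * Q - b) * (f - g) * c * d * Q
      + g * Q * (c - f) * (d - f) * (Q * c * d - e) * (1 - g * Q * z) * (1 - g * z)
      - g * Q * (c * d * Q * (c * d - g * (c + d) + g + f * g - f) + e * (c * d * (g - 1 - f) + f * d + f * c - f * g))
          * (1 - f * z) * (1 - g * Q * z))
   = (f - g) * c * d * Q ^ 2 * g * ((1 - a*z)*(1-b*z)*(1-c*z)*(1-d*z) - (1-e*z/Q)*(1-f*z)*(1-g*Q*z)*(1-z))"
proof -
  have "e * f * g = 1 * a * b * c * d" using assms by simp
  then obtain A F B where AFB: "a = e * A" "f = A * F" "b = F * B" "g = 1 * B * c * d"
    using assms by (elim balanced_cases)
  have "z * ((1 - c * z) * (1 - d * z) * (g * Q - a) * (g * Q - b) * (f - g) * c * d * Q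
      + g * Q * (c - f) * (d - f) * (Q * c * d - e) * (1 - g * Q * z) * (1 - g * z)
      - g * Q * (c * d * Q * (c * d - g * (c + d) + g + f * g - f) + e * (c * d * (g - 1 - f) + f * d + f * c - f * g))
          * (1 - f * z) * (1 - g * Q * z))
   = (f - g) * c * d * Q * g * (Q*(1 - a*z)*(1-b*z)*(1-c*z)*(1-d*z) - (Q-e*z)*(1-f*z)*(1-g*Q*z)*(1-z))"
    unfolding AFB by algebra
  also have "Q - e * z = Q * (1 - e * z / Q)"
    using assms(2) by (simp add: right_diff_distrib)
  also have "(f - g) * c * d * Q * g * (Q*(1 - a*z)*(1-b*z)*(1-c*z)*(1-d*z) - Q*x*(1-f*z)*(1-g*Q*z)*(1-z)) =
    (f - g) * c * d * Q ^ 2 * g * ((1 - a*z)*(1-b*z)*(1-c*z)*(1-d*z) - x*(1-f*z)*(1-g*Q*z)*(1-z))" for x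
    by (simp add: power2_eq_square mult_ac flip: right_diff_distrib)
  finally show ?thesis .
qed

text \<open>
  The \<open>\<tau>\<close> for the lowered series: up to a constant factor, the linear function whose values at \<open>1 / c\<close> and
  \<open>1 / d\<close>, where the other two series of the relation do not contribute, are forced by that relation.
\<close>

definition aw_theta :: "complex \<Rightarrow> complex \<Rightarrow> complex \<Rightarrow> complex \<Rightarrow> complex \<Rightarrow> complex \<Rightarrow> complex" where
  "aw_theta Q c d e f z =
     c * d * Q^2 + c * d * Q * e - c * Q * e - d * Q * e - c * d * Q * f + e * f
     + z * (c * d * (c + d) * Q * f - c^2 * d^2 * Q^2 + c * d * Q * e - c * d * Q * f - c * d * e * f)"

text \<open>With a constant multiplier the \<open>z ^ 4\<close> terms would differ by a factor
  \<open>Q\<close>. A linear multiplier, taken at \<open>Q * z\<close> and at \<open>z\<close>,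
  makes up for this factor and leaves \<open>z\<close> times a cubic. At \<open>z = 1 / g\<close>
  and \<open>z = 1 / (f * Q)\<close> a single cubic survives; the first gives the coefficient with
  \<open>aw_theta\<close> at \<open>Q / g\<close>, the second calls for \<open>aw_theta\<close> at
  \<open>1 / f\<close>, which factors.\<close>

lemma telescoping_poly_lower:
  fixes a b c d e f g Q z :: complex
  assumes rel: "e * f * g = Q * a * b * c * d" and nz: "Q \<noteq> 0" "a \<noteq> 0" "b \<noteq> 0" "e \<noteq> 0" "f \<noteq> 0" "g \<noteq> 0"
  shows "z * ((c * Q - e) * (d * Q - e) * (f * Q - g) * (1 - c) * (1 - d) * (1 - f * z) * (1 - f * Q * z) * (1 - g * z)
      + (f * Q - a) * (f * Q - b) * ((c - f) * (d - f) * Q * (e - c * d * Q) / f) * (1 - c * z) * (1 - d * z) * (1 - g * z)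
      - (g - a) * (g - b) * aw_theta Q c d e (f * Q) (Q / g) * (1 - c * z) * (1 - d * z) * (1 - f * Q * z))
   = (f * Q - g) * ((1 - a*z)*(1-b*z)*(1-c*z)*(1-d*z) * aw_theta Q c d e (f * Q) (Q * z) 
        - (1-e*z/Q)*(1-f*Q*z)*(1-g*z)*(1-z) * aw_theta Q c d e (f * Q) z)" (is "?L = ?R")
proof -
  obtain A F B where AFB: "a = e * A" "f = A * F" "b = F * B" "g = Q * B * c * d"
    using assms by (elim balanced_cases)
  define t0 where "t0 = c * d * Q^2 + c * d * Q * e - c * Q * e - d * Q * e - c * d * Q * (f*Q) + e * (f*Q)"
  define t1 where "t1 = c * d * (c + d) * Q * (f*Q) - c^2 * d^2 * Q^2 + c * d * Q * e - c * d * Q * (f*Q) - c * d * e * (f*Q)"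
  have th: "aw_theta Q c d e (f * Q) z = t0 + z * t1" for z
    by (simp add: aw_theta_def t0_def t1_def)
  \<comment> \<open>Multiplied by \<open>f * g * Q\<close>, so that a polynomial identity without
    divisions is left.\<close>
  have "z * ((c * Q - e) * (d * Q - e) * (f * Q - g) * (1 - c) * (1 - d) * (1 - f * z) * (1 - f * Q * z) * (1 - g * z) * f * g
      + (f * Q - a) * (f * Q - b) * ((c - f) * (d - f) * Q * (e - c * d * Q)) * (1 - c * z) * (1 - d * z) * (1 - g * z) * g
      - (g - a) * (g - b) * (g * t0 + Q * t1) * (1 - c * z) * (1 - d * z) * (1 - f * Q * z) * f) * Q
   = (f * Q - g) * ((1 - a*z)*(1-b*z)*(1-c*z)*(1-d*z) * (t0 + Q * z * t1) * Q
        - (Q-e*z)*(1-f*Q*z)*(1-g*z)*(1-z) * (t0 + z * t1)) * f * g" (is "?L' = ?R'")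
    unfolding t0_def t1_def unfolding AFB by algebra
  moreover have "?L' = ?L * (f * g * Q)"
  proof -
    have aux: "z * (x + y * p * w1 * w2 * w3 - v * q * u1 * u2 * u3) * (f * g * Q) =
          z * (x * f * g + y * (p * f) * w1 * w2 * w3 * g - v * (g * q) * u1 * u2 * u3 * f) * Q"
      for x y p w1 w2 w3 v q u1 u2 u3 :: complex by algebra
    have "((c - f) * (d - f) * Q * (e - c * d * Q)) / f * f = (c - f) * (d - f) * Q * (e - c * d * Q)"
      "g * (t0 + Q / g * t1) = g * t0 + Q * t1"
      using nz by (simp_all add: distrib_left)
    then show ?thesis
      unfolding th aux by (simp only:)
  qed
  moreover have "?R' = ?R * (f * g * Q)"
  proof -
    have aux: "(f * Q - g) * (x * T - k * y1 * y2 * y3 * S) * (f * g * Q) =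
      (f * Q - g) * (x * T * Q - (Q * k) * y1 * y2 * y3 * S) * f * g" for x T k y1 y2 y3 S :: complex
      by algebra
    have "Q * (1 - e * z / Q) = Q - e * z"
      using nz by (simp add: right_diff_distrib)
    then show ?thesis
      unfolding th aux by (simp only: mult.assoc)
  qed
  ultimately show ?thesis using nz by simp
qed

section \<open>Termwise shifts of parameters, and the three relations between series\<close>

lemma aw_term_shift_num:
  "(1 - a) * aw_term Q (a * Q) b c d e f g n = (1 - a * Q ^ n) * aw_term Q a b c d e f g n"
  "(1 - b) * aw_term Q a (b * Q) c d e f g n = (1 - b * Q ^ n) * aw_term Q a b c d e f g n"
  "(1 - c) * aw_term Q a b (c * Q) d e f g n = (1 - c * Q ^ n) * aw_term Q a b c d e f g n"
  "(1 - d) * aw_term Q a b c (d * Q) e f g n = (1 - d * Q ^ n) * aw_term Q a b c d e f g n"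
  using qpoch_shift[of a Q n] qpoch_shift[of b Q n] qpoch_shift[of c Q n] qpoch_shift[of d Q n]
  by (simp_all add: aw_term_def mult_ac)

lemma qpoch_shift_inverse:
  assumes "a * b ^ n \<noteq> 1" "a \<noteq> 1"
  shows "(1 - a) / qpoch a b n = (1 - a * b ^ n) / qpoch (a * b) b n"
proof -
  have "qpoch (a * b) b n = qpoch a b n * (1 - a * b ^ n) / (1 - a)"
    using qpoch_shift[of a b n] assms(2) by (simp add: field_simps)
  then show ?thesis using assms by simp
qed

lemma aw_term_shift_denom:
  assumes "f * Q ^ n \<noteq> 1" "f \<noteq> 1"
  shows "(1 - f) * aw_term Q a b c d e f g n = (1 - f * Q ^ n) * aw_term Q a b c d e (f * Q) g n"
    and "(1 - f) * aw_term Q a b c d e g f n = (1 - f * Q ^ n) * aw_term Q a b c d e g (f * Q) n"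
proof -
  have *: "(1 - f) * aw_term Q a b c d e f g n = (1 - f) / qpoch f Q n *
      ((qpoch a Q n * qpoch b Q n * qpoch c Q n * qpoch d Q n) / (qpoch e Q n * qpoch g Q n) * (Q ^ n / qpoch Q Q n))"
    for f g by (simp add: aw_term_def)
  show "(1 - f) * aw_term Q a b c d e f g n = (1 - f * Q ^ n) * aw_term Q a b c d e (f * Q) g n"
    unfolding * qpoch_shift_inverse[OF assms] by (simp add: aw_term_def)
  then show "(1 - f) * aw_term Q a b c d e g f n = (1 - f * Q ^ n) * aw_term Q a b c d e g (f * Q) n"
    by (simp add: aw_term_def mult_ac)
qed

lemma sum_combination3:
  fixes A B C :: complex
  shows "A * (\<Sum>n<N. s n * (p n * p' n)) - B * (\<Sum>n<N. s n * (q n * q' n)) - C * (\<Sum>n<N. s n * (r n * r' n))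
    = (\<Sum>n<N. s n * (A * p n * p' n - B * q n * q' n - C * r n * r' n))"
  by (simp add: sum_distrib_left sum_subtractf right_diff_distrib mult_ac)

lemma mult_chain:
  fixes x :: complex
  assumes "p * x = p' * y" "q * y = q' * z"
  shows "p * q * x = p' * q' * z"
  using assms by (metis mult.assoc mult.left_commute)

lemma scale_by_quotient:
  fixes z :: complex
  assumes "z * X = K * Y" "z \<noteq> 0"
  shows "s * X = K * (s * (Y / z))"
  using assms by (simp add: field_simps)

text \<open>Moves a factor \<open>Q\<close> between \<open>a\<close> and \<open>b\<close>, as a
  change of \<open>y\<close> alone does. Both lower parameters and the pair \<open>c\<close>,
  \<open>d\<close> stay in place for this move, and \<open>c\<close> provides the
  termination.\<close>

lemma aw_phi_shift:
  fixes a b c d e f g Q :: complex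
  assumes rel: "e * f * g = Q * a * b * c * d"
    and nz: "Q \<noteq> 0" "a \<noteq> 0" "b \<noteq> 0" "e \<noteq> 0" "f \<noteq> 0" "a \<noteq> 1"
    and den: "\<And>n. e * Q ^ n \<noteq> 1" "\<And>n. f * Q ^ n \<noteq> 1" "\<And>n. g * Q ^ n \<noteq> 1" "\<And>n. Q * Q ^ n \<noteq> 1"
    and N: "qpoch c Q N = 0"
  shows "(f - g) * (a * Q - e) * (a - g) * b * f * (1 - b) * (1 - f) * aw_phi Q a (b * Q) c d e f (g * Q) =
    a * (((f - g) * f * (1 - b) * (b * Q - e) * (b - g) + b * Q * (f - c) * (f - d) * (g - b) * (a - b))
           * ((1 - f) * aw_phi Q (a * Q) b c d e f (g * Q))
       - b * Q * (f - c) * (f - d) * (f - b) * (a - b) * ((1 - g) * aw_phi Q (a * Q) b c d e (f * Q) g))"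
proof -
  \<comment> \<open>A common term: up to a constant, each series of the relation has this term times
    two linear factors in \<open>Q ^ n\<close>.\<close>
  let ?s = "aw_term Q a b c d e (f * Q) (g * Q)"
  have phi: "aw_phi Q a b c d e f g = (\<Sum>n<N. aw_term Q a b c d e f g n)" for a b d e f g
    by (rule aw_phi_eq_sum) (simp add: qpoch_eq_0_mono[OF N])
  have den': "e * Q ^ n \<noteq> 1" "f * Q * Q ^ n \<noteq> 1" "g * Q * Q ^ n \<noteq> 1" "Q * Q ^ n \<noteq> 1" for n
    using den(1)[of n] den(2)[of "Suc n"] den(3)[of "Suc n"] den(4)[of n] by (simp_all add: mult_ac)
  have ne1: "f \<noteq> 1" "g \<noteq> 1"
    using den(2,3)[of 0] by simp_all
  have 1: "(1 - b) * (1 - f) * aw_phi Q a (b * Q) c d e f (g * Q) =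
      (\<Sum>n<N. ?s n * ((1 - b * Q ^ n) * (1 - f * Q ^ n)))"
    unfolding phi sum_distrib_left
  proof (rule sum.cong)
    fix n
    show "(1 - b) * (1 - f) * aw_term Q a (b * Q) c d e f (g * Q) n = ?s n * ((1 - b * Q ^ n) * (1 - f * Q ^ n))"
      using aw_term_shift_num(2)[of b Q a c d e "f * Q" "g * Q" n]
        aw_term_shift_denom(1)[OF den(2)[of n] ne1(1), where a=a and b="b * Q" and c=c and d=d and e=e and g="g * Q"] by (simp add: mult_ac)
  qed simp
  have 2: "(1 - a) * ((1 - f) * aw_phi Q (a * Q) b c d e f (g * Q)) =
      (\<Sum>n<N. ?s n * ((1 - a * Q ^ n) * (1 - f * Q ^ n)))"
    unfolding phi sum_distrib_left
  proof (rule sum.cong)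
    fix n
    show "(1 - a) * ((1 - f) * aw_term Q (a * Q) b c d e f (g * Q) n) = ?s n * ((1 - a * Q ^ n) * (1 - f * Q ^ n))"
      using aw_term_shift_num(1)[of a Q b c d e "f * Q" "g * Q" n]
        aw_term_shift_denom(1)[OF den(2)[of n] ne1(1), where a="a * Q" and b=b and c=c and d=d and e=e and g="g * Q"] by (simp add: mult_ac)
  qed simp
  have 3: "(1 - a) * ((1 - g) * aw_phi Q (a * Q) b c d e (f * Q) g) =
      (\<Sum>n<N. ?s n * ((1 - a * Q ^ n) * (1 - g * Q ^ n)))"
    unfolding phi sum_distrib_left
  proof (rule sum.cong)
    fix n
    show "(1 - a) * ((1 - g) * aw_term Q (a * Q) b c d e (f * Q) g n) = ?s n * ((1 - a * Q ^ n) * (1 - g * Q ^ n))"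
      using aw_term_shift_num(1)[of a Q b c d e "f * Q" "g * Q" n]
        aw_term_shift_denom(2)[OF den(3)[of n] ne1(2), where a="a * Q" and b=b and c=c and d=d and e=e and g="f * Q"] by (simp add: mult_ac)
  qed simp
  let ?A = "(1 - a) * (f - g) * (a * Q - e) * (a * Q - g * Q) * b * f"
  let ?B = "a * Q * (- b * Q * (f - c) * (f - d) * (f - b) * (a - b))"
  let ?C = "a * Q * ((f - g) * f * (1 - b) * (b * Q - e) * (b - g) + b * (f - c) * (f - d) * (g - b) * (a - b) * Q)"
  let ?K = "Q^2 * a * b * f * (a - b) * (f - g)"
  have "?A * ((1 - b) * (1 - f) * aw_phi Q a (b * Q) c d e f (g * Q))
      - ?B * ((1 - a) * ((1 - g) * aw_phi Q (a * Q) b c d e (f * Q) g))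
      - ?C * ((1 - a) * ((1 - f) * aw_phi Q (a * Q) b c d e f (g * Q)))
    = (\<Sum>n<N. ?s n * (?A * (1 - b * Q ^ n) * (1 - f * Q ^ n) - ?B * (1 - a * Q ^ n) * (1 - g * Q ^ n)
         - ?C * (1 - a * Q ^ n) * (1 - f * Q ^ n)))"
    unfolding 1 2 3 by (rule sum_combination3)
  also have "\<dots> = (\<Sum>n<N. ?K * (?s n * (((1 - a * Q ^ n) * (1 - b * Q ^ n) * (1 - c * Q ^ n) * (1 - d * Q ^ n) * 1 -
             (1 - e * Q ^ n / Q) * (1 - f * Q * Q ^ n / Q) * (1 - g * Q * Q ^ n / Q) * (1 - Q ^ n) * 1) / Q ^ n)))"
  proof (rule sum.cong)
    fix n
    have "f * Q * Q ^ n / Q = f * Q ^ n" "g * Q * Q ^ n / Q = g * Q ^ n" "Q ^ n \<noteq> 0"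
      using nz(1) by simp_all
    then show "?s n * (?A * (1 - b * Q ^ n) * (1 - f * Q ^ n) - ?B * (1 - a * Q ^ n) * (1 - g * Q ^ n)
         - ?C * (1 - a * Q ^ n) * (1 - f * Q ^ n)) =
       ?K * (?s n * (((1 - a * Q ^ n) * (1 - b * Q ^ n) * (1 - c * Q ^ n) * (1 - d * Q ^ n) * 1 -
             (1 - e * Q ^ n / Q) * (1 - f * Q * Q ^ n / Q) * (1 - g * Q * Q ^ n / Q) * (1 - Q ^ n) * 1) / Q ^ n))"
      using telescoping_poly_shift[OF rel nz(1-5), of "Q ^ n"] by (intro scale_by_quotient) (simp_all only: mult_1_right not_False_eq_True)
  qed simp
  also have "\<dots> = 0"
    unfolding sum_distrib_left[symmetric]
    by (subst sum_telescope_aw[where \<tau> = "\<lambda>_. 1"]) (use den' nz N in auto)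
  finally have "Q * (1 - a) * ((f - g) * (a * Q - e) * (a - g) * b * f * (1 - b) * (1 - f) * aw_phi Q a (b * Q) c d e f (g * Q)
    - a * (((f - g) * f * (1 - b) * (b * Q - e) * (b - g) + b * Q * (f - c) * (f - d) * (g - b) * (a - b))
           * ((1 - f) * aw_phi Q (a * Q) b c d e f (g * Q))
       - b * Q * (f - c) * (f - d) * (f - b) * (a - b) * ((1 - g) * aw_phi Q (a * Q) b c d e (f * Q) g))) = 0"
    by algebra
  then show ?thesis using nz by simp
qed

text \<open>Multiplies \<open>c\<close>, \<open>d\<close> and both lower parameters of the series
  with \<open>f\<close>, \<open>g * Q\<close> by \<open>Q\<close>: the effect of removing a particle
  while the adjoining height rises by 2. Since \<open>c\<close> and \<open>d\<close> move,
  termination is taken from \<open>a\<close>.\<close>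

lemma aw_phi_raise:
  fixes a b c d e f g Q :: complex
  assumes rel: "e * f * g = a * b * c * d"
    and nz: "Q \<noteq> 0" "a \<noteq> 0" "b \<noteq> 0" "e \<noteq> 0" "f \<noteq> 0"
    and den: "\<And>n. e * Q ^ n \<noteq> 1" "\<And>n. f * Q ^ n \<noteq> 1" "\<And>n. g * Q ^ n \<noteq> 1" "\<And>n. Q * Q ^ n \<noteq> 1"
    and N: "qpoch a Q N = 0"
  shows "(g * Q - a) * (g * Q - b) * (f - g) * c * d * ((1 - c) * (1 - d) * aw_phi Q a b (c * Q) (d * Q) e (f * Q) (g * Q * Q)) =
    (1 - g * Q) * g * ((c * d * Q * (c * d - g * (c + d) + g + f * g - f) + e * (c * d * (g - 1 - f) + f * d + f * c - f * g))
           * ((1 - f) * aw_phi Q a b c d e f (g * Q))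
       - (c - f) * (d - f) * (Q * c * d - e) * ((1 - g) * aw_phi Q a b c d e (f * Q) g))"
proof -
  let ?s = "aw_term Q a b c d e (f * Q) (g * Q * Q)"
  have phi: "aw_phi Q a b c d e f g = (\<Sum>n<N. aw_term Q a b c d e f g n)" for b c d e f g
    by (rule aw_phi_eq_sum) (simp add: qpoch_eq_0_mono[OF N])
  have den': "e * Q ^ n \<noteq> 1" "f * Q * Q ^ n \<noteq> 1" "g * Q * Q * Q ^ n \<noteq> 1" "Q * Q ^ n \<noteq> 1"
     and denQ: "g * Q * Q ^ n \<noteq> 1" for n
    using den(1)[of n] den(2)[of "Suc n"] den(3)[of "Suc n"] den(3)[of "Suc (Suc n)"] den(4)[of n]
    by (simp_all add: mult_ac)
  have ne1: "f \<noteq> 1" "g \<noteq> 1" "g * Q \<noteq> 1"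
    using den(2,3)[of 0] den(3)[of 1] by simp_all
  have 1: "(1 - c) * (1 - d) * aw_phi Q a b (c * Q) (d * Q) e (f * Q) (g * Q * Q) =
      (\<Sum>n<N. ?s n * ((1 - c * Q ^ n) * (1 - d * Q ^ n)))"
    unfolding phi sum_distrib_left
  proof (rule sum.cong)
    fix n
    show "(1 - c) * (1 - d) * aw_term Q a b (c * Q) (d * Q) e (f * Q) (g * Q * Q) n = ?s n * ((1 - c * Q ^ n) * (1 - d * Q ^ n))"
      using mult_chain[OF aw_term_shift_num(3)[of c Q a b "d * Q" e "f * Q" "g * Q * Q" n]
        aw_term_shift_num(4)[of d Q a b c e "f * Q" "g * Q * Q" n]] by (simp add: mult_ac)
  qed simp
  have 2: "(1 - g * Q) * ((1 - f) * aw_phi Q a b c d e f (g * Q)) =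
      (\<Sum>n<N. ?s n * ((1 - f * Q ^ n) * (1 - g * Q * Q ^ n)))"
    unfolding phi sum_distrib_left
  proof (rule sum.cong)
    fix n
    show "(1 - g * Q) * ((1 - f) * aw_term Q a b c d e f (g * Q) n) = ?s n * ((1 - f * Q ^ n) * (1 - g * Q * Q ^ n))"
      using aw_term_shift_denom(2)[OF denQ[of n] ne1(3), where a=a and b=b and c=c and d=d and e=e and g="f * Q"]
        aw_term_shift_denom(1)[OF den(2)[of n] ne1(1), where a=a and b=b and c=c and d=d and e=e and g="g * Q"]
      by (simp add: mult_ac)
  qed simp
  have 3: "(1 - g * Q) * ((1 - g) * aw_phi Q a b c d e (f * Q) g) =
      (\<Sum>n<N. ?s n * ((1 - g * Q * Q ^ n) * (1 - g * Q ^ n)))"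
    unfolding phi sum_distrib_left
  proof (rule sum.cong)
    fix n
    show "(1 - g * Q) * ((1 - g) * aw_term Q a b c d e (f * Q) g n) = ?s n * ((1 - g * Q * Q ^ n) * (1 - g * Q ^ n))"
      using aw_term_shift_denom(2)[OF denQ[of n] ne1(3), where a=a and b=b and c=c and d=d and e=e and g="f * Q"]
        aw_term_shift_denom(2)[OF den(3)[of n] ne1(2), where a=a and b=b and c=c and d=d and e=e and g="f * Q"]
      by (simp add: mult_ac)
  qed simp
  let ?A = "(g * Q - a) * (g * Q - b) * (f - g) * c * d * Q"
  let ?B = "- (g * Q * (c - f) * (d - f) * (Q * c * d - e))"
  let ?C = "g * Q * (c * d * Q * (c * d - g * (c + d) + g + f * g - f) + e * (c * d * (g - 1 - f) + f * d + f * c - f * g))"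
  let ?K = "(f - g) * c * d * Q ^ 2 * g"
  have "?A * ((1 - c) * (1 - d) * aw_phi Q a b (c * Q) (d * Q) e (f * Q) (g * Q * Q))
      - ?B * ((1 - g * Q) * ((1 - g) * aw_phi Q a b c d e (f * Q) g))
      - ?C * ((1 - g * Q) * ((1 - f) * aw_phi Q a b c d e f (g * Q)))
    = (\<Sum>n<N. ?s n * (?A * (1 - c * Q ^ n) * (1 - d * Q ^ n) - ?B * (1 - g * Q * Q ^ n) * (1 - g * Q ^ n)
         - ?C * (1 - f * Q ^ n) * (1 - g * Q * Q ^ n)))"
    unfolding 1 2 3 by (rule sum_combination3)
  also have "\<dots> = (\<Sum>n<N. ?K * (?s n * (((1 - a * Q ^ n) * (1 - b * Q ^ n) * (1 - c * Q ^ n) * (1 - d * Q ^ n) * 1 -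
             (1 - e * Q ^ n / Q) * (1 - f * Q * Q ^ n / Q) * (1 - g * Q * Q * Q ^ n / Q) * (1 - Q ^ n) * 1) / Q ^ n)))"
  proof (rule sum.cong)
    fix n
    have eq: "f * Q * Q ^ n / Q = f * Q ^ n" "g * Q * Q * Q ^ n / Q = g * Q * Q ^ n" "Q ^ n \<noteq> 0"
      using nz(1) by simp_all
    have "Q ^ n * (?A * (1 - c * Q ^ n) * (1 - d * Q ^ n) - ?B * (1 - g * Q * Q ^ n) * (1 - g * Q ^ n)
         - ?C * (1 - f * Q ^ n) * (1 - g * Q * Q ^ n)) =
       ?K * ((1 - a * Q ^ n) * (1 - b * Q ^ n) * (1 - c * Q ^ n) * (1 - d * Q ^ n) -
             (1 - e * Q ^ n / Q) * (1 - f * Q ^ n) * (1 - g * Q * Q ^ n) * (1 - Q ^ n))"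
      unfolding telescoping_poly_raise[OF rel nz, of "Q ^ n", symmetric] by (simp add: mult_ac)
    then show "?s n * (?A * (1 - c * Q ^ n) * (1 - d * Q ^ n) - ?B * (1 - g * Q * Q ^ n) * (1 - g * Q ^ n)
         - ?C * (1 - f * Q ^ n) * (1 - g * Q * Q ^ n)) =
       ?K * (?s n * (((1 - a * Q ^ n) * (1 - b * Q ^ n) * (1 - c * Q ^ n) * (1 - d * Q ^ n) * 1 -
             (1 - e * Q ^ n / Q) * (1 - f * Q * Q ^ n / Q) * (1 - g * Q * Q * Q ^ n / Q) * (1 - Q ^ n) * 1) / Q ^ n))"
      using eq by (intro scale_by_quotient) (simp_all only: mult_1_right not_False_eq_True)
  qed simp
  also have "\<dots> = 0"
    unfolding sum_distrib_left[symmetric]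
    by (subst sum_telescope_aw[where \<tau> = "\<lambda>_. 1"]) (use den' nz N in auto)
  finally have "Q * ((g * Q - a) * (g * Q - b) * (f - g) * c * d * ((1 - c) * (1 - d) * aw_phi Q a b (c * Q) (d * Q) e (f * Q) (g * Q * Q)) -
    (1 - g * Q) * g * ((c * d * Q * (c * d - g * (c + d) + g + f * g - f) + e * (c * d * (g - 1 - f) + f * d + f * c - f * g))
           * ((1 - f) * aw_phi Q a b c d e f (g * Q))
       - (c - f) * (d - f) * (Q * c * d - e) * ((1 - g) * aw_phi Q a b c d e (f * Q) g))) = 0"
    by algebra
  then show ?thesis using nz by simp
qed

text \<open>The opposite move, a particle added while the adjoining height drops by 2. The series on
  the left has \<open>c\<close>, \<open>d\<close>, \<open>f\<close> and \<open>g\<close> all at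
  their lowest, so a common term takes three linear factors per series instead of two; this is where
  \<open>aw_theta\<close> enters.\<close>

lemma aw_phi_lower:
  fixes a b c d e f g Q :: complex
  assumes rel: "e * f * g = Q * a * b * c * d"
    and nz: "Q \<noteq> 0" "a \<noteq> 0" "b \<noteq> 0" "e \<noteq> 0" "f \<noteq> 0" "g \<noteq> 0" "c \<noteq> 1" "d \<noteq> 1"
    and den: "\<And>n. e * Q ^ n \<noteq> 1" "\<And>n. f * Q ^ n \<noteq> 1" "\<And>n. g * Q ^ n \<noteq> 1" "\<And>n. Q * Q ^ n \<noteq> 1"
    and N: "qpoch a Q N = 0"
  shows "(c * Q - e) * (d * Q - e) * (f * Q - g) * (1 - f) * (1 - f * Q) * (1 - g) * aw_phi Q a b c d e f g =
     (g - a) * (g - b) * aw_theta Q c d e (f * Q) (Q / g) * ((1 - f * Q) * aw_phi Q a b (c * Q) (d * Q) e (f * Q) (g * Q))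
     - (f * Q - a) * (f * Q - b) * ((c - f) * (d - f) * Q * (e - c * d * Q) / f)
        * ((1 - g) * aw_phi Q a b (c * Q) (d * Q) e (f * Q * Q) g)"
proof -
  let ?s = "aw_term Q a b c d e (f * Q * Q) (g * Q)"
  have phi: "aw_phi Q a b c d e f g = (\<Sum>n<N. aw_term Q a b c d e f g n)" for b c d e f g
    by (rule aw_phi_eq_sum) (simp add: qpoch_eq_0_mono[OF N])
  have den': "e * Q ^ n \<noteq> 1" "f * Q * Q * Q ^ n \<noteq> 1" "g * Q * Q ^ n \<noteq> 1" "Q * Q ^ n \<noteq> 1"
     and denQ: "f * Q * Q ^ n \<noteq> 1" for n
    using den(1)[of n] den(2)[of "Suc n"] den(3)[of "Suc n"] den(2)[of "Suc (Suc n)"] den(4)[of n]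
    by (simp_all add: mult_ac)
  have ne1: "f \<noteq> 1" "g \<noteq> 1" "f * Q \<noteq> 1"
    using den(2,3)[of 0] den(2)[of 1] by simp_all
  have 1: "(1 - f) * (1 - f * Q) * (1 - g) * aw_phi Q a b c d e f g =
      (\<Sum>n<N. ?s n * ((1 - f * Q ^ n) * ((1 - f * Q * Q ^ n) * (1 - g * Q ^ n))))"
    unfolding phi sum_distrib_left
  proof (rule sum.cong)
    fix n
    show "(1 - f) * (1 - f * Q) * (1 - g) * aw_term Q a b c d e f g n = ?s n * ((1 - f * Q ^ n) * ((1 - f * Q * Q ^ n) * (1 - g * Q ^ n)))"
      using mult_chain[OF mult_chain[OF
        aw_term_shift_denom(1)[OF den(2)[of n] ne1(1), where a=a and b=b and c=c and d=d and e=e and g="g"]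
        aw_term_shift_denom(1)[OF denQ[of n] ne1(3), where a=a and b=b and c=c and d=d and e=e and g="g"]]
        aw_term_shift_denom(2)[OF den(3)[of n] ne1(2), where a=a and b=b and c=c and d=d and e=e and g="f * Q * Q"]]
      by (simp add: mult_ac)
  qed simp
  have num: "(1 - c) * (1 - d) * aw_term Q a b (c * Q) (d * Q) e f g n =
      (1 - c * Q ^ n) * (1 - d * Q ^ n) * aw_term Q a b c d e f g n" for f g n
    by (rule mult_chain[OF aw_term_shift_num(3)[of c Q a b "d * Q" e f g n] aw_term_shift_num(4)[of d Q a b c e f g n]])
  have 2: "(1 - c) * (1 - d) * ((1 - f * Q) * aw_phi Q a b (c * Q) (d * Q) e (f * Q) (g * Q)) =
      (\<Sum>n<N. ?s n * ((1 - c * Q ^ n) * ((1 - d * Q ^ n) * (1 - f * Q * Q ^ n))))"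
    unfolding phi sum_distrib_left
  proof (rule sum.cong)
    fix n
    show "(1 - c) * (1 - d) * ((1 - f * Q) * aw_term Q a b (c * Q) (d * Q) e (f * Q) (g * Q) n) =
        ?s n * ((1 - c * Q ^ n) * ((1 - d * Q ^ n) * (1 - f * Q * Q ^ n)))"
      using aw_term_shift_denom(1)[OF denQ[of n] ne1(3), where a=a and b=b and c="c * Q" and d="d * Q" and e=e and g="g * Q"]
        num[of "f * Q * Q" "g * Q" n]
      by (simp add: mult_ac)
  qed simp
  have 3: "(1 - c) * (1 - d) * ((1 - g) * aw_phi Q a b (c * Q) (d * Q) e (f * Q * Q) g) =
      (\<Sum>n<N. ?s n * ((1 - c * Q ^ n) * ((1 - d * Q ^ n) * (1 - g * Q ^ n))))"
    unfolding phi sum_distrib_left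
  proof (rule sum.cong)
    fix n
    show "(1 - c) * (1 - d) * ((1 - g) * aw_term Q a b (c * Q) (d * Q) e (f * Q * Q) g n) =
        ?s n * ((1 - c * Q ^ n) * ((1 - d * Q ^ n) * (1 - g * Q ^ n)))"
      using aw_term_shift_denom(2)[OF den(3)[of n] ne1(2), where a=a and b=b and c="c * Q" and d="d * Q" and e=e and g="f * Q * Q"]
        num[of "f * Q * Q" "g * Q" n]
      by (simp add: mult_ac)
  qed simp
  define p where "p = (c - f) * (d - f) * Q * (e - c * d * Q) / f"
  let ?\<theta> = "aw_theta Q c d e (f * Q)"
  let ?A = "(c * Q - e) * (d * Q - e) * (f * Q - g) * (1 - c) * (1 - d)"
  let ?B = "- ((f * Q - a) * (f * Q - b) * p)"
  let ?C = "(g - a) * (g - b) * ?\<theta> (Q / g)"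
  let ?K = "f * Q - g"
  have "?A * ((1 - f) * (1 - f * Q) * (1 - g) * aw_phi Q a b c d e f g)
      - ?B * ((1 - c) * (1 - d) * ((1 - g) * aw_phi Q a b (c * Q) (d * Q) e (f * Q * Q) g))
      - ?C * ((1 - c) * (1 - d) * ((1 - f * Q) * aw_phi Q a b (c * Q) (d * Q) e (f * Q) (g * Q)))
    = (\<Sum>n<N. ?s n * (?A * (1 - f * Q ^ n) * ((1 - f * Q * Q ^ n) * (1 - g * Q ^ n))
         - ?B * (1 - c * Q ^ n) * ((1 - d * Q ^ n) * (1 - g * Q ^ n))
         - ?C * (1 - c * Q ^ n) * ((1 - d * Q ^ n) * (1 - f * Q * Q ^ n))))"
    unfolding 1 2 3 by (rule sum_combination3)
  also have "\<dots> = (\<Sum>n<N. ?K * (?s n * (((1 - a * Q ^ n) * (1 - b * Q ^ n) * (1 - c * Q ^ n) * (1 - d * Q ^ n) * ?\<theta> (Q ^ Suc n) -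
             (1 - e * Q ^ n / Q) * (1 - f * Q * Q * Q ^ n / Q) * (1 - g * Q * Q ^ n / Q) * (1 - Q ^ n) * ?\<theta> (Q ^ n)) / Q ^ n)))"
  proof (rule sum.cong)
    fix n
    have eq: "f * Q * Q * Q ^ n / Q = f * Q * Q ^ n" "g * Q * Q ^ n / Q = g * Q ^ n" "Q ^ n \<noteq> 0"
      using nz(1) by simp_all
    have "Q ^ n * (?A * (1 - f * Q ^ n) * ((1 - f * Q * Q ^ n) * (1 - g * Q ^ n))
         - ?B * (1 - c * Q ^ n) * ((1 - d * Q ^ n) * (1 - g * Q ^ n))
         - ?C * (1 - c * Q ^ n) * ((1 - d * Q ^ n) * (1 - f * Q * Q ^ n))) =
       ?K * ((1 - a * Q ^ n) * (1 - b * Q ^ n) * (1 - c * Q ^ n) * (1 - d * Q ^ n) * ?\<theta> (Q ^ Suc n) -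
             (1 - e * Q ^ n / Q) * (1 - f * Q * Q ^ n) * (1 - g * Q ^ n) * (1 - Q ^ n) * ?\<theta> (Q ^ n))"
      unfolding power_Suc telescoping_poly_lower[OF rel nz(1-6), of "Q ^ n", folded p_def, symmetric] by (simp add: mult_ac)
    then show "?s n * (?A * (1 - f * Q ^ n) * ((1 - f * Q * Q ^ n) * (1 - g * Q ^ n))
         - ?B * (1 - c * Q ^ n) * ((1 - d * Q ^ n) * (1 - g * Q ^ n))
         - ?C * (1 - c * Q ^ n) * ((1 - d * Q ^ n) * (1 - f * Q * Q ^ n))) =
       ?K * (?s n * (((1 - a * Q ^ n) * (1 - b * Q ^ n) * (1 - c * Q ^ n) * (1 - d * Q ^ n) * ?\<theta> (Q ^ Suc n) -
             (1 - e * Q ^ n / Q) * (1 - f * Q * Q * Q ^ n / Q) * (1 - g * Q * Q ^ n / Q) * (1 - Q ^ n) * ?\<theta> (Q ^ n)) / Q ^ n))"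
      using eq by (intro scale_by_quotient) (simp_all only: not_False_eq_True)
  qed simp
  also have "\<dots> = 0"
    unfolding sum_distrib_left[symmetric]
    by (subst sum_telescope_aw[where \<tau> = "\<lambda>n. ?\<theta> (Q ^ n)"]) (use den' nz N in auto)
  finally have "(1 - c) * (1 - d) * ((c * Q - e) * (d * Q - e) * (f * Q - g) * (1 - f) * (1 - f * Q) * (1 - g) * aw_phi Q a b c d e f g -
     (?C * ((1 - f * Q) * aw_phi Q a b (c * Q) (d * Q) e (f * Q) (g * Q))
     - (f * Q - a) * (f * Q - b) * p * ((1 - g) * aw_phi Q a b (c * Q) (d * Q) e (f * Q * Q) g))) = 0"
    by algebra
  then show ?thesis using nz unfolding p_def by simp
qed

section \<open>The two-site identity\<close>

text \<open>
  Coefficients of the functions with parameter \<open>v\<close> (index 0) and with shifted \<open>v\<close> (index 1) in the three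
  contiguous relations.
\<close>

definition shift_coeff0 :: "complex \<Rightarrow> complex \<Rightarrow> complex \<Rightarrow> complex \<Rightarrow> complex \<Rightarrow> complex \<Rightarrow> complex \<Rightarrow> complex \<Rightarrow> complex" where
  "shift_coeff0 Q a b c d e f g = (f-g)*f*(1-b)*(b*Q-e)*(b-g)+b*(f-c)*(f-d)*(g-b)*(a-b*Q)"
definition shift_coeff1 :: "complex \<Rightarrow> complex \<Rightarrow> complex \<Rightarrow> complex \<Rightarrow> complex \<Rightarrow> complex \<Rightarrow> complex" where
  "shift_coeff1 Q a b c d f = b*(f-c)*(f-d)*(f-b)*(a-b*Q)"
definition raise_coeff0 :: "complex \<Rightarrow> complex \<Rightarrow> complex \<Rightarrow> complex \<Rightarrow> complex \<Rightarrow> complex \<Rightarrow> complex" where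
  "raise_coeff0 Q c d e f g = c*d*Q*(c*d-g*(c+d)+g+f*g-f)+e*(c*d*(g-1-f)+f*d+f*c-f*g)"
definition raise_coeff1 :: "complex \<Rightarrow> complex \<Rightarrow> complex \<Rightarrow> complex \<Rightarrow> complex \<Rightarrow> complex" where
  "raise_coeff1 Q c d e f = (f-c)*(f-d)*(Q*c*d-e)"
definition lower_coeff0 :: "complex \<Rightarrow> complex \<Rightarrow> complex \<Rightarrow> complex \<Rightarrow> complex \<Rightarrow> complex \<Rightarrow> complex \<Rightarrow> complex \<Rightarrow> complex" where
  "lower_coeff0 Q a b c d e f g = (g-c)*(g-d)*(g*(Q*a*b+a*b*e-Q*(a+b)*e-a*b*f+Q*e*f)
      +(a*b*(a+b)*f-a^2*b^2+Q*a*b*e-Q*a*b*f-a*b*e*f))"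
definition lower_coeff1 :: "complex \<Rightarrow> complex \<Rightarrow> complex \<Rightarrow> complex \<Rightarrow> complex \<Rightarrow> complex \<Rightarrow> complex \<Rightarrow> complex" where
  "lower_coeff1 Q a b c d e f = (f-c)*(f-d)*(f-a)*(f-b)*(e*Q-a*b)"

lemma combine_quotients:
  fixes D :: complex
  assumes "D1 * n1 = D" "D2 * n2 = D" "D3 * n3 = D" "D \<noteq> 0" "n1 * Y1 + n2 * Y2 = n3 * Y3"
  shows "Y1 / D1 + Y2 / D2 = Y3 / D3"
proof -
  have "n1 \<noteq> 0" "n2 \<noteq> 0" "n3 \<noteq> 0" using assms by auto
  then have "Y1 / D1 = (n1 * Y1) / (D1 * n1)" "Y2 / D2 = (n2 * Y2) / (D2 * n2)" "Y3 / D3 = (n3 * Y3) / (D3 * n3)"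
    by simp_all
  then show ?thesis using assms(5) unfolding assms(1-3) by (simp add: add_divide_distrib[symmetric])
qed

lemma expand_quotient:
  fixes D :: complex
  assumes "D1 * n = D" "D \<noteq> 0"
  shows "Y / D1 = n * Y / D"
  using assms by auto

text \<open>
  With \<open>Q = q\<^sup>2\<close>, the first site has \<open>a = Q powr (- y)\<close>, \<open>b = Q powr (y + \<lambda> + k)\<close>, \<open>c = Q powr (- x)\<close>,
  \<open>d = Q powr (x + \<rho>' + k)\<close>, \<open>e = Q powr k\<close> and the lower parameters \<open>f\<close>, \<open>g\<close>; the primed variables belong
  to the second site. \<open>H\<close> and \<open>G\<close> are \<open>Q\<close> to the power of the heights \<open>h\<^sup>-\<close> and \<open>h\<^sup>+\<close> between the two sites, and
  \<open>f0\<close>, \<open>g0\<close> are the shifted lower parameters \<open>f' / Q\<close>, \<open>g / Q\<close>. The roles of \<open>f\<close> and \<open>g\<close> are interchanged on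
  the second site, so that the locale is invariant under exchanging the sites.
\<close>

locale two_site_params =
  fixes Q a b c d e a' b' c' d' e' F W H G f g f' g' f0 g0 :: complex
  assumes b: "b = a * H" and b': "a' * b' = e' * H" and d': "d' = c' * G" and d: "c * d = e * G"
    and f: "f = a * F" and g: "g = a * W" and f': "f' = c' * F" and g': "g' = c' * W"
    and FW: "F * W = Q * H * G" and f0: "f' = f0 * Q" and g0: "g = g0 * Q"
    and nz: "Q \<noteq> 0" "a \<noteq> 0" "c \<noteq> 0" "e \<noteq> 0" "a' \<noteq> 0" "c' \<noteq> 0" "e' \<noteq> 0" "F \<noteq> 0" "W \<noteq> 0" "H \<noteq> 0" "G \<noteq> 0"
    and gen: "H \<noteq> 1" "H * Q \<noteq> 1" "H \<noteq> Q" "F \<noteq> G" "H \<noteq> W" "W \<noteq> Q" "Q \<noteq> F"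
begin

lemma params:
  obtains P h k E E' where "F = Q * P" "H = P * h" "G = Q * k" "W = Q * (h * k)" "e = c * E" "e' = a' * E'"
    "d = E * (Q * k)" "d' = c' * (Q * k)" "b' = E' * (P * h)" "b = a * (P * h)" "f = a * (Q * P)" "g = a * (Q * (h * k))"
    "f' = c' * (Q * P)" "g' = c' * (Q * (h * k))" "f0 = c' * P" "g0 = a * (h * k)"
proof
  show "F = Q * (F / Q)" "H = (F / Q) * (H * Q / F)" "G = Q * (G / Q)" "e = c * (e / c)" "e' = a' * (e' / a')"
    using nz by (auto simp: field_simps)
  show W: "W = Q * ((H * Q / F) * (G / Q))" using FW nz by (auto simp: field_simps)
  show "d = (e / c) * (Q * (G / Q))" using d nz by (auto simp: field_simps)
  show "d' = c' * (Q * (G / Q))" using d' nz by (auto simp: field_simps)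
  show "b' = (e' / a') * ((F / Q) * (H * Q / F))" using b' nz by (auto simp: field_simps)
  show "b = a * ((F / Q) * (H * Q / F))" using b nz by (auto simp: field_simps)
  show "f = a * (Q * (F / Q))" "f' = c' * (Q * (F / Q))" using f f' nz by (auto simp: field_simps)
  show "f0 = c' * (F / Q)" using f0 f' nz by (auto simp: field_simps)
  show "g = a * (Q * ((H * Q / F) * (G / Q)))" "g' = c' * (Q * ((H * Q / F) * (G / Q)))"
    unfolding W[symmetric] using g g' by auto
  have "g0 * Q = a * ((H * Q / F) * (G / Q)) * Q" using g0 g W by (simp add: mult_ac)
  then show "g0 = a * ((H * Q / F) * (G / Q))" using nz(1) by (simp only: mult_cancel_right) simp
qed

lemma params_nz:
  "e * e'^2 * a^3 * H^2 * (H-1) * (1-H*Q) * (F-G) * (H-Q) * (H-W) * (W-Q) * (Q-F) \<noteq> 0"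
  "b \<noteq> 0" "d \<noteq> 0" "b' \<noteq> 0" "d' \<noteq> 0" "f \<noteq> 0" "g \<noteq> 0" "f' \<noteq> 0" "g' \<noteq> 0" "f0 \<noteq> 0" "g0 \<noteq> 0"
proof -
  show "b \<noteq> 0" "d \<noteq> 0" "b' \<noteq> 0" "d' \<noteq> 0" "f \<noteq> 0" "g \<noteq> 0" "f' \<noteq> 0" "g' \<noteq> 0" 
    using nz b d b' d' f g f' g' by auto
  then show "f0 \<noteq> 0" "g0 \<noteq> 0" using f0 g0 by auto
qed (use nz gen in auto)

text \<open>The two summands come from the two jumps, with denominators left over from rates and
  weights. The factors \<open>1 - H * Q\<close> and \<open>H - Q\<close> divide the respective
  \<open>shift_coeff1\<close>, because \<open>b = a * H\<close>; the factor \<open>H - 1\<close>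
  cancels only in the sum.\<close>

lemma form11_eq:
  "- (shift_coeff1 Q a b c d f * raise_coeff1 Q a' b' e' g') / (e*e'^2*a^3*H^2*(H-1)*(1-H*Q)*(F-G))
   + Q^3*H * (shift_coeff1 Q b a c d f * lower_coeff1 Q a' b' c' d' e' g') / (e*e'^2*c'*a^3*F*(H-1)*(H-Q)*(H-W)*(W-Q)*(Q-F)*(Q*g'))
   = Q * ((f-c)*(f-d)*(g'-a')*(g'-b') * (2*Q*(F+W)*(1+H)*(1+G)-(1+Q)*((F+W)^2+Q*(H+G)*(1+H*G)-H*G*(1-Q)^2)))
      / (e*e'*(F-G)*(H-W)*(W-Q)*(Q-F))"
  (is "?Y1 / ?D1 + ?Y2 / ?D2 = ?Y3 / ?D3")
proof (rule combine_quotients)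
  define n1 where "n1 = (H-Q)*(H-W)*(W-Q)*(Q-F)*c'*F*(Q*g')"
  define n2 where "n2 = H^2*(1-H*Q)*(F-G)"
  define n3 where "n3 = e'*a^3*H^2*(H-1)*(1-H*Q)*(H-Q)*c'*F*(Q*g')"
  show "?D2 * n2 = ?D1 * n1" "?D3 * n3 = ?D1 * n1"
    by (simp_all add: n1_def n2_def n3_def power2_eq_square mult_ac)
  show "?D1 * n1 = ?D1 * n1" by simp
  show "?D1 * n1 \<noteq> 0" using params_nz nz by (simp add: n1_def)
  let ?X = "(f-c)*(f-d)*(g'-a')*(g'-b')"
  obtain P h k E E' where eqs: "F = Q * P" "H = P * h" "G = Q * k" "W = Q * (h * k)" "e = c * E" "e' = a' * E'"
    "d = E * (Q * k)" "d' = c' * (Q * k)" "b' = E' * (P * h)" "b = a * (P * h)" "f = a * (Q * P)" "g = a * (Q * (h * k))"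
    "f' = c' * (Q * P)" "g' = c' * (Q * (h * k))" "f0 = c' * P" "g0 = a * (h * k)" by (rule params)
  have p: "- n1 * b*(f-b)*(a-b*Q)*(Q*a'*b'-e') + n2 * Q^3*H*a*(f-a)*(b-a*Q)*(g'-c')*(g'-d')*(e'*Q-a'*b')
    = n3 * Q * (2*Q*(F+W)*(1+H)*(1+G)-(1+Q)*((F+W)^2+Q*(H+G)*(1+H*G)-H*G*(1-Q)^2))"
    unfolding n1_def n2_def n3_def unfolding eqs by algebra
  have "n1 * ?Y1 + n2 * ?Y2 = ?X * (- n1 * b*(f-b)*(a-b*Q)*(Q*a'*b'-e') + n2 * Q^3*H*a*(f-a)*(b-a*Q)*(g'-c')*(g'-d')*(e'*Q-a'*b'))"
  proof -
    have "n1 * ?Y1 = ?X * (- n1 * b*(f-b)*(a-b*Q)*(Q*a'*b'-e'))"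
      by (simp add: shift_coeff1_def raise_coeff1_def mult_ac)
    moreover have "n2 * ?Y2 = ?X * (n2 * Q^3*H*a*(f-a)*(b-a*Q)*(g'-c')*(g'-d')*(e'*Q-a'*b'))"
      by (simp add: shift_coeff1_def lower_coeff1_def mult_ac)
    ultimately show ?thesis by (simp only: distrib_left)
  qed
  also have "\<dots> = n3 * ?Y3"
    unfolding p by (simp add: mult_ac)
  finally show "n1 * ?Y1 + n2 * ?Y2 = n3 * ?Y3" .
qed

lemma form10_eq:
  "- (shift_coeff1 Q a b c d f * raise_coeff0 Q a' b' e' g' f0) / (e*e'^2*a^3*H^2*(H-1)*(1-H*Q)*(F-G))
   + Q^3*H * (shift_coeff1 Q b a c d f * lower_coeff0 Q a' b' c' d' e' g' f0) / (e*e'^2*c'*a^3*F*(H-1)*(H-Q)*(H-W)*(W-Q)*(Q-F)*(Q*f0))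
   = - (c'*((f-c)*(f-d)*(Q^2*(c'*d'+e')*G*((Q+1)*H*(G+1)-(H+1)*(F+W))+Q^2*(a'+b')*d'*((Q+1)*G*(1+H)-(F+W)*(1+G))+(Q+e')*d'*(Q*F-W)*(F-Q*W))))
      / (Q*e*e'*d'*(F-G)*(W-Q))"
  (is "?Y1 / ?D1 + ?Y2 / ?D2 = ?Y3 / ?D3")
proof (rule combine_quotients)
  define n1 where "n1 = (H-Q)*(H-W)*(W-Q)*(Q-F)*c'*F*(Q*f0)*d'"
  define n2 where "n2 = H^2*(1-H*Q)*(F-G)*d'"
  define n3 where "n3 = e'*a^3*H^2*(H-1)*(1-H*Q)*(H-Q)*(H-W)*(Q-F)*F*f0*c'"
  show "?D2 * n2 = ?D1 * n1" "?D3 * n3 = ?D1 * n1"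
    by (simp_all add: n1_def n2_def n3_def power2_eq_square mult_ac)
  show "?D1 * n1 = ?D1 * n1" by simp
  show "?D1 * n1 \<noteq> 0" using params_nz nz by (simp add: n1_def)
  let ?X = "(f-c)*(f-d)"
  obtain P h k E E' where eqs: "F = Q * P" "H = P * h" "G = Q * k" "W = Q * (h * k)" "e = c * E" "e' = a' * E'"
    "d = E * (Q * k)" "d' = c' * (Q * k)" "b' = E' * (P * h)" "b = a * (P * h)" "f = a * (Q * P)" "g = a * (Q * (h * k))"
    "f' = c' * (Q * P)" "g' = c' * (Q * (h * k))" "f0 = c' * P" "g0 = a * (h * k)" by (rule params)
  have p: "- n1 * (b*(f-b)*(a-b*Q)*raise_coeff0 Q a' b' e' g' f0) + n2 * Q^3*H*(a*(f-a)*(b-a*Q)*lower_coeff0 Q a' b' c' d' e' g' f0) = n3 * (-(c'*(Q^2*(c'*d'+e')*G*((Q+1)*H*(G+1)-(H+1)*(F+W))+Q^2*(a'+b')*d'*((Q+1)*G*(1+H)-(F+W)*(1+G))+(Q+e')*d'*(Q*F-W)*(F-Q*W))))"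
    unfolding n1_def n2_def n3_def raise_coeff0_def lower_coeff0_def shift_coeff0_def raise_coeff1_def lower_coeff1_def unfolding eqs by algebra
  have "n1 * ?Y1 + n2 * ?Y2 = ?X * (- n1 * (b*(f-b)*(a-b*Q)*raise_coeff0 Q a' b' e' g' f0) + n2 * Q^3*H*(a*(f-a)*(b-a*Q)*lower_coeff0 Q a' b' c' d' e' g' f0))"
  proof -
    have "n1 * ?Y1 = ?X * (- n1 * (b*(f-b)*(a-b*Q)*raise_coeff0 Q a' b' e' g' f0))"
      by (simp add: shift_coeff1_def mult_ac)
    moreover have "n2 * ?Y2 = ?X * (n2 * Q^3*H*(a*(f-a)*(b-a*Q)*lower_coeff0 Q a' b' c' d' e' g' f0))"
      by (simp add: shift_coeff1_def mult_ac)
    ultimately show ?thesis by (simp only: distrib_left)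
  qed
  also have "\<dots> = n3 * ?Y3"
    unfolding p by (simp add: mult_ac)
  finally show "n1 * ?Y1 + n2 * ?Y2 = n3 * ?Y3" .
qed

text \<open>Here \<open>1 - H * Q\<close> and \<open>H - Q\<close> cancel against the second site:
  \<open>a' * b' = e' * H\<close> makes them divide \<open>raise_coeff1\<close> and
  \<open>lower_coeff1\<close>.\<close>

lemma form01_eq:
  "- (shift_coeff0 Q a b c d e f g0 * raise_coeff1 Q a' b' e' g') / (e*e'^2*a^3*H^2*(H-1)*(1-H*Q)*(F-G))
   + Q^3*H * (shift_coeff0 Q b a c d e f g0 * lower_coeff1 Q a' b' c' d' e' g') / (e*e'^2*c'*a^3*F*(H-1)*(H-Q)*(H-W)*(W-Q)*(Q-F)*(Q*g'))
   = - (a*((g'-a')*(g'-b')*(Q^2*(a*b+e)*H*((Q+1)*G*(H+1)-(G+1)*(F+W))+Q^2*(c+d)*b*((Q+1)*H*(1+G)-(F+W)*(1+H))+(Q+e)*b*(Q*W-F)*(W-Q*F))))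
      / (Q*e'*e*b*(H-W)*(Q-F))"
  (is "?Y1 / ?D1 + ?Y2 / ?D2 = ?Y3 / ?D3")
proof (rule combine_quotients)
  define n1 where "n1 = (H-Q)*(H-W)*(W-Q)*(Q-F)*c'*F*(Q*g')*b"
  define n2 where "n2 = H^2*(1-H*Q)*(F-G)*b"
  define n3 where "n3 = e'*a^3*H^2*(H-1)*(1-H*Q)*(H-Q)*(F-G)*(W-Q)*F*g'*c'"
  show "?D2 * n2 = ?D1 * n1" "?D3 * n3 = ?D1 * n1"
    by (simp_all add: n1_def n2_def n3_def power2_eq_square mult_ac)
  show "?D1 * n1 = ?D1 * n1" by simp
  show "?D1 * n1 \<noteq> 0" using params_nz nz by (simp add: n1_def)
  let ?X = "(g'-a')*(g'-b')"
  obtain P h k E E' where eqs: "F = Q * P" "H = P * h" "G = Q * k" "W = Q * (h * k)" "e = c * E" "e' = a' * E'"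
    "d = E * (Q * k)" "d' = c' * (Q * k)" "b' = E' * (P * h)" "b = a * (P * h)" "f = a * (Q * P)" "g = a * (Q * (h * k))"
    "f' = c' * (Q * P)" "g' = c' * (Q * (h * k))" "f0 = c' * P" "g0 = a * (h * k)" by (rule params)
  have p: "- n1 * (shift_coeff0 Q a b c d e f g0*(Q*a'*b'-e')) + n2 * Q^3*H*(shift_coeff0 Q b a c d e f g0*((g'-c')*(g'-d')*(e'*Q-a'*b'))) = n3 * (-(a*(Q^2*(a*b+e)*H*((Q+1)*G*(H+1)-(G+1)*(F+W))+Q^2*(c+d)*b*((Q+1)*H*(1+G)-(F+W)*(1+H))+(Q+e)*b*(Q*W-F)*(W-Q*F))))"
    unfolding n1_def n2_def n3_def raise_coeff0_def lower_coeff0_def shift_coeff0_def raise_coeff1_def lower_coeff1_def unfolding eqs by algebra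
  have "n1 * ?Y1 + n2 * ?Y2 = ?X * (- n1 * (shift_coeff0 Q a b c d e f g0*(Q*a'*b'-e')) + n2 * Q^3*H*(shift_coeff0 Q b a c d e f g0*((g'-c')*(g'-d')*(e'*Q-a'*b'))))"
  proof -
    have "n1 * ?Y1 = ?X * (- n1 * (shift_coeff0 Q a b c d e f g0*(Q*a'*b'-e')))"
      by (simp add: raise_coeff1_def mult_ac)
    moreover have "n2 * ?Y2 = ?X * (n2 * Q^3*H*(shift_coeff0 Q b a c d e f g0*((g'-c')*(g'-d')*(e'*Q-a'*b'))))"
      by (simp add: lower_coeff1_def mult_ac)
    ultimately show ?thesis by (simp only: distrib_left)
  qed
  also have "\<dots> = n3 * ?Y3"
    unfolding p by (simp add: mult_ac)
  finally show "n1 * ?Y1 + n2 * ?Y2 = n3 * ?Y3" .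
qed

text \<open>Neither site supplies the factors \<open>1 - H * Q\<close> and \<open>H - Q\<close>
  here. The last summand on the right is the sum of the two rates times
  \<open>(f - g0) * (g' - f0)\<close>, which is what the diagonal part of the generator subtracts;
  the other summand is free of these denominators and can therefore be symmetric.\<close>

lemma form00_eq:
  "- (shift_coeff0 Q a b c d e f g0 * raise_coeff0 Q a' b' e' g' f0) / (e*e'^2*a^3*H^2*(H-1)*(1-H*Q)*(F-G))
   + Q^3*H * (shift_coeff0 Q b a c d e f g0 * lower_coeff0 Q a' b' c' d' e' g' f0) / (e*e'^2*c'*a^3*F*(H-1)*(H-Q)*(H-W)*(W-Q)*(Q-F)*(Q*f0))
   = a*c'*(Q^2*H*G*(F+W)*(a*b+e)*(c'*d'+e') + Q^2*(F+W)*(c+d)*(a'+b')*b*d'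
        - Q^2*(1+Q)*H*G*((a*b+e)*(a'+b')*d'+(c+d)*b*(c'*d'+e')) - (e*e'+Q)*(F-Q*W)*(Q*F-W)*b*d') / (Q^2*e*e'*b*d')
     + ((1-a')*(e-a)*(1-b)*(b'-1)*H*Q / (e*e'*b*(H-1)*(1-H*Q))
        + Q*H*(1-a)*(e'-a')*(b-e)*(b'-e') / (e*e'^2*b*(H-1)*(H-Q))) * ((f-g0)*(g'-f0))"
  (is "?Y1 / ?D1 + ?Y2 / ?D2 = ?Y3 / ?D3 + (?Y4 / ?D4 + ?Y5 / ?D5) * ?Z")
proof -
  define n1 where "n1 = (H-Q)*(H-W)*(W-Q)*(Q-F)*c'*F*(Q*f0)*Q*b*d'"
  define n2 where "n2 = H^2*(1-H*Q)*(F-G)*Q*b*d'"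
  define n3 where "n3 = e'*a^3*H^2*F*c'*(H-1)*(1-H*Q)*(H-Q)*(F-G)*(H-W)*(W-Q)*(Q-F)*f0"
  define n4 where "n4 = e'*a^3*H^2*F*c'*(H-Q)*(F-G)*(H-W)*(W-Q)*(Q-F)*Q*f0*Q*d'"
  define n5 where "n5 = a^3*H^2*F*c'*(1-H*Q)*(F-G)*(H-W)*(W-Q)*(Q-F)*Q*f0*Q*d'"
  define D where "D = ?D1 * n1"
  have D: "?D1 * n1 = D" "?D2 * n2 = D" "?D3 * n3 = D" "?D4 * n4 = D" "?D5 * n5 = D"
    by (simp_all add: D_def n1_def n2_def n3_def n4_def n5_def power2_eq_square mult_ac)
  have "D \<noteq> 0" using params_nz nz by (simp add: n1_def D_def)
  obtain P h k E E' where eqs: "F = Q * P" "H = P * h" "G = Q * k" "W = Q * (h * k)" "e = c * E" "e' = a' * E'"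
    "d = E * (Q * k)" "d' = c' * (Q * k)" "b' = E' * (P * h)" "b = a * (P * h)" "f = a * (Q * P)" "g = a * (Q * (h * k))"
    "f' = c' * (Q * P)" "g' = c' * (Q * (h * k))" "f0 = c' * P" "g0 = a * (h * k)" by (rule params)
  have "n1 * ?Y1 + n2 * ?Y2 = n3 * ?Y3 + (n4 * ?Y4 + n5 * ?Y5) * ?Z"
    unfolding n1_def n2_def n3_def n4_def n5_def raise_coeff0_def lower_coeff0_def shift_coeff0_def unfolding eqs by algebra
  moreover have "?Y1 / ?D1 = n1 * ?Y1 / D" "?Y2 / ?D2 = n2 * ?Y2 / D" "?Y3 / ?D3 = n3 * ?Y3 / D"
      "?Y4 / ?D4 = n4 * ?Y4 / D" "?Y5 / ?D5 = n5 * ?Y5 / D"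
    by (rule expand_quotient; use D \<open>D \<noteq> 0\<close> in simp)+
  ultimately show ?thesis
    by (simp only: add_divide_distrib[symmetric] times_divide_eq_left)
qed

text \<open>
  The rates are those of the left process up to a common factor; the weights are quotients of
  the prefactors of \<open>p_AW\<close> after and before the jump.
\<close>

definition "rate_m = (1-a')*(e-a)*(1-b)*(b'-1)*H*Q / (e*e'*b*(H-1)*(1-H*Q))"
definition "rate_p = Q*H*(1-a)*(e'-a')*(b-e)*(b'-e') / (e*e'^2*b*(H-1)*(H-Q))"
definition "weight_m = (1-a/g)*(1-f'/c')/((1-f')*(1-1/g'))"
definition "weight_p = (1-f'/Q)*(1-Q/g')/((1-a*Q/g)*(1-f'/(c'*Q)))"

text \<open>These coefficients are written so that exchanging the two sites visibly swaps \<open>form10\<close> and \<open>form01\<close> and fixes the others.\<close>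

definition "form11 = Q * ((f-c)*(f-d)*(g'-a')*(g'-b') * (2*Q*(F+W)*(1+H)*(1+G)-(1+Q)*((F+W)^2+Q*(H+G)*(1+H*G)-H*G*(1-Q)^2)))
      / (e*e'*(F-G)*(H-W)*(W-Q)*(Q-F))"
definition "form10 = - (c'*((f-c)*(f-d)*(Q^2*(c'*d'+e')*G*((Q+1)*H*(G+1)-(H+1)*(F+W))+Q^2*(a'+b')*d'*((Q+1)*G*(1+H)-(F+W)*(1+G))+(Q+e')*d'*(Q*F-W)*(F-Q*W))))
      / (Q*e*e'*d'*(F-G)*(W-Q))"
definition "form01 = - (a*((g'-a')*(g'-b')*(Q^2*(a*b+e)*H*((Q+1)*G*(H+1)-(G+1)*(F+W))+Q^2*(c+d)*b*((Q+1)*H*(1+G)-(F+W)*(1+H))+(Q+e)*b*(Q*W-F)*(W-Q*F))))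
      / (Q*e'*e*b*(H-W)*(Q-F))"
definition "form00 = a*c'*(Q^2*H*G*(F+W)*(a*b+e)*(c'*d'+e') + Q^2*(F+W)*(c+d)*(a'+b')*b*d'
        - Q^2*(1+Q)*H*G*((a*b+e)*(a'+b')*d'+(c+d)*b*(c'*d'+e')) - (e*e'+Q)*(F-Q*W)*(Q*F-W)*b*d') / (Q^2*e*e'*b*d')"

text \<open>Pure linear algebra, with the series replaced by unknowns: \<open>um\<close>,
  \<open>wU\<close> are the functions after a jump from the second site to the first,
  \<open>up\<close>, \<open>wD\<close> those after the opposite jump, and \<open>xh\<close>,
  \<open>yh\<close> stand for the basis functions with shifted \<open>v\<close>.\<close>

lemma half_generator:
  assumes ne1: "f' \<noteq> 1" "g' \<noteq> 1"
    and um: "(f-g0)*(a-e)*(a-g)*b*f*(1-b)*(1-f)*um = a*(shift_coeff0 Q a b c d e f g0 * x - shift_coeff1 Q a b c d f * xh)"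
    and up: "(f-g0)*(b-e)*(b-g)*a*f*(1-a)*(1-f)*up = b*(shift_coeff0 Q b a c d e f g0 * x - shift_coeff1 Q b a c d f * xh)"
    and wU: "(f'-c')*(f'-d')*(g'-f0)*a'*b'*(1-a')*(1-b')*wU = (1-f')*f0*(raise_coeff0 Q a' b' e' g' f0 * y - raise_coeff1 Q a' b' e' g' * yh)"
    and wD: "(a'-e')*(b'-e')*(g'-f0)*(1-g'/Q)*(1-g')*(1-f0)*wD =
      lower_coeff0 Q a' b' c' d' e' g' f0 / (Q*f0) * y - lower_coeff1 Q a' b' c' d' e' g' / (Q*g') * yh"
    and x: "x = (1-f)*u" and y: "y = (1-g')*w"
  shows "(1-f)*(1-g')*(f-g0)*(g'-f0) * (rate_m * (weight_m * (um * wU) - u * w) + rate_p * (weight_p * (up * wD) - u * w)) =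
    form11 * xh * yh - form10 * xh * y - form01 * x * yh + form00 * x * y"
proof -
  let ?D1 = "e*e'^2*a^3*H^2*(H-1)*(1-H*Q)*(F-G)"
  let ?D2 = "e*e'^2*c'*a^3*F*(H-1)*(H-Q)*(H-W)*(W-Q)*(Q-F)"
  \<comment> \<open>Up to sign, the right side is the product of the factors in front of
    \<open>um\<close> and \<open>wU\<close> in their relations, apart from those already in the
    factor of the conclusion. So the relations are inserted without dividing by, say,
    \<open>1 - a'\<close>, which vanishes when the second site is empty.\<close>
  have m: "rate_m * weight_m * (1-g') * (a * ((1-f')*f0)) * ?D1 =
      - ((a-e)*(a-g)*b*f*(1-b)*((f'-c')*(f'-d')*a'*b'*(1-a')*(1-b')))"
  proof -
    have eqs: "a / g = 1 / W" "f' / c' = F" "1 - 1 / g' = - (1 - g') / g'"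
      using nz params_nz by (auto simp: g f' diff_divide_distrib)
    have quot: "X / (A * (- B / z)) * B = - z * X / A" if "B \<noteq> 0" "z \<noteq> 0" "A \<noteq> 0" for X A B z :: complex
      using that by simp
    have weight: "weight_m * (1-g') = - g' * ((1 - 1/W) * (1 - F)) / (1 - f')"
      unfolding weight_m_def eqs using ne1 params_nz(9) by (intro quot) simp_all
    have weight': "weight_m * (1-g') * (1-f') = c' * (1 - W) * (1 - F)"
    proof -
      have "g' * (1 - 1/W) = c' * (W - 1)" using nz by (simp add: g' field_simps)
      then have "- g' * ((1 - 1/W) * (1 - F)) = c' * (1 - W) * (1 - F)" by algebra
      then show ?thesis unfolding weight using ne1 by simp
    qed
    have rate: "rate_m * (e*e'*b*(H-1)*(1-H*Q)) = (1-a')*(e-a)*(1-b)*(b'-1)*H*Q"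
      using nz gen params_nz by (simp add: rate_m_def)
    have f0': "Q * f0 = c' * F" using f0 f' by (simp add: mult.commute)
    have "(rate_m * weight_m * (1-g') * (a * ((1-f')*f0)) * ?D1) * b =
       (weight_m * (1-g') * (1-f')) * (rate_m * (e*e'*b*(H-1)*(1-H*Q))) * (a*f0*e'*a^3*H^2*(F-G))"
      by (simp add: power2_eq_square mult_ac)
    also have "\<dots> = c' * (1 - W) * (1 - F) * ((1-a')*(e-a)*(1-b)*(b'-1)*H) * (a*(Q*f0)*e'*a^3*H^2*(F-G))"
      unfolding weight' rate by (simp only: mult_ac)
    also have "\<dots> = - ((a-e)*(1-b)*(1-a')*(1-b')) * (a*(1-W)) * (a*H) * (a*F) * (c'*(F-1)) * (c'*(F-G)) * (e'*H) * (a*H)"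
      unfolding f0' by algebra
    also have "\<dots> = - ((a-e)*(1-b)*(1-a')*(1-b')) * (a-g) * b * f * (f'-c') * (f'-d') * (a'*b') * b"
      unfolding b' by (simp add: b g f f' d' right_diff_distrib)
    also have "\<dots> = - ((a-e)*(a-g)*b*f*(1-b)*((f'-c')*(f'-d')*a'*b'*(1-a')*(1-b'))) * b"
      by (simp add: mult_ac)
    finally show ?thesis using params_nz(2) by (simp only: mult_cancel_right) simp
  qed
  \<comment> \<open>The same matching for the opposite jump, with the factors in front of
    \<open>up\<close> and \<open>wD\<close>.\<close>
  have p: "rate_p * weight_p * (b * ?D2) =
      Q^3*H*((b-e)*(b-g)*a*f*(1-a)*((a'-e')*(b'-e')*(1-g'/Q)*(1-f0)))"
  proof -
    have "a * Q / g = Q / W" "f' / (c' * Q) = F / Q" "f' / Q = f0" "1 - Q / g' = - (Q / g') * (1 - g' / Q)"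
      subgoal using nz by (simp add: g)
      subgoal using nz by (simp add: f')
      subgoal using nz by (simp add: f0)
      subgoal using nz params_nz(9) by (simp add: right_diff_distrib)
      done
    then have w: "weight_p = (1 - f0) * (- (Q / g') * (1 - g' / Q)) / ((1 - Q / W) * (1 - F / Q))"
      unfolding weight_p_def by simp
    have q: "1 - Q / W = (W - Q) / W" "1 - F / Q = (Q - F) / Q"
      using nz by (simp_all add: diff_divide_distrib)
    have cancel: "x * (- (Q / g') * y) / (u / W * (v / Q)) * u * v * c' = - (x * y * Q^2)"
      if "u \<noteq> 0" "v \<noteq> 0" for x y u v
      using that nz by (simp add: g' power2_eq_square)
    have weight: "weight_p * (W - Q) * (Q - F) * c' = - ((1 - f0) * (1 - g' / Q) * Q^2)"
      unfolding w q by (rule cancel) (use gen in auto)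
    have rate: "rate_p * (e*e'^2*b*(H-1)*(H-Q)) = Q*H*(1-a)*(e'-a')*(b-e)*(b'-e')"
      using nz params_nz gen by (simp add: rate_p_def)
    have "rate_p * weight_p * (b * ?D2) =
       (rate_p * (e*e'^2*b*(H-1)*(H-Q))) * (weight_p * (W - Q) * (Q - F) * c') * (a^3*F*(H-W))"
      by (simp only: mult_ac)
    also have "\<dots> = Q*H*(1-a)*(e'-a')*(b-e)*(b'-e') * (- ((1 - f0) * (1 - g' / Q) * Q^2)) * (a^3 * F * (H - W))"
      unfolding rate weight ..
    also have "\<dots> = Q^3*H*((b-e)*(a * (H - W))*a*(a * F)*(1-a)*((a'-e')*(b'-e')*(1-g'/Q)*(1-f0)))"
    proof -
      have "Q*H*(1-a)*(e'-a')*(b-e)*(b'-e') * (- (z1 * z2 * Q^2)) * (a^3 * F * z3) =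
        Q^3*H*((b-e)*(a * z3)*a*(a * F)*(1-a)*((a'-e')*(b'-e')*z2*z1))" for z1 z2 z3
        by algebra
      then show ?thesis .
    qed
    also have "a * (H - W) = b - g" by (simp add: b g right_diff_distrib)
    finally show ?thesis by (simp add: f)
  qed
  define X where "X = shift_coeff0 Q a b c d e f g0 * x - shift_coeff1 Q a b c d f * xh"
  define X' where "X' = shift_coeff0 Q b a c d e f g0 * x - shift_coeff1 Q b a c d f * xh"
  define Y where "Y = raise_coeff0 Q a' b' e' g' f0 * y - raise_coeff1 Q a' b' e' g' * yh"
  define Y' where "Y' = lower_coeff0 Q a' b' c' d' e' g' f0 / (Q*f0) * y - lower_coeff1 Q a' b' c' d' e' g' / (Q*g') * yh"
  let ?c = "(1-f)*(1-g')*(f-g0)*(g'-f0)"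
  have D: "?D1 \<noteq> 0" "?D2 \<noteq> 0" "a * ((1-f')*f0) \<noteq> 0"
    using nz gen ne1 params_nz by auto
  have "?c * (rate_m * weight_m * (um * wU)) * (a * ((1-f')*f0)) * ?D1 =
     (rate_m * weight_m * (1-g') * (a * ((1-f')*f0)) * ?D1) * ((1-f)*(f-g0)*(g'-f0)*um*wU)"
    by (simp only: mult_ac)
  also have "\<dots> = - (((f-g0)*(a-e)*(a-g)*b*f*(1-b)*(1-f)*um) * ((f'-c')*(f'-d')*(g'-f0)*a'*b'*(1-a')*(1-b')*wU))"
    unfolding m by (simp add: mult_ac)
  also have "\<dots> = - (X * Y / ?D1) * (a * ((1-f')*f0)) * ?D1"
    unfolding um wU X_def[symmetric] Y_def[symmetric] using D(1) by (simp add: mult_ac)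
  finally have T1: "?c * (rate_m * weight_m * (um * wU)) = - (X * Y / ?D1)"
    using D by (simp only: mult_cancel_right) simp
  have "?c * (rate_p * weight_p * (up * wD)) * (b * ?D2) =
     (rate_p * weight_p * (b * ?D2)) * ((1-f)*(1-g')*(f-g0)*(g'-f0)*up*wD)"
    by (simp only: mult_ac)
  also have "\<dots> = Q^3*H*(((f-g0)*(b-e)*(b-g)*a*f*(1-a)*(1-f)*up) * ((a'-e')*(b'-e')*(g'-f0)*(1-g'/Q)*(1-g')*(1-f0)*wD))"
    unfolding p by (simp only: mult_ac)
  also have "\<dots> = (Q^3*H*X'*Y' / ?D2) * (b * ?D2)"
    unfolding up wD X'_def[symmetric] Y'_def[symmetric] using D(2) by (simp add: mult_ac)
  finally have T2: "?c * (rate_p * weight_p * (up * wD)) = Q^3*H*X'*Y' / ?D2"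
    using D(2) params_nz(2) by (simp only: mult_cancel_right) simp
  have "?c * (rate_m * (weight_m * (um * wU) - u * w) + rate_p * (weight_p * (up * wD) - u * w)) =
      ?c * (rate_m * weight_m * (um * wU)) + ?c * (rate_p * weight_p * (up * wD)) - (rate_m + rate_p) * ((f-g0)*(g'-f0)) * (x * y)"
    unfolding x y by algebra
  also have "\<dots> = - (X * Y) * inverse ?D1 + X' * Y' * (Q^3*H / ?D2) - (rate_m + rate_p) * ((f-g0)*(g'-f0)) * (x * y)"
    unfolding T1 T2 by (simp add: divide_inverse mult_ac)
  also have "\<dots> = form11 * xh * yh - form10 * xh * y - form01 * x * yh + form00 * x * y"
  proof -
    \<comment> \<open>Reciprocals and quotients become atoms, so that comparing the two bilinear
      forms is a polynomial matter.\<close>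
    define i j p0 p1 where "i = inverse ?D1" and "j = Q^3*H / ?D2"
      and "p0 = lower_coeff0 Q a' b' c' d' e' g' f0 / (Q*f0)" and "p1 = lower_coeff1 Q a' b' c' d' e' g' / (Q*g')"
    have 11: "form11 = - (shift_coeff1 Q a b c d f * raise_coeff1 Q a' b' e' g') * i + j * (shift_coeff1 Q b a c d f * p1)"
      unfolding form11_def form11_eq[symmetric] i_def j_def p1_def by (simp add: divide_inverse mult_ac)
    have 10: "form10 = - (shift_coeff1 Q a b c d f * raise_coeff0 Q a' b' e' g' f0) * i + j * (shift_coeff1 Q b a c d f * p0)"
      unfolding form10_def form10_eq[symmetric] i_def j_def p0_def by (simp add: divide_inverse mult_ac)
    have 01: "form01 = - (shift_coeff0 Q a b c d e f g0 * raise_coeff1 Q a' b' e' g') * i + j * (shift_coeff0 Q b a c d e f g0 * p1)"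
      unfolding form01_def form01_eq[symmetric] i_def j_def p1_def by (simp add: divide_inverse mult_ac)
    have "form00 + (rate_m + rate_p) * ((f-g0)*(g'-f0)) =
        - (shift_coeff0 Q a b c d e f g0 * raise_coeff0 Q a' b' e' g' f0) * i + j * (shift_coeff0 Q b a c d e f g0 * p0)"
      unfolding form00_def rate_m_def rate_p_def form00_eq[symmetric] i_def j_def p0_def
      by (simp add: divide_inverse mult_ac)
    then have 00: "form00 = - (shift_coeff0 Q a b c d e f g0 * raise_coeff0 Q a' b' e' g' f0) * i + j * (shift_coeff0 Q b a c d e f g0 * p0)
        - (rate_m + rate_p) * ((f-g0)*(g'-f0))" by (simp add: algebra_simps)
    show ?thesis
      unfolding 11 10 01 00 X_def Y_def X'_def Y'_def i_def[symmetric] j_def[symmetric] p0_def[symmetric] p1_def[symmetric]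
      by algebra
  qed
  finally show ?thesis .
qed

end

context two_site_params begin

text \<open>The left generator shifts \<open>a\<close>, \<open>b\<close> and \<open>a'\<close>,
  \<open>b'\<close>, so termination is taken from \<open>c\<close> and \<open>c'\<close>. At the
  first site both lower parameters keep their values in a jump; at the second they follow the middle
  height.\<close>

lemma half_generator_phi:
  assumes den: "\<And>n. e * Q ^ n \<noteq> 1" "\<And>n. f * Q ^ n \<noteq> 1" "\<And>n. g0 * Q ^ n \<noteq> 1" "\<And>n. Q * Q ^ n \<noteq> 1"
     "\<And>n. e' * Q ^ n \<noteq> 1" "\<And>n. g' / Q * Q ^ n \<noteq> 1" "\<And>n. f0 * Q ^ n \<noteq> 1"
    and ne: "a \<noteq> Q" "b \<noteq> Q" "a' \<noteq> Q" "b' \<noteq> Q"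
    and N: "qpoch c Q N = 0" "qpoch c' Q N' = 0"
  defines "u \<equiv> aw_phi Q a b c d e f g" and "w \<equiv> aw_phi Q c' d' a' b' e' g' f'"
  shows "(1-f)*(1-g')*(f-g0)*(g'-f0) *
     (rate_m * (weight_m * (aw_phi Q (a/Q) (b*Q) c d e f g * aw_phi Q c' d' (a'*Q) (b'*Q) e' (g'*Q) (f'*Q)) - u * w)
    + rate_p * (weight_p * (aw_phi Q (b/Q) (a*Q) c d e f g * aw_phi Q c' d' (a'/Q) (b'/Q) e' (g'/Q) f0) - u * w))
   = form11 * ((1-g0) * aw_phi Q a b c d e (f*Q) g0) * ((1-f0) * aw_phi Q c' d' a' b' e' (g'*Q) f0)
    - form10 * ((1-g0) * aw_phi Q a b c d e (f*Q) g0) * ((1-g') * w)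
    - form01 * ((1-f) * u) * ((1-f0) * aw_phi Q c' d' a' b' e' (g'*Q) f0)
    + form00 * ((1-f) * u) * ((1-g') * w)"
proof (rule half_generator)
  have den': "g' * Q ^ n \<noteq> 1" "f' * Q ^ n \<noteq> 1" for n
    using den(6)[of "Suc n"] den(7)[of "Suc n"] nz(1) by (simp_all add: f0 mult_ac)
  show "f' \<noteq> 1" "g' \<noteq> 1" using den'[of 0] by simp_all
  have bal: "e * f * g = Q * a * b * c * d" "e' * f' * g' = Q * a' * b' * c' * d'"
  proof -
    have "e * f * g = e * a * a * (F * W)" by (simp add: f g)
    also have "\<dots> = Q * a * b * (e * G)" unfolding FW by (simp add: b)
    finally show "e * f * g = Q * a * b * c * d" unfolding d[symmetric] by (simp add: mult_ac)
    have "e' * f' * g' = e' * c' * c' * (F * W)" by (simp add: f' g')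
    also have "\<dots> = Q * (e' * H) * c' * d'" unfolding FW by (simp add: d')
    finally show "e' * f' * g' = Q * a' * b' * c' * d'" unfolding b'[symmetric] by (simp add: mult_ac)
  qed
  have swap: "aw_phi Q b a c d e f g = aw_phi Q a b c d e f g" for b a c d e f g
    by (simp add: phi43_def mult_ac)
  note nzs = nz params_nz
  \<comment> \<open>Stated for arbitrary \<open>a\<close>, \<open>b\<close>, because the two jumps
    at the first site differ only by exchanging these.\<close>
  have up: "(f-g0)*(a-e)*(a-g)*b*f*(1-b)*(1-f)*aw_phi Q (a/Q) (b*Q) c d e f g =
      a*(shift_coeff0 Q a b c d e f g0 * ((1-f) * aw_phi Q a b c d e f g) - shift_coeff1 Q a b c d f * ((1-g0) * aw_phi Q a b c d e (f*Q) g0))"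
    if "e * f * g = Q * a * b * c * d" "a \<noteq> Q" "a \<noteq> 0" "b \<noteq> 0" for a b
  proof -
    \<comment> \<open>The relation is taken at \<open>a / Q\<close> and \<open>g0\<close>, so that
      its other two series have upper parameter \<open>a\<close> and the lower parameters of the
      basis.\<close>
    have "(f - g0) * (a / Q * Q - e) * (a / Q - g0) * b * f * (1 - b) * (1 - f) * aw_phi Q (a / Q) (b * Q) c d e f (g0 * Q) =
    a / Q * (((f - g0) * f * (1 - b) * (b * Q - e) * (b - g0) + b * Q * (f - c) * (f - d) * (g0 - b) * (a / Q - b))
           * ((1 - f) * aw_phi Q (a / Q * Q) b c d e f (g0 * Q))
       - b * Q * (f - c) * (f - d) * (f - b) * (a / Q - b) * ((1 - g0) * aw_phi Q (a / Q * Q) b c d e (f * Q) g0))"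
      using that nzs by (intro aw_phi_shift[OF _ _ _ _ _ _ _ den(1-4) N(1)]) (auto simp: g0 field_simps)
    moreover have "a / Q * Q = a" using nz by simp
    moreover have "a / Q - g0 = (a - g) / Q" "a / Q - b = (a - b * Q) / Q" using nz g0 by (simp_all add: diff_divide_distrib)
    ultimately have "(f - g0) * (a - e) * ((a - g) / Q) * b * f * (1 - b) * (1 - f) * aw_phi Q (a / Q) (b * Q) c d e f g =
    a / Q * (((f - g0) * f * (1 - b) * (b * Q - e) * (b - g0) + b * Q * (f - c) * (f - d) * (g0 - b) * ((a - b * Q) / Q))
           * ((1 - f) * aw_phi Q a b c d e f g)
       - b * Q * (f - c) * (f - d) * (f - b) * ((a - b * Q) / Q) * ((1 - g0) * aw_phi Q a b c d e (f * Q) g0))"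
      by (simp only: g0[symmetric])
    then show ?thesis using nz(1) by (simp add: shift_coeff0_def shift_coeff1_def)
  qed
  show "(f-g0)*(a-e)*(a-g)*b*f*(1-b)*(1-f)*aw_phi Q (a/Q) (b*Q) c d e f g =
      a*(shift_coeff0 Q a b c d e f g0 * ((1-f) * u) - shift_coeff1 Q a b c d f * ((1-g0) * aw_phi Q a b c d e (f*Q) g0))"
    unfolding u_def using bal ne nzs by (intro up) auto
  show "(f-g0)*(b-e)*(b-g)*a*f*(1-a)*(1-f)*aw_phi Q (b/Q) (a*Q) c d e f g =
      b*(shift_coeff0 Q b a c d e f g0 * ((1-f) * u) - shift_coeff1 Q b a c d f * ((1-g0) * aw_phi Q a b c d e (f*Q) g0))"
  proof -
    have "e * f * g = Q * b * a * c * d" using bal(1) by (simp add: mult_ac)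
    from up[OF this ne(2) params_nz(2) nz(2)] show ?thesis
      unfolding u_def swap[of b a c d e f g] swap[of b a c d e "f*Q" g0] .
  qed
  have relU: "e' * g' * f0 = c' * d' * a' * b'"
  proof -
    have "(e' * g' * f0) * Q = (c' * d' * a' * b') * Q"
      using bal(2) unfolding f0 by (simp only: mult_ac)
    then show ?thesis using nz(1) by simp
  qed
  have relD: "e' * (g' / Q) * f0 = Q * c' * d' * (a' / Q) * (b' / Q)"
    using relU nz(1) by simp
  show "(f'-c')*(f'-d')*(g'-f0)*a'*b'*(1-a')*(1-b')*aw_phi Q c' d' (a'*Q) (b'*Q) e' (g'*Q) (f'*Q) =
      (1-f')*f0*(raise_coeff0 Q a' b' e' g' f0 * ((1-g')*w) - raise_coeff1 Q a' b' e' g' * ((1-f0) * aw_phi Q c' d' a' b' e' (g'*Q) f0))"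
  proof -
    \<comment> \<open>In the raising relation \<open>c'\<close>, \<open>d'\<close> take the place of
      \<open>a\<close>, \<open>b\<close>, while \<open>a'\<close>, \<open>b'\<close> take that of
      \<open>c\<close>, \<open>d\<close>, with \<open>g'\<close> for \<open>f\<close> and
      \<open>f0\<close> for \<open>g\<close>.\<close>
    have "(f' - c') * (f' - d') * (g' - f0) * a' * b' *
        ((1 - a') * (1 - b') * aw_phi Q c' d' (a' * Q) (b' * Q) e' (g' * Q) (f' * Q)) =
      (1 - f') * f0 * ((a' * b' * Q * (a' * b' - f0 * (a' + b') + f0 + g' * f0 - g') + e' * (a' * b' * (f0 - 1 - g') + g' * b' + g' * a' - g' * f0))
           * ((1 - g') * aw_phi Q c' d' a' b' e' g' f')
       - (a' - g') * (b' - g') * (Q * a' * b' - e') * ((1 - f0) * aw_phi Q c' d' a' b' e' (g' * Q) f0))"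
      unfolding f0
      by (rule aw_phi_raise[OF relU nz(1) nz(6) params_nz(5) nz(7) params_nz(9) den(5) den'(1) den(7) den(4) N(2)])
    also have raise_coeff1: "(a' - g') * (b' - g') * (Q * a' * b' - e') = raise_coeff1 Q a' b' e' g'"
      unfolding raise_coeff1_def by algebra
    finally show ?thesis
      by (simp only: raise_coeff0_def w_def mult.assoc)
  qed
  show "(a'-e')*(b'-e')*(g'-f0)*(1-g'/Q)*(1-g')*(1-f0)*aw_phi Q c' d' (a'/Q) (b'/Q) e' (g'/Q) f0 =
      lower_coeff0 Q a' b' c' d' e' g' f0 / (Q*f0) * ((1-g')*w) - lower_coeff1 Q a' b' c' d' e' g' / (Q*g') * ((1-f0) * aw_phi Q c' d' a' b' e' (g'*Q) f0)"
  proof -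
    have cancel: "a' / Q * Q = a'" "b' / Q * Q = b'" "g' / Q * Q = g'" using nz(1) by simp_all
    have nzQ: "g' / Q \<noteq> 0" "a' / Q \<noteq> 1" "b' / Q \<noteq> 1"
      using params_nz(9) nz(1) ne by auto
    have "(a'-e')*(b'-e')*(g'-f0)*(1-g'/Q)*(1-g')*(1-f0)*aw_phi Q c' d' (a'/Q) (b'/Q) e' (g'/Q) f0 =
     (f0 - c') * (f0 - d') * aw_theta Q (a'/Q) (b'/Q) e' g' (Q / f0) * ((1 - g') * aw_phi Q c' d' a' b' e' g' f')
     - (g' - c') * (g' - d') * ((a'/Q - g'/Q) * (b'/Q - g'/Q) * Q * (e' - a'/Q * (b'/Q) * Q) / (g'/Q))
        * ((1 - f0) * aw_phi Q c' d' a' b' e' (g' * Q) f0)"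
      using aw_phi_lower[OF relD nz(1) nz(6) params_nz(5) nz(7) nzQ(1) params_nz(10) nzQ(2,3) den(5-7) den(4) N(2)]
      unfolding cancel f0 .
    moreover have "aw_theta Q (a'/Q) (b'/Q) e' g' (Q / f0) = (f0*(Q*a'*b'+a'*b'*e'-Q*(a'+b')*e'-a'*b'*g'+Q*e'*g')
      +(a'*b'*(a'+b')*g'-a'^2*b'^2+Q*a'*b'*e'-Q*a'*b'*g'-a'*b'*e'*g')) / (Q * f0)"
      using nz(1) params_nz(10) by (simp add: aw_theta_def field_simps power2_eq_square)
    then have "(f0 - c') * (f0 - d') * aw_theta Q (a'/Q) (b'/Q) e' g' (Q / f0) = lower_coeff0 Q a' b' c' d' e' g' f0 / (Q*f0)"
      by (simp add: lower_coeff0_def)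
    moreover have "(a'/Q - g'/Q) * (b'/Q - g'/Q) * Q * (e' - a'/Q * (b'/Q) * Q) / (g'/Q) = (g' - a') * (g' - b') * (e' * Q - a' * b') / (Q*g')"
    proof -
      have "a'/Q - g'/Q = (a' - g') / Q" "b'/Q - g'/Q = (b' - g') / Q" "e' - a'/Q * (b'/Q) * Q = (e' * Q - a' * b') / Q"
        using nz(1) by (simp_all add: diff_divide_distrib)
      then have "(a'/Q - g'/Q) * (b'/Q - g'/Q) * Q * (e' - a'/Q * (b'/Q) * Q) / (g'/Q) =
          ((a' - g') * (b' - g')) * (e' * Q - a' * b') / (Q*g')"
        using nz(1) params_nz(9) by simp
      also have "(a' - g') * (b' - g') = (g' - a') * (g' - b')" by algebra
      finally show ?thesis .
    qed
    then have "(g' - c') * (g' - d') * ((a'/Q - g'/Q) * (b'/Q - g'/Q) * Q * (e' - a'/Q * (b'/Q) * Q) / (g'/Q)) = lower_coeff1 Q a' b' c' d' e' g' / (Q*g')"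
      unfolding lower_coeff1_def by (simp only: times_divide_eq_right mult.assoc)
    ultimately show ?thesis by (simp only: w_def)
  qed
qed simp_all

text \<open>Both sides are instances of \<open>half_generator_phi\<close>, the right one for the
  exchanged sites. The factor in front is fixed by the exchange and nonzero, so equality of the
  bilinear forms suffices.\<close>

lemma two_site_phi:
  assumes den: "\<And>n. e * Q ^ n \<noteq> 1" "\<And>n. f / Q * Q ^ n \<noteq> 1" "\<And>n. g0 * Q ^ n \<noteq> 1" "\<And>n. Q * Q ^ n \<noteq> 1"
     "\<And>n. e' * Q ^ n \<noteq> 1" "\<And>n. g' / Q * Q ^ n \<noteq> 1" "\<And>n. f0 * Q ^ n \<noteq> 1"
    and ne: "a \<noteq> Q" "b \<noteq> Q" "c \<noteq> Q" "d \<noteq> Q" "a' \<noteq> Q" "b' \<noteq> Q" "c' \<noteq> Q" "d' \<noteq> Q"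
      "f \<noteq> g0" "g' \<noteq> f0" "G \<noteq> 1" "G * Q \<noteq> 1" "G \<noteq> Q"
    and N: "qpoch a Q N1 = 0" "qpoch c Q N2 = 0" "qpoch a' Q N3 = 0" "qpoch c' Q N4 = 0"
  defines "u \<equiv> aw_phi Q a b c d e f g" and "w \<equiv> aw_phi Q c' d' a' b' e' g' f'"
    and "rate_m' \<equiv> two_site_params.rate_m Q c' d' e' c d e G"
    and "rate_p' \<equiv> two_site_params.rate_p Q c' d' e' c d e G"
    and "weight_m' \<equiv> two_site_params.weight_m c' a f' g f"
    and "weight_p' \<equiv> two_site_params.weight_p Q c' a f' g f"
  shows "rate_m * (weight_m * (aw_phi Q (a/Q) (b*Q) c d e f g * aw_phi Q c' d' (a'*Q) (b'*Q) e' (g'*Q) (f'*Q)) - u * w)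
    + rate_p * (weight_p * (aw_phi Q (b/Q) (a*Q) c d e f g * aw_phi Q c' d' (a'/Q) (b'/Q) e' (g'/Q) f0) - u * w)
   = rate_m' * (weight_m' * (aw_phi Q (c'/Q) (d'*Q) a' b' e' g' f' * aw_phi Q a b (c*Q) (d*Q) e (f*Q) (g*Q)) - w * u)
    + rate_p' * (weight_p' * (aw_phi Q (d'/Q) (c'*Q) a' b' e' g' f' * aw_phi Q a b (c/Q) (d/Q) e (f/Q) g0) - w * u)"
proof -
  have gen': "G \<noteq> 1" "G * Q \<noteq> 1" "G \<noteq> Q" "W \<noteq> H" "G \<noteq> F" "F \<noteq> Q" "Q \<noteq> W"
    using ne gen by auto
  \<comment> \<open>The exchange pairs \<open>a\<close> with \<open>c'\<close>, \<open>b\<close>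
    with \<open>d'\<close>, \<open>c\<close> with \<open>a'\<close>, \<open>d\<close> with
    \<open>b'\<close>, \<open>H\<close> with \<open>G\<close>, \<open>F\<close> with
    \<open>W\<close>, \<open>f\<close> with \<open>g'\<close>, \<open>g\<close> with
    \<open>f'\<close> and \<open>f0\<close> with \<open>g0\<close>.\<close>
  interpret sw: two_site_params Q c' d' a' b' e' c d a b e W F G H g' f' g f g0 f0
    by unfold_locales (use nz gen' b b' d d' f g f' g' f0 g0 FW in \<open>simp_all add: mult_ac\<close>)
  have den': "f * Q ^ n \<noteq> 1" "g' * Q ^ n \<noteq> 1" for n
    using den(2,6)[of "Suc n"] nz(1) by (simp_all add: mult_ac)
  let ?C = "(1-f)*(1-g')*(f-g0)*(g'-f0)"
  have "?C \<noteq> 0"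
    using den'[of 0] ne by simp
  have forms: "sw.form11 = form11" "sw.form10 = form01" "sw.form01 = form10" "sw.form00 = form00"
    unfolding sw.form11_def form11_def sw.form10_def form10_def sw.form01_def form01_def sw.form00_def form00_def
    by (rule arg_cong2[where f = "(/)"]; algebra)+
  note left = half_generator_phi[OF den(1) den'(1) den(3-7) ne(1,2,5,6) N(2,4), folded u_def w_def]
  note right = sw.half_generator_phi[OF den(5) den'(2) den(7) den(4) den(1) den(2) den(3) ne(7,8,3,4) N(3,1),
    folded u_def w_def rate_m'_def rate_p'_def weight_m'_def weight_p'_def, unfolded forms]
  have "?C * (rate_m * (weight_m * (aw_phi Q (a/Q) (b*Q) c d e f g * aw_phi Q c' d' (a'*Q) (b'*Q) e' (g'*Q) (f'*Q)) - u * w)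
    + rate_p * (weight_p * (aw_phi Q (b/Q) (a*Q) c d e f g * aw_phi Q c' d' (a'/Q) (b'/Q) e' (g'/Q) f0) - u * w))
   = (1-g')*(1-f)*(g'-f0)*(f-g0) * (rate_m' * (weight_m' * (aw_phi Q (c'/Q) (d'*Q) a' b' e' g' f' * aw_phi Q a b (c*Q) (d*Q) e (f*Q) (g*Q)) - w * u)
    + rate_p' * (weight_p' * (aw_phi Q (d'/Q) (c'*Q) a' b' e' g' f' * aw_phi Q a b (c/Q) (d/Q) e (f/Q) g0) - w * u))"
    unfolding left right by algebra
  then show ?thesis
    using \<open>?C \<noteq> 0\<close> by (simp add: mult_ac)
qed
end

section \<open>Two-site duality for generic parameters\<close>

lemma qpow_add: "q > 0 \<Longrightarrow> qpow q (a + b) = qpow q a * qpow q b"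
  by (simp add: qpow_def powr_add)

lemma qpow_0 [simp]: "q > 0 \<Longrightarrow> qpow q 0 = 1"
  by (simp add: qpow_def)

lemma qpow_nonzero [simp]: "q > 0 \<Longrightarrow> qpow q a \<noteq> 0"
  by (simp add: qpow_def)

lemma qpow_minus: "q > 0 \<Longrightarrow> qpow q (- a) = inverse (qpow q a)"
  by (simp add: qpow_def powr_minus)

lemma qpow_diff: "q > 0 \<Longrightarrow> qpow q (a - b) = qpow q a / qpow q b"
  by (simp add: qpow_def powr_diff)

lemma qpow_power: "q > 0 \<Longrightarrow> qpow q a ^ n = qpow q (a * real n)"
  by (induction n) (simp_all add: qpow_add algebra_simps)

lemma qpow_eq_iff: "q > 0 \<Longrightarrow> q \<noteq> 1 \<Longrightarrow> qpow q a = qpow q b \<longleftrightarrow> a = b"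
  by (auto simp: qpow_def powr_inj)

lemma qpow_eq_1_iff: "q > 0 \<Longrightarrow> q \<noteq> 1 \<Longrightarrow> qpow q a = 1 \<longleftrightarrow> a = 0"
  using qpow_eq_iff[of q a 0] by simp

lemma qpow_in_Reals: "qpow q a \<in> \<real>"
  by (simp add: qpow_def)

text \<open>All exceptional values of \<open>v\<close> are real.\<close>

lemma nonreal_neq:
  assumes "q > 0" "v \<notin> \<real>"
  shows "v * qpow q a \<noteq> qpow q b" "inverse v * qpow q a \<noteq> qpow q b"
    "v * qpow q a \<noteq> inverse v * qpow q b" "inverse v * qpow q b \<noteq> v * qpow q a"
proof -
  have v0: "v \<noteq> 0" using assms by auto
  show "v * qpow q a \<noteq> qpow q b"
  proof
    assume "v * qpow q a = qpow q b"
    then have "v = qpow q b / qpow q a" using assms(1) by (simp add: field_simps)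
    then show False using assms(2) by (auto intro: Reals_divide qpow_in_Reals)
  qed
  show "inverse v * qpow q a \<noteq> qpow q b"
  proof
    assume "inverse v * qpow q a = qpow q b"
    then have "v = qpow q a / qpow q b" using assms(1) v0 by (simp add: field_simps)
    then show False using assms(2) by (auto intro: Reals_divide qpow_in_Reals)
  qed
  show *: "v * qpow q a \<noteq> inverse v * qpow q b"
  proof
    assume "v * qpow q a = inverse v * qpow q b"
    then have "v ^ 2 = qpow q (b - a)"
      using v0 assms(1) by (simp add: field_simps power2_eq_square qpow_diff)
    also have "\<dots> = qpow q ((b - a) / 2) ^ 2"
    proof -
      have "(b - a) / 2 * real 2 = b - a" by simp
      then show ?thesis unfolding qpow_power[OF assms(1)] by (simp only:)
    qed
    finally have "v = qpow q ((b - a) / 2) \<or> v = - qpow q ((b - a) / 2)"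
      by (simp add: power2_eq_iff)
    then show False using assms(2) by (auto intro: qpow_in_Reals)
  qed
  show "inverse v * qpow q b \<noteq> v * qpow q a" using * by metis
qed

text \<open>Both factorizations are used: \<open>a\<close> and \<open>a'\<close> carry negative
  exponents, while \<open>b\<close>, \<open>b'\<close> and \<open>H\<close> carry positive
  ones.\<close>

lemma qnum_eq_qpow:
  assumes "q > 0" "q \<noteq> 1"
  shows "complex_of_real (qnum q a) = qpow q (- a) * (qpow q (2 * a) - 1) / complex_of_real (q - 1 / q)"
    "complex_of_real (qnum q a) = qpow q a * (1 - qpow q (- 2 * a)) / complex_of_real (q - 1 / q)"
proof -
  have "qpow q (2 * a) = qpow q a * qpow q a" "qpow q (- 2 * a) = qpow q (- a) * qpow q (- a)"
    using qpow_add[OF assms(1), of a a] qpow_add[OF assms(1), of "-a" "-a"] by simp_all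
  moreover have "qpow q (- a) * qpow q a = 1" "qpow q a * qpow q (- a) = 1"
    using qpow_add[OF assms(1), of "-a" a] qpow_add[OF assms(1), of "a" "-a"] assms by simp_all
  moreover have "complex_of_real (qnum q a) = (qpow q a - qpow q (- a)) / complex_of_real (q - 1 / q)"
    by (simp add: qnum_def qpow_def)
  ultimately show "complex_of_real (qnum q a) = qpow q (- a) * (qpow q (2 * a) - 1) / complex_of_real (q - 1 / q)"
    "complex_of_real (qnum q a) = qpow q a * (1 - qpow q (- 2 * a)) / complex_of_real (q - 1 / q)"
    by (simp_all add: right_diff_distrib mult.assoc[symmetric])
qed

lemma q_minus_inverse_nonzero: "q > 0 \<Longrightarrow> q \<noteq> 1 \<Longrightarrow> q - 1 / q \<noteq> (0::real)"
  by (auto simp: field_simps) (metis abs_of_pos abs_square_eq_1 power2_eq_square)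

lemma qnum_eq_0_iff: "q > 0 \<Longrightarrow> q \<noteq> 1 \<Longrightarrow> qnum q a = 0 \<longleftrightarrow> a = 0"
  using q_minus_inverse_nonzero[of q] powr_inj[of q a "- a"] by (auto simp: qnum_def)

text \<open>
  The rates of the left process across a bond with heights \<open>l\<close> and \<open>h\<close> to the left and in the middle. The
  rates of the right process are obtained by reading the bond from right to left.
\<close>

definition bond_rate_right :: "real \<Rightarrow> real \<Rightarrow> real \<Rightarrow> real \<Rightarrow> nat \<Rightarrow> nat \<Rightarrow> real" where
  "bond_rate_right q l k1 k2 y1 y2 = (let h = l + 2 * real y1 + k1 in
     qnum q y1 * qnum q (y2 + k2) * ((qnum q (l + y1) * qnum q (h + y2)) / (qnum q h * qnum q (h - 1))))"

definition bond_rate_left :: "real \<Rightarrow> real \<Rightarrow> real \<Rightarrow> real \<Rightarrow> nat \<Rightarrow> nat \<Rightarrow> real" where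
  "bond_rate_left q l k1 k2 y1 y2 = (let h = l + 2 * real y1 + k1 in
     qnum q y2 * qnum q (y1 + k1) * (if y1 = 0 then 1 else qnum q (h - y1) / qnum q h)
       * (qnum q (h + y2 + k2) / qnum q (h + 1)))"

text \<open>The common factor dropped in \<open>rate_m\<close> and \<open>rate_p\<close>. It is
  symmetric in \<open>k1\<close> and \<open>k2\<close>, so reading the bond backwards gives the same
  factor and it drops out of the comparison.\<close>

definition rate_scale :: "real \<Rightarrow> real \<Rightarrow> real \<Rightarrow> complex" where
  "rate_scale q k1 k2 = qpow q (k1 + k2 - 1) / complex_of_real (q - 1 / q) ^ 2"

lemma rate_conversion:
  fixes y1 y2 :: nat and l k1 k2 :: real
  assumes q: "q > 0" "q \<noteq> 1"
    and h: "l + 2 * real y1 + k1 \<noteq> 0" "l + 2 * real y1 + k1 \<noteq> 1" "l + 2 * real y1 + k1 \<noteq> - 1"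
  defines "Q \<equiv> qpow q 2" and "a \<equiv> qpow q (- 2 * real y1)" and "b \<equiv> qpow q (2 * real y1 + 2 * l + 2 * k1)"
    and "a' \<equiv> qpow q (- 2 * real y2)" and "b' \<equiv> qpow q (2 * real y2 + 2 * (l + 2 * real y1 + k1) + 2 * k2)"
    and "e \<equiv> qpow q (2 * k1)" and "e' \<equiv> qpow q (2 * k2)" and "H \<equiv> qpow q (2 * (l + 2 * real y1 + k1))"
  shows "complex_of_real (bond_rate_left q l k1 k2 y1 y2) = rate_scale q k1 k2 *
      ((1-a')*(e-a)*(1-b)*(b'-1)*H*Q / (e*e'*b*(H-1)*(1-H*Q)))"
    and "complex_of_real (bond_rate_right q l k1 k2 y1 y2) = rate_scale q k1 k2 *
      (Q*H*(1-a)*(e'-a')*(b-e)*(b'-e') / (e*e'^2*b*(H-1)*(H-Q)))"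
proof -
  define h1 where "h1 = l + 2 * real y1 + k1"
  define D where "D = complex_of_real (q - 1 / q)"
  have D0: "D \<noteq> 0" unfolding D_def using q_minus_inverse_nonzero[OF q] by (simp only: of_real_eq_0_iff) simp
  note add = qpow_add[OF q(1), symmetric]
  note qn = qnum_eq_qpow[OF q, folded D_def]
  \<comment> \<open>For nonzero \<open>h1\<close> the convention at \<open>y1 = 0\<close> agrees
    with the quotient itself.\<close>
  have if1: "(if y1 = 0 then 1 else qnum q (h1 - y1) / qnum q h1) = qnum q (h1 - y1) / qnum q h1"
  proof -
    have "qnum q h1 \<noteq> 0" unfolding qnum_eq_0_iff[OF q] using h by (simp add: h1_def)
    then show ?thesis by simp
  qed
  have nH: "H \<noteq> 1" "1 - H * Q \<noteq> 0" "H \<noteq> Q"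
    using h unfolding H_def Q_def add using q by (auto simp: qpow_eq_1_iff qpow_eq_iff)
  have n: "complex_of_real (qnum q y2) = qpow q y2 * (1 - a') / D"
      "complex_of_real (qnum q (y1 + k1)) = qpow q (real y1 - k1) * (e - a) / D"
      "complex_of_real (qnum q (h1 - y1)) = qpow q (- (h1 - y1)) * (b - 1) / D"
      "complex_of_real (qnum q (h1 + y2 + k2)) = qpow q (- (h1 + y2 + k2)) * (b' - 1) / D"
      "complex_of_real (qnum q h1) = qpow q (- h1) * (H - 1) / D"
      "complex_of_real (qnum q (h1 + 1)) = qpow q (- (h1 + 1)) * (H * Q - 1) / D"
      "complex_of_real (qnum q (h1 - 1)) = qpow q (- (h1 + 1)) * (H - Q) / D"
      "complex_of_real (qnum q y1) = qpow q y1 * (1 - a) / D"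
      "complex_of_real (qnum q (y2 + k2)) = qpow q (real y2 - k2) * (e' - a') / D"
      "complex_of_real (qnum q (l + y1)) = qpow q (- (l + y1 + 2 * k1)) * (b - e) / D"
      "complex_of_real (qnum q (h1 + y2)) = qpow q (- (h1 + y2 + 2 * k2)) * (b' - e') / D"
    subgoal unfolding a'_def by (rule qn(2))
    subgoal unfolding qn(2)[of "y1 + k1"] e_def a_def right_diff_distrib add by (simp add: algebra_simps)
    subgoal unfolding qn(1) b_def by (simp add: h1_def algebra_simps)
    subgoal unfolding qn(1) b'_def by (simp add: h1_def algebra_simps)
    subgoal unfolding qn(1) H_def h1_def ..
    subgoal unfolding qn(1) H_def Q_def h1_def add by (simp add: algebra_simps)
    subgoal unfolding qn(1) H_def Q_def h1_def right_diff_distrib mult_1_right add by (simp add: algebra_simps)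
    subgoal unfolding a_def by (rule qn(2))
    subgoal unfolding qn(2)[of "y2 + k2"] e'_def a'_def right_diff_distrib add by (simp add: algebra_simps)
    subgoal unfolding qn(1) b_def e_def right_diff_distrib mult_1_right add by (simp add: algebra_simps)
    subgoal unfolding qn(1) b'_def e'_def h1_def right_diff_distrib mult_1_right add by (simp add: algebra_simps)
    done
  have "complex_of_real (bond_rate_left q l k1 k2 y1 y2) =
      (qpow q y2 * qpow q (real y1 - k1) * qpow q (- (h1 - y1)) * qpow q (- (h1 + y2 + k2)) / (qpow q (- h1) * qpow q (- (h1 + 1))))
        / D ^ 2 * ((1 - a') * (e - a) * (b - 1) * (b' - 1) / ((H - 1) * (H * Q - 1)))"
    unfolding bond_rate_left_def Let_def h1_def[symmetric] if1 of_real_mult of_real_divide n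
    using D0 by (simp add: power2_eq_square) (simp only: mult_ac)
  also have "qpow q y2 * qpow q (real y1 - k1) * qpow q (- (h1 - y1)) * qpow q (- (h1 + y2 + k2)) / (qpow q (- h1) * qpow q (- (h1 + 1)))
     = qpow q (k1 + k2 - 1) * (H * Q / (e * e' * b))"
    unfolding H_def Q_def e_def e'_def b_def add qpow_diff[OF q(1), symmetric] by (simp add: h1_def algebra_simps)
  also have "qpow q (k1 + k2 - 1) * (H * Q / (e * e' * b)) / D ^ 2 * ((1 - a') * (e - a) * (b - 1) * (b' - 1) / ((H - 1) * (H * Q - 1)))
    = rate_scale q k1 k2 * ((1-a')*(e-a)*(1-b)*(b'-1)*H*Q / (e*e'*b*(H-1)*(1-H*Q)))"
  proof -
    have "p * r * t / (u * w) = p * (- r) * t / (u * (- w))" for p r t u w :: complex by simp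
    from this[of "(1 - a') * (e - a)" "b - 1" "b' - 1" "H - 1" "H * Q - 1"]
    have "((1 - a') * (e - a) * (b - 1) * (b' - 1) / ((H - 1) * (H * Q - 1))) =
      ((1 - a') * (e - a) * (1 - b) * (b' - 1) / ((H - 1) * (1 - H * Q)))"
      by (simp only: minus_diff_eq)
    then show ?thesis
      unfolding rate_scale_def D_def[symmetric]
      by (simp only: times_divide_eq_left times_divide_eq_right divide_divide_eq_left mult_ac)
  qed
  finally show "complex_of_real (bond_rate_left q l k1 k2 y1 y2) = rate_scale q k1 k2 *
      ((1-a')*(e-a)*(1-b)*(b'-1)*H*Q / (e*e'*b*(H-1)*(1-H*Q)))" .
  have "complex_of_real (bond_rate_right q l k1 k2 y1 y2) =
      (qpow q y1 * qpow q (real y2 - k2) * qpow q (- (l + y1 + 2 * k1)) * qpow q (- (h1 + y2 + 2 * k2)) / (qpow q (- h1) * qpow q (- (h1 + 1))))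
        / D ^ 2 * ((1 - a) * (e' - a') * (b - e) * (b' - e') / ((H - 1) * (H - Q)))"
    unfolding bond_rate_right_def Let_def h1_def[symmetric] of_real_mult of_real_divide n
    using D0 by (simp add: power2_eq_square) (simp only: mult_ac)
  also have "qpow q y1 * qpow q (real y2 - k2) * qpow q (- (l + y1 + 2 * k1)) * qpow q (- (h1 + y2 + 2 * k2)) / (qpow q (- h1) * qpow q (- (h1 + 1)))
     = qpow q (k1 + k2 - 1) * (Q * H / (e * e'^2 * b))"
    unfolding H_def Q_def e_def e'_def b_def power2_eq_square add qpow_diff[OF q(1), symmetric] by (simp add: h1_def algebra_simps)
  also have "qpow q (k1 + k2 - 1) * (Q * H / (e * e'^2 * b)) / D ^ 2 * ((1 - a) * (e' - a') * (b - e) * (b' - e') / ((H - 1) * (H - Q)))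
    = rate_scale q k1 k2 * (Q*H*(1-a)*(e'-a')*(b-e)*(b'-e') / (e*e'^2*b*(H-1)*(H-Q)))"
    unfolding rate_scale_def D_def[symmetric]
      by (simp only: times_divide_eq_left times_divide_eq_right divide_divide_eq_left mult_ac)
  finally show "complex_of_real (bond_rate_right q l k1 k2 y1 y2) = rate_scale q k1 k2 *
      (Q*H*(1-a)*(e'-a')*(b-e)*(b'-e') / (e*e'^2*b*(H-1)*(H-Q)))" .
qed

lemma aw_phi_swap_pairs: "aw_phi Q c d a b e g f = aw_phi Q a b c d e f g"
  by (simp add: phi43_def mult_ac)

lemma qpoch_terminates:
  assumes "q > 0"
  shows "qpoch (qpow q (- 2 * real y)) (qpow q 2) (Suc y) = 0"
proof -
  have "qpow q (- 2 * real y) * qpow q 2 ^ y = 1"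
    using assms by (simp add: qpow_power qpow_add[symmetric])
  then show ?thesis by (simp add: qpoch_Suc)
qed

text \<open>The exchange of sites yields the weights with \<open>f\<close> and \<open>g\<close>
  interchanged, as if the prefactors had been formed with the inverse of \<open>v\<close>. Since the
  lower parameters of the two sites are proportional, the quotients agree all the same.\<close>

lemma weight_swap:
  fixes a c' f f' g g' :: complex
  assumes "a * f' = c' * f" "a * g' = c' * g" "a \<noteq> 0" "c' \<noteq> 0" "f \<noteq> 0" "g \<noteq> 0" "f' \<noteq> 0" "g' \<noteq> 0" "Q \<noteq> 0"
  shows "(1 - c'/f') * (1 - g/a) / ((1 - g) * (1 - 1/f)) = (1 - a/g) * (1 - f'/c') / ((1 - f) * (1 - 1/g))"
    and "(1-g/Q)*(1-Q/f)/((1-c'*Q/f')*(1-g/(a*Q))) = (1-f/Q)*(1-Q/g)/((1-a*Q/g)*(1-f'/(c'*Q)))"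
proof -
  have f': "f' = c' * f / a" and g': "g' = c' * g / a"
    using assms by (auto simp: field_simps)
  have 1: "1 - c'/f' = - (a - f) / f" "1 - g/a = (a - g)/a" "1 - 1/f = - (1 - f)/f" "1 - a/g = - (a - g)/g" "1 - f'/c' = (a - f)/a"
     "1 - 1/g = - (1 - g)/g"
    using assms by (auto simp: f' diff_divide_distrib)
  show "(1 - c'/f') * (1 - g/a) / ((1 - g) * (1 - 1/f)) = (1 - a/g) * (1 - f'/c') / ((1 - f) * (1 - 1/g))"
  proof -
    have "(- p / f) * (r / a) / (t * (- s / f)) = (- r / g) * (p / a) / (s * (- t / g))" for p r s t
      using assms by (simp add: mult_ac)
    then show ?thesis unfolding 1 .
  qed
  have 2: "1-g/Q = (Q-g)/Q" "1-Q/f = - (Q-f)/f" "1-c'*Q/f' = - (a*Q-f)/f" "1-g/(a*Q) = (a*Q-g)/(a*Q)"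
    "1-f/Q = (Q-f)/Q" "1-Q/g = - (Q-g)/g" "1-a*Q/g = - (a*Q-g)/g" "1-f'/(c'*Q) = (a*Q-f)/(a*Q)"
    using assms by (auto simp: f' diff_divide_distrib)
  show "(1-g/Q)*(1-Q/f)/((1-c'*Q/f')*(1-g/(a*Q))) = (1-f/Q)*(1-Q/g)/((1-a*Q/g)*(1-f'/(c'*Q)))"
  proof -
    have "(r / Q) * (- p / f) / ((- s / f) * (t / (a * Q))) = (p / Q) * (- r / g) / ((- t / g) * (s / (a * Q)))" for p r s t
      using assms by (simp add: mult_ac)
    then show ?thesis unfolding 2 .
  qed
qed

text \<open>The conditions on \<open>h\<close> and \<open>g2\<close> keep the rate denominators away
  from zero. The four conditions \<open>ex\<close> say that \<open>b\<close>, \<open>b'\<close>,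
  \<open>d\<close>, \<open>d'\<close> differ from \<open>Q\<close>; they stem from divisions in the
  contiguous relations, not from the statement itself.\<close>

lemma two_site_formula:
  fixes q l \<rho> k1 k2 :: real and v :: complex and y1 y2 x1 x2 :: nat
  assumes q: "q > 0" "q \<noteq> 1" and k: "k1 > 0" "k2 > 0" and v: "v \<notin> \<real>"
  defines "h \<equiv> l + 2 * real y1 + k1" and "g2 \<equiv> \<rho> + 2 * real x2 + k2"
  assumes h: "h \<noteq> 0" "h \<noteq> 1" "h \<noteq> -1" and g2: "g2 \<noteq> 0" "g2 \<noteq> 1" "g2 \<noteq> -1"
    and ex: "real y1 + l + k1 \<noteq> 1" "real y2 + h + k2 \<noteq> 1" "real x1 + g2 + k1 \<noteq> 1" "real x2 + \<rho> + k2 \<noteq> 1"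
  defines "P \<equiv> p_AW_formula y1 x1 l g2 v k1 q * p_AW_formula y2 x2 h \<rho> v k2 q"
  shows "complex_of_real (bond_rate_left q l k1 k2 y1 y2) * (p_AW_formula (Suc y1) x1 l g2 v k1 q * p_AW_formula (y2 - 1) x2 (h + 2) \<rho> v k2 q - P)
    + complex_of_real (bond_rate_right q l k1 k2 y1 y2) * (p_AW_formula (y1 - 1) x1 l g2 v k1 q * p_AW_formula (Suc y2) x2 (h - 2) \<rho> v k2 q - P)
    = complex_of_real (bond_rate_left q \<rho> k2 k1 x2 x1) * (p_AW_formula y1 (x1 - 1) l (g2 + 2) v k1 q * p_AW_formula y2 (Suc x2) h \<rho> v k2 q - P)
    + complex_of_real (bond_rate_right q \<rho> k2 k1 x2 x1) * (p_AW_formula y1 (Suc x1) l (g2 - 2) v k1 q * p_AW_formula y2 (x2 - 1) h \<rho> v k2 q - P)"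
proof -
  have v0: "v \<noteq> 0" using v by auto
  note add = qpow_add[OF q(1), symmetric]
  note qsimp = qpow_eq_iff[OF q] qpow_eq_1_iff[OF q]
  define Q where "Q = qpow q 2"
  define a where "a = qpow q (- 2 * real y1)"
  define b where "b = qpow q (2 * real y1 + 2 * l + 2 * k1)"
  define c where "c = qpow q (- 2 * real x1)"
  define d where "d = qpow q (2 * real x1 + 2 * g2 + 2 * k1)"
  define e where "e = qpow q (2 * k1)"
  define a' where "a' = qpow q (- 2 * real y2)"
  define b' where "b' = qpow q (2 * real y2 + 2 * h + 2 * k2)"
  define c' where "c' = qpow q (- 2 * real x2)"
  define d' where "d' = qpow q (2 * real x2 + 2 * \<rho> + 2 * k2)"
  define e' where "e' = qpow q (2 * k2)"
  define H where "H = qpow q (2 * h)"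
  define G where "G = qpow q (2 * g2)"
  define A where "A = g2 + l + k1 + 1"
  define A' where "A' = \<rho> + h + k2 + 1"
  define f where "f = v * qpow q A"
  define g where "g = inverse v * qpow q A"
  define f' where "f' = v * qpow q A'"
  define g' where "g' = inverse v * qpow q A'"
  define F where "F = v * qpow q (A + 2 * real y1)"
  define W where "W = inverse v * qpow q (A + 2 * real y1)"
  define f0 where "f0 = v * qpow q (A' - 2)"
  define g0 where "g0 = inverse v * qpow q (A - 2)"
  note defs = Q_def a_def b_def c_def d_def e_def a'_def b'_def c'_def d'_def e'_def H_def G_def
    f_def g_def f'_def g'_def F_def W_def f0_def g0_def
  \<comment> \<open>This equality is the reason why one \<open>F\<close> and one \<open>W\<close>
    serve both sites.\<close>
  have AA': "A' + 2 * real x2 = A + 2 * real y1"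
    by (simp add: A_def A'_def g2_def h_def)
  have nonreal: "v * qpow q x \<noteq> qpow q y" "inverse v * qpow q x \<noteq> qpow q y" "v * qpow q x \<noteq> 1" "inverse v * qpow q x \<noteq> 1"
     "v * qpow q x \<noteq> inverse v * qpow q y" "inverse v * qpow q y \<noteq> v * qpow q x" for x y
    using nonreal_neq[OF q(1) v, of x y] nonreal_neq[OF q(1) v, of x 0] q(1) by auto
  have Qp: "x * qpow q y * Q ^ n = x * qpow q (y + 2 * real n)" for x y n
    unfolding Q_def qpow_power[OF q(1)] mult.assoc add by simp
  have Qp': "qpow q y * Q ^ n = qpow q (y + 2 * real n)" for y n
    using Qp[of 1 y n] by simp
  interpret two_site_params Q a b c d e a' b' c' d' e' F W H G f g f' g' f0 g0
  proof
    show "b = a * H" "a' * b' = e' * H" "d' = c' * G" "c * d = e * G"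
      unfolding defs add by (simp_all add: h_def g2_def algebra_simps)
    have "a * qpow q (A + 2 * real y1) = qpow q A"
      unfolding a_def add by simp
    then show "f = a * F" "g = a * W"
      unfolding F_def W_def f_def g_def by (simp_all add: mult.left_commute)
    have "c' * qpow q (A + 2 * real y1) = qpow q A'"
      unfolding c'_def add AA'[symmetric] by simp
    then show "f' = c' * F" "g' = c' * W"
      unfolding F_def W_def f'_def g'_def by (simp_all add: mult.left_commute)
    have "F * W = qpow q (A + 2 * real y1) * qpow q (A + 2 * real y1)" using v0 by (simp add: F_def W_def)
    then show "F * W = Q * H * G" unfolding Q_def H_def G_def add by (simp add: A_def h_def g2_def algebra_simps)
    show "f' = f0 * Q" "g = g0 * Q" unfolding f'_def f0_def g_def g0_def Q_def mult.assoc add by simp_all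
    show "H \<noteq> 1" "H * Q \<noteq> 1" "H \<noteq> Q" unfolding H_def Q_def add qsimp using h by auto
    show "F \<noteq> G" "H \<noteq> W" "W \<noteq> Q" "Q \<noteq> F" unfolding F_def W_def G_def H_def Q_def
      using nonreal(1,2) by metis+
  qed (use q v0 in \<open>simp_all add: defs\<close>)
  have Qshift: "f / Q = v * qpow q (A - 2)" "g' / Q = inverse v * qpow q (A' - 2)"
    unfolding f_def g'_def Q_def qpow_diff[OF q(1)] by simp_all
  define u where "u = aw_phi Q a b c d e f g"
  define w where "w = aw_phi Q c' d' a' b' e' g' f'"
  define um where "um = aw_phi Q (a/Q) (b*Q) c d e f g"
  define up where "up = aw_phi Q (b/Q) (a*Q) c d e f g"
  define wU where "wU = aw_phi Q c' d' (a'*Q) (b'*Q) e' (g'*Q) (f'*Q)"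
  define wD where "wD = aw_phi Q c' d' (a'/Q) (b'/Q) e' (g'/Q) f0"
  define wm where "wm = aw_phi Q (c'/Q) (d'*Q) a' b' e' g' f'"
  define wp where "wp = aw_phi Q (d'/Q) (c'*Q) a' b' e' g' f'"
  define uU where "uU = aw_phi Q a b (c*Q) (d*Q) e (f*Q) (g*Q)"
  define uD where "uD = aw_phi Q a b (c/Q) (d/Q) e (f/Q) g0"
  define rm where "rm = two_site_params.rate_m Q c' d' e' c d e G"
  define rp where "rp = two_site_params.rate_p Q c' d' e' c d e G"
  define R where "R = (1-a/g)*(1-f'/c')"
  define S where "S = (1-a*Q/g)*(1-f'/(c'*Q))"
  interpret sw: two_site_params Q c' d' a' b' e' c d a b e W F G H g' f' g f g0 f0
  proof
    show "G \<noteq> 1" "G * Q \<noteq> 1" "G \<noteq> Q" unfolding G_def Q_def add qsimp using g2 by auto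
  qed (use nz gen b b' d d' f g f' g' f0 g0 FW in \<open>simp_all add: mult_ac\<close>)
  have main: "rate_m * (weight_m * (um * wU) - u * w) + rate_p * (weight_p * (up * wD) - u * w)
    = rm * (R / ((1-f)*(1-1/g)) * (wm * uU) - w * u) + rp * ((1-f/Q)*(1-Q/g)/S * (wp * uD) - w * u)"
  proof -
    have "a * f' = c' * f" "a * g' = c' * g" by (simp_all add: f f' g g')
    note swap = weight_swap[OF this nz(2) nz(6) params_nz(6-9) nz(1), folded sw.weight_m_def sw.weight_p_def R_def S_def]
    show ?thesis
      unfolding um_def wU_def u_def w_def up_def wD_def rm_def rp_def wm_def uU_def wp_def uD_def swap[symmetric]
    proof (rule two_site_phi)
      show "e * Q ^ n \<noteq> 1" "e' * Q ^ n \<noteq> 1" "Q * Q ^ n \<noteq> 1" for n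
        unfolding e_def e'_def Qp' using k by (auto simp: qsimp Q_def qpow_power[OF q(1)] add)
      show "f / Q * Q ^ n \<noteq> 1" "g0 * Q ^ n \<noteq> 1" "g' / Q * Q ^ n \<noteq> 1" "f0 * Q ^ n \<noteq> 1" for n
        unfolding Qshift unfolding g0_def f0_def Qp using nonreal by simp_all
      show "a \<noteq> Q" "b \<noteq> Q" "c \<noteq> Q" "d \<noteq> Q" "a' \<noteq> Q" "b' \<noteq> Q" "c' \<noteq> Q" "d' \<noteq> Q"
        unfolding a_def b_def c_def d_def a'_def b'_def c'_def d'_def Q_def qsimp using ex by auto
      show "f \<noteq> g0" "g' \<noteq> f0" unfolding f_def g'_def f0_def g0_def using nonreal by simp_all
      show "G \<noteq> 1" "G * Q \<noteq> 1" "G \<noteq> Q" using sw.gen by auto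
      show "qpoch a Q (Suc y1) = 0" "qpoch c Q (Suc x1) = 0" "qpoch a' Q (Suc y2) = 0" "qpoch c' Q (Suc x2) = 0"
        unfolding a_def c_def a'_def c'_def Q_def by (rule qpoch_terminates[OF q(1)])+
    qed
  qed
  define Qi where "Qi = qpow q (- 2)"
  have Qi: "Q * Qi = 1" "Qi * Q = 1" unfolding Q_def Qi_def add using q by simp_all
  have inv_g: "v * qpow q (- A) = 1 / g" "v * qpow q (- A') = 1 / g'"
    using v0 q(1) by (simp_all add: g_def g'_def qpow_minus field_simps)
  have formula: "p_AW_formula y x lam r v k q = qpoch (v * qpow q B) Q x * qpoch (v * qpow q (- B)) Qi y *
      aw_phi Q (qpow q (- 2 * real y)) (qpow q (2 * real y + 2 * lam + 2 * k)) (qpow q (- 2 * real x))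
        (qpow q (2 * real x + 2 * r + 2 * k)) (qpow q (2 * k)) (v * qpow q B) (inverse v * qpow q B)"
    if "B = r + lam + k + 1" for y x lam r k B
  proof -
    have e: "r + lam + k + 1 = B" "- r - lam - k - 1 = - B" using that by simp_all
    show ?thesis unfolding p_AW_formula_def e Q_def Qi_def by simp
  qed
  have sh: "f * Q = v * qpow q (A + 2)" "g * Q = inverse v * qpow q (A + 2)" "f / Q = v * qpow q (A - 2)" "g / Q = inverse v * qpow q (A - 2)"
    "f' * Q = v * qpow q (A' + 2)" "g' * Q = inverse v * qpow q (A' + 2)" "f' / Q = v * qpow q (A' - 2)" "g' / Q = inverse v * qpow q (A' - 2)"
    unfolding f_def g_def f'_def g'_def Q_def mult.assoc add qpow_diff[OF q(1)] by simp_all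
  have shi: "1 / g * Qi = v * qpow q (- (A + 2))" "Q / g = v * qpow q (- (A - 2))"
      "1 / g' * Qi = v * qpow q (- (A' + 2))" "Q / g' = v * qpow q (- (A' - 2))"
    unfolding inv_g[symmetric] Qi_def mult.assoc add
    using inv_g q(1) by (simp_all add: Q_def g_def g'_def qpow_minus qpow_diff field_simps)
  have args: "qpow q (- 2 * real (Suc y1)) = a / Q" "qpow q (2 * real (Suc y1) + 2 * l + 2 * k1) = b * Q"
    "qpow q (- 2 * real (Suc y2)) = a' / Q" "qpow q (2 * real (Suc y2) + 2 * (h - 2) + 2 * k2) = b' / Q"
    "qpow q (- 2 * real (Suc x1)) = c / Q" "qpow q (2 * real (Suc x1) + 2 * (g2 - 2) + 2 * k1) = d / Q"
    "qpow q (- 2 * real (Suc x2)) = c' / Q" "qpow q (2 * real (Suc x2) + 2 * \<rho> + 2 * k2) = d' * Q"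
    unfolding a_def b_def a'_def b'_def c_def d_def c'_def d'_def Q_def add qpow_diff[OF q(1), symmetric]
    by (rule arg_cong[where f = "qpow q"], simp add: algebra_simps)+
  have args': "y1 > 0 \<Longrightarrow> qpow q (- 2 * real (y1 - 1)) = a * Q" "y1 > 0 \<Longrightarrow> qpow q (2 * real (y1 - 1) + 2 * l + 2 * k1) = b / Q"
    "y2 > 0 \<Longrightarrow> qpow q (- 2 * real (y2 - 1)) = a' * Q" "y2 > 0 \<Longrightarrow> qpow q (2 * real (y2 - 1) + 2 * (h + 2) + 2 * k2) = b' * Q"
    "x1 > 0 \<Longrightarrow> qpow q (- 2 * real (x1 - 1)) = c * Q" "x1 > 0 \<Longrightarrow> qpow q (2 * real (x1 - 1) + 2 * (g2 + 2) + 2 * k1) = d * Q"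
    "x2 > 0 \<Longrightarrow> qpow q (- 2 * real (x2 - 1)) = c' * Q" "x2 > 0 \<Longrightarrow> qpow q (2 * real (x2 - 1) + 2 * \<rho> + 2 * k2) = d' / Q"
    unfolding a_def b_def a'_def b'_def c_def d_def c'_def d'_def Q_def add qpow_diff[OF q(1), symmetric]
    by (rule arg_cong[where f = "qpow q"], simp add: algebra_simps of_nat_diff)+
  define pre1 where "pre1 = qpoch f Q x1 * qpoch (1/g) Qi y1"
  define pre2 where "pre2 = qpoch f' Q x2 * qpoch (1/g') Qi y2"
  have P: "P = pre1 * pre2 * (u * w)"
  proof -
    have "p_AW_formula y1 x1 l g2 v k1 q = pre1 * u"
      unfolding formula[OF A_def] inv_g pre1_def u_def a_def b_def c_def d_def e_def f_def g_def ..
    moreover have "p_AW_formula y2 x2 h \<rho> v k2 q = pre2 * w"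
      unfolding formula[OF A'_def] inv_g pre2_def w_def aw_phi_swap_pairs[of c' d']
      unfolding a'_def b'_def c'_def d'_def e'_def f'_def g'_def ..
    ultimately show ?thesis by (simp add: P_def mult_ac)
  qed
  have y1p: "p_AW_formula (Suc y1) x1 l g2 v k1 q = qpoch f Q x1 * qpoch (1/g) Qi (Suc y1) * um"
    unfolding formula[OF A_def] inv_g args um_def c_def d_def e_def f_def g_def ..
  have y1m: "p_AW_formula (y1 - 1) x1 l g2 v k1 q = qpoch f Q x1 * qpoch (1/g) Qi (y1 - 1) * up" if "y1 > 0"
    unfolding formula[OF A_def] inv_g args'(1,2)[OF that] up_def 
    unfolding c_def d_def e_def f_def g_def by (simp add: phi43_def mult_ac)
  have y2m: "p_AW_formula (y2 - 1) x2 (h + 2) \<rho> v k2 q = qpoch (f' * Q) Q x2 * qpoch (1/g' * Qi) Qi (y2 - 1) * wU" if "y2 > 0"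
  proof -
    have B: "A' + 2 = \<rho> + (h + 2) + k2 + 1" by (simp add: A'_def)
    show ?thesis
      unfolding formula[OF B] args'(3,4)[OF that] wU_def aw_phi_swap_pairs[of c' d'] sh shi
      unfolding c'_def d'_def e'_def ..
  qed
  have y2p: "p_AW_formula (Suc y2) x2 (h - 2) \<rho> v k2 q = qpoch (f' / Q) Q x2 * qpoch (Q / g') Qi (Suc y2) * wD"
  proof -
    have B: "A' - 2 = \<rho> + (h - 2) + k2 + 1" by (simp add: A'_def)
    show ?thesis
      unfolding formula[OF B] args wD_def aw_phi_swap_pairs[of c' d'] sh shi f0_def
      unfolding c'_def d'_def e'_def ..
  qed
  have x1m: "p_AW_formula y1 (x1 - 1) l (g2 + 2) v k1 q = qpoch (f * Q) Q (x1 - 1) * qpoch (1/g * Qi) Qi y1 * uU" if "x1 > 0"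
  proof -
    have B: "A + 2 = (g2 + 2) + l + k1 + 1" by (simp add: A_def)
    show ?thesis
      unfolding formula[OF B] args'(5,6)[OF that] uU_def sh shi
      unfolding a_def b_def e_def ..
  qed
  have x1p: "p_AW_formula y1 (Suc x1) l (g2 - 2) v k1 q = qpoch (f / Q) Q (Suc x1) * qpoch (Q / g) Qi y1 * uD"
  proof -
    have B: "A - 2 = (g2 - 2) + l + k1 + 1" by (simp add: A_def)
    show ?thesis
      unfolding formula[OF B] args uD_def sh shi g0_def
      unfolding a_def b_def e_def ..
  qed
  have x2p: "p_AW_formula y2 (Suc x2) h \<rho> v k2 q = qpoch f' Q (Suc x2) * qpoch (1/g') Qi y2 * wm"
    unfolding formula[OF A'_def] inv_g args wm_def aw_phi_swap_pairs[of "c'/Q"]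
    unfolding a'_def b'_def e'_def f'_def g'_def ..
  have x2m: "p_AW_formula y2 (x2 - 1) h \<rho> v k2 q = qpoch f' Q (x2 - 1) * qpoch (1/g') Qi y2 * wp" if "x2 > 0"
    unfolding formula[OF A'_def] inv_g args'(7,8)[OF that] wp_def 
    unfolding a'_def b'_def e'_def f'_def g'_def by (simp add: phi43_def mult_ac)
  have rates: "complex_of_real (bond_rate_left q l k1 k2 y1 y2) = rate_scale q k1 k2 * rate_m"
    "complex_of_real (bond_rate_right q l k1 k2 y1 y2) = rate_scale q k1 k2 * rate_p"
    "complex_of_real (bond_rate_left q \<rho> k2 k1 x2 x1) = rate_scale q k1 k2 * rm"
    "complex_of_real (bond_rate_right q \<rho> k2 k1 x2 x1) = rate_scale q k1 k2 * rp"
  proof -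
    have sym: "rate_scale q k2 k1 = rate_scale q k1 k2" by (simp add: rate_scale_def add.commute)
    show "complex_of_real (bond_rate_left q l k1 k2 y1 y2) = rate_scale q k1 k2 * rate_m"
      "complex_of_real (bond_rate_right q l k1 k2 y1 y2) = rate_scale q k1 k2 * rate_p"
      using rate_conversion[OF q h[unfolded h_def], of k2 y2]
      unfolding rate_m_def rate_p_def unfolding defs h_def by simp_all
    show "complex_of_real (bond_rate_left q \<rho> k2 k1 x2 x1) = rate_scale q k1 k2 * rm"
      "complex_of_real (bond_rate_right q \<rho> k2 k1 x2 x1) = rate_scale q k1 k2 * rp"
      using rate_conversion[OF q g2[unfolded g2_def], of k1 x1]
      unfolding rm_def rp_def sw.rate_m_def sw.rate_p_def unfolding defs g2_def sym by simp_all
  qed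
  have shift: "(1 - z) * qpoch (z * s) s (n - 1) = qpoch z s n" if "n > 0" for z s n
    using qpoch_shift[of z s "n - 1"] qpoch_Suc[of z s "n - 1"] that by simp
  have pow: "Q ^ x1 = 1 / c" "Q ^ x2 = 1 / c'" "Qi ^ y1 = a" "Qi ^ y2 = a'"
    unfolding Q_def Qi_def c_def c'_def a_def a'_def qpow_power[OF q(1)] using q(1) by (simp_all add: qpow_minus field_simps)
  have ne: "1 - f \<noteq> 0" "1 - f' \<noteq> 0" "1 - g \<noteq> 0" "1 - g' \<noteq> 0" "1 - f / Q \<noteq> 0" "1 - f' / Q \<noteq> 0"
       "1 - 1 / g \<noteq> 0" "1 - 1 / g' \<noteq> 0" "1 - Q / g \<noteq> 0" "1 - Q / g' \<noteq> 0"
    unfolding right_minus_eq inv_g[symmetric] sh shi unfolding f_def f'_def g_def g'_def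
    using nonreal(3,4) by metis+
  have neS: "1 - a * Q / g \<noteq> 0" "1 - f' / (c' * Q) \<noteq> 0"
    using nz gen by (simp_all add: g f')
  have Qi_pow: "Qi ^ (n - 1) = Qi ^ n * Q" "Q ^ (n - 1) = Q ^ n / Q" if "n > 0" for n
    using that Qi nz(1) by (cases n; simp add: mult_ac)+
  \<comment> \<open>Each of the four jump terms is its rate times the change of prefactors times
    shifted series. If the departing site is empty, the truncated \<open>y2 - 1\<close> is not the
    shifted value, but then the rate vanishes.\<close>
  have Lm: "complex_of_real (bond_rate_left q l k1 k2 y1 y2) * (p_AW_formula (Suc y1) x1 l g2 v k1 q * p_AW_formula (y2 - 1) x2 (h + 2) \<rho> v k2 q - P)
     = rate_scale q k1 k2 * pre1 * pre2 * (rate_m * (weight_m * (um * wU) - u * w))"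
  proof (cases "y2 = 0")
    case True
    then have "1 - a' = 0" by (simp add: a'_def q)
    then have "rate_m = 0" unfolding rate_m_def by simp
    then show ?thesis by (simp add: rates)
  next
    case False
    then have "(1 - f') * qpoch (f' * Q) Q x2 = qpoch f' Q x2 * (1 - f' / c')"
      "(1 - 1/g') * qpoch (1/g' * Qi) Qi (y2 - 1) = qpoch (1/g') Qi y2"
      "qpoch (1/g) Qi (Suc y1) = qpoch (1/g) Qi y1 * (1 - a / g)"
      using qpoch_shift[of f' Q x2] shift[of y2 "1/g'" Qi] by (simp_all add: pow qpoch_Suc)
    then have "qpoch (f' * Q) Q x2 = qpoch f' Q x2 * (1 - f' / c') / (1 - f')"
       "qpoch (1/g' * Qi) Qi (y2 - 1) = qpoch (1/g') Qi y2 / (1 - 1/g')"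
       "qpoch (1/g) Qi (Suc y1) = qpoch (1/g) Qi y1 * (1 - a / g)"
      using ne by (simp_all add: nonzero_eq_divide_eq mult.commute)
    then have "p_AW_formula (Suc y1) x1 l g2 v k1 q * p_AW_formula (y2 - 1) x2 (h + 2) \<rho> v k2 q =
        pre1 * pre2 * (weight_m * (um * wU))"
      unfolding y1p y2m[OF False[unfolded neq0_conv]] by (simp add: pre1_def pre2_def weight_m_def)
    then show ?thesis by (simp only: rates P right_diff_distrib mult_ac)
  qed
  have Lp: "complex_of_real (bond_rate_right q l k1 k2 y1 y2) * (p_AW_formula (y1 - 1) x1 l g2 v k1 q * p_AW_formula (Suc y2) x2 (h - 2) \<rho> v k2 q - P)
     = rate_scale q k1 k2 * pre1 * pre2 * (rate_p * (weight_p * (up * wD) - u * w))"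
  proof (cases "y1 = 0")
    case True
    then have "1 - a = 0" by (simp add: a_def q)
    then have "rate_p = 0" unfolding rate_p_def by simp
    then show ?thesis by (simp add: rates)
  next
    case False
    then have qp: "Qi ^ (y1 - Suc 0) = a * Q" using Qi_pow(1)[of y1] pow by simp
    have "(1 - f' / Q) * qpoch f' Q x2 = qpoch (f' / Q) Q x2 * (1 - f' / (c' * Q))"
      "qpoch (Q / g') Qi (Suc y2) = (1 - Q / g') * qpoch (1/g') Qi y2"
      "qpoch (1/g) Qi y1 = qpoch (1/g) Qi (y1 - 1) * (1 - a * Q / g)"
      using qpoch_shift[of "f' / Q" Q x2] shift[of "Suc y2" "Q / g'" Qi] qpoch_Suc[of "1/g" Qi "y1 - 1"] Qi nz(1) False
      by (simp_all add: pow qp mult_ac)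
    then have "qpoch (f' / Q) Q x2 = (1 - f' / Q) * qpoch f' Q x2 / (1 - f' / (c' * Q))"
      "qpoch (Q / g') Qi (Suc y2) = (1 - Q / g') * qpoch (1/g') Qi y2"
      "qpoch (1/g) Qi (y1 - 1) = qpoch (1/g) Qi y1 / (1 - a * Q / g)"
      using neS by simp_all
    then have "p_AW_formula (y1 - 1) x1 l g2 v k1 q * p_AW_formula (Suc y2) x2 (h - 2) \<rho> v k2 q =
        pre1 * pre2 * (weight_p * (up * wD))"
      unfolding y2p y1m[OF False[unfolded neq0_conv]] by (simp add: pre1_def pre2_def weight_p_def)
    then show ?thesis by (simp only: rates P right_diff_distrib mult_ac)
  qed
  have Rm: "complex_of_real (bond_rate_left q \<rho> k2 k1 x2 x1) * (p_AW_formula y1 (x1 - 1) l (g2 + 2) v k1 q * p_AW_formula y2 (Suc x2) h \<rho> v k2 q - P)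
     = rate_scale q k1 k2 * pre1 * pre2 * (rm * (R / ((1-f)*(1-1/g)) * (wm * uU) - w * u))"
  proof (cases "x1 = 0")
    case True
    then have "1 - c = 0" by (simp add: c_def q)
    then have "rm = 0" unfolding rm_def sw.rate_m_def by simp
    then show ?thesis by (simp add: rates)
  next
    case False
    then have "(1 - f) * qpoch (f * Q) Q (x1 - 1) = qpoch f Q x1"
      "(1 - 1/g) * qpoch (1/g * Qi) Qi y1 = qpoch (1/g) Qi y1 * (1 - a / g)"
      "qpoch f' Q (Suc x2) = qpoch f' Q x2 * (1 - f' / c')"
      using qpoch_shift[of "1/g" Qi y1] shift[of x1 f Q] by (simp_all add: pow qpoch_Suc)
    then have "qpoch (f * Q) Q (x1 - 1) = qpoch f Q x1 / (1 - f)"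
      "qpoch (1/g * Qi) Qi y1 = qpoch (1/g) Qi y1 * (1 - a / g) / (1 - 1/g)"
      "qpoch f' Q (Suc x2) = qpoch f' Q x2 * (1 - f' / c')"
      using ne by (simp_all add: nonzero_eq_divide_eq mult.commute)
    then have "p_AW_formula y1 (x1 - 1) l (g2 + 2) v k1 q * p_AW_formula y2 (Suc x2) h \<rho> v k2 q =
        pre1 * pre2 * (R / ((1-f)*(1-1/g)) * (wm * uU))"
      unfolding x2p x1m[OF False[unfolded neq0_conv]] by (simp add: pre1_def pre2_def R_def)
    then show ?thesis by (simp only: rates P right_diff_distrib mult_ac)
  qed
  have Rp: "complex_of_real (bond_rate_right q \<rho> k2 k1 x2 x1) * (p_AW_formula y1 (Suc x1) l (g2 - 2) v k1 q * p_AW_formula y2 (x2 - 1) h \<rho> v k2 q - P)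
     = rate_scale q k1 k2 * pre1 * pre2 * (rp * ((1-f/Q)*(1-Q/g)/S * (wp * uD) - w * u))"
  proof (cases "x2 = 0")
    case True
    then have "1 - c' = 0" by (simp add: c'_def q)
    then have "rp = 0" unfolding rp_def sw.rate_p_def by simp
    then show ?thesis by (simp add: rates)
  next
    case False
    then have qp: "Q ^ (x2 - Suc 0) = 1 / c' / Q" using Qi_pow(2)[of x2] pow by simp
    have "qpoch (f / Q) Q (Suc x1) = (1 - f / Q) * qpoch f Q x1"
      "(1 - Q / g) * qpoch (1/g) Qi y1 = qpoch (Q / g) Qi y1 * (1 - a * Q / g)"
      "qpoch f' Q x2 = qpoch f' Q (x2 - 1) * (1 - f' / (c' * Q))"
      using qpoch_shift[of "Q / g" Qi y1] shift[of "Suc x1" "f / Q" Q] qpoch_Suc[of f' Q "x2 - 1"] Qi nz(1) False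
      by (simp_all add: pow qp mult_ac)
    then have "qpoch (f / Q) Q (Suc x1) = (1 - f / Q) * qpoch f Q x1"
      "qpoch (Q / g) Qi y1 = (1 - Q / g) * qpoch (1/g) Qi y1 / (1 - a * Q / g)"
      "qpoch f' Q (x2 - 1) = qpoch f' Q x2 / (1 - f' / (c' * Q))"
      using neS by simp_all
    then have "p_AW_formula y1 (Suc x1) l (g2 - 2) v k1 q * p_AW_formula y2 (x2 - 1) h \<rho> v k2 q =
        pre1 * pre2 * ((1-f/Q)*(1-Q/g)/S * (wp * uD))"
      unfolding x1p x2m[OF False[unfolded neq0_conv]] by (simp add: pre1_def pre2_def S_def)
    then show ?thesis by (simp only: rates P right_diff_distrib mult_ac)
  qed
  show ?thesis
    unfolding Lm Lp Rm Rp distrib_left[symmetric] main ..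
qed

section \<open>Removing the genericity assumptions\<close>

definition aw_poly_coeff :: "real \<Rightarrow> real \<Rightarrow> nat \<Rightarrow> complex" where
  "aw_poly_coeff k q n = qpow q 2 ^ n / (qpoch (qpow q (2 * k)) (qpow q 2) n * qpoch (qpow q 2) (qpow q 2) n)"

text \<open>
  The function \<open>p_AW\<close> with the lower parameters of the series cancelled against the prefactor, which
  shows that it is polynomial in \<open>v\<close>.
\<close>

definition aw_poly :: "nat \<Rightarrow> nat \<Rightarrow> real \<Rightarrow> real \<Rightarrow> complex \<Rightarrow> real \<Rightarrow> real \<Rightarrow> complex" where
  "aw_poly y x lam \<rho> v k q = (\<Sum>n\<le>min x y.
     qpoch (qpow q (- 2 * real y)) (qpow q 2) n * qpoch (qpow q (2 * real y + 2 * lam + 2 * k)) (qpow q 2) n *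
     qpoch (qpow q (- 2 * real x)) (qpow q 2) n * qpoch (qpow q (2 * real x + 2 * \<rho> + 2 * k)) (qpow q 2) n *
     aw_poly_coeff k q n *
     (\<Prod>i=n..<x. 1 - v * qpow q (\<rho> + lam + k + 1) * qpow q 2 ^ i) *
     (\<Prod>i<n. - (v * qpow q (- \<rho> - lam - k - 1) * qpow q (- 2) ^ i)) *
     (\<Prod>i=n..<y. 1 - v * qpow q (- \<rho> - lam - k - 1) * qpow q (- 2) ^ i))"

lemma qpoch_split: "n \<le> m \<Longrightarrow> qpoch a b m = qpoch a b n * (\<Prod>i=n..<m. 1 - a * b ^ i)"
  unfolding qpoch_def by (subst prod.union_disjoint[symmetric]) (auto simp: ivl_disj_un lessThan_atLeast0 intro: prod.cong)

lemma p_AW_formula_eq_aw_poly: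
  assumes q: "q > 0" and v: "v \<noteq> 0"
    and nz: "qpoch (v * qpow q (\<rho> + lam + k + 1)) (qpow q 2) (min x y) \<noteq> 0"
      "qpoch (inverse v * qpow q (\<rho> + lam + k + 1)) (qpow q 2) (min x y) \<noteq> 0"
  shows "p_AW_formula y x lam \<rho> v k q = aw_poly y x lam \<rho> v k q"
proof -
  let ?Q = "qpow q 2" and ?Qi = "qpow q (- 2)"
  let ?f = "v * qpow q (\<rho> + lam + k + 1)" and ?g = "inverse v * qpow q (\<rho> + lam + k + 1)"
  let ?z = "v * qpow q (- \<rho> - lam - k - 1)"
  let ?a = "qpow q (- 2 * real y)" and ?b = "qpow q (2 * real y + 2 * lam + 2 * k)"
  let ?c = "qpow q (- 2 * real x)" and ?d = "qpow q (2 * real x + 2 * \<rho> + 2 * k)"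
  have zero: "qpoch ?a ?Q n * qpoch ?b ?Q n * qpoch ?c ?Q n * qpoch ?d ?Q n = 0" if "n \<ge> Suc (min x y)" for n
  proof -
    have "qpoch ?a ?Q n = 0 \<or> qpoch ?c ?Q n = 0"
      using that qpoch_eq_0_mono[OF qpoch_terminates[OF q, of y], of n]
        qpoch_eq_0_mono[OF qpoch_terminates[OF q, of x], of n] by (auto simp: min_def split: if_splits)
    then show ?thesis by auto
  qed
  have gz: "?g * ?z = 1"
  proof -
    have "qpow q (\<rho> + lam + k + 1) * qpow q (- \<rho> - lam - k - 1) = 1"
      unfolding qpow_add[OF q, symmetric] using q by simp
    moreover have "?g * ?z = (inverse v * v) * (qpow q (\<rho> + lam + k + 1) * qpow q (- \<rho> - lam - k - 1))"
      by (simp only: mult_ac)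
    ultimately show ?thesis using v by simp
  qed
  have QQi: "?Q ^ i * ?Qi ^ i = 1" for i
    unfolding power_mult_distrib[symmetric] qpow_add[OF q, symmetric] using q by simp
  \<comment> \<open>Because \<open>?g * ?z = 1\<close> and the bases are inverse to each other, the
    second prefactor is, up to monomials, the Pochhammer symbol of the lower parameter
    \<open>?g\<close>; this is how that denominator cancels.\<close>
  have g_factor: "1 - ?z * ?Qi ^ i = - (?z * ?Qi ^ i) * (1 - ?g * ?Q ^ i)" for i
  proof -
    have "(?z * ?Qi ^ i) * (?g * ?Q ^ i) = (?g * ?z) * (?Q ^ i * ?Qi ^ i)" by simp
    then have "(?z * ?Qi ^ i) * (?g * ?Q ^ i) = 1" unfolding gz QQi by simp
    then show ?thesis by (simp add: right_diff_distrib)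
  qed
  have "p_AW_formula y x lam \<rho> v k q = qpoch ?f ?Q x * qpoch ?z ?Qi y *
      (\<Sum>n<Suc (min x y). aw_term ?Q ?a ?b ?c ?d (qpow q (2 * k)) ?f ?g n)"
    unfolding p_AW_formula_def by (subst aw_phi_eq_sum[OF zero]) (assumption, rule refl)
  also have "\<dots> = aw_poly y x lam \<rho> v k q"
    unfolding aw_poly_def sum_distrib_left lessThan_Suc_atMost
  proof (rule sum.cong)
    fix n assume "n \<in> {..min x y}"
    then have n: "n \<le> min x y" "n \<le> x" "n \<le> y" by auto
    have ne: "qpoch ?f ?Q n \<noteq> 0" "qpoch ?g ?Q n \<noteq> 0"
      using nz qpoch_eq_0_mono n(1) by blast+
    have "qpoch ?z ?Qi n = (\<Prod>i<n. - (?z * ?Qi ^ i)) * qpoch ?g ?Q n"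
      unfolding qpoch_def prod.distrib[symmetric] g_factor ..
    then have "qpoch ?z ?Qi y = (\<Prod>i<n. - (?z * ?Qi ^ i)) * qpoch ?g ?Q n * (\<Prod>i=n..<y. 1 - ?z * ?Qi ^ i)"
      using qpoch_split[OF n(3)] by simp
    moreover have "qpoch ?f ?Q x = qpoch ?f ?Q n * (\<Prod>i=n..<x. 1 - ?f * ?Q ^ i)"
      by (rule qpoch_split[OF n(2)])
    moreover have "(F * p) * (w * G * r) * (N / (E * F * G) * (t / u)) = N * (t / (E * u)) * p * w * r"
      if "F \<noteq> 0" "G \<noteq> 0" for F p w G r N E t u :: complex
      using that by (simp add: mult_ac)
    ultimately show "qpoch ?f ?Q x * qpoch ?z ?Qi y * aw_term ?Q ?a ?b ?c ?d (qpow q (2 * k)) ?f ?g n =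
       qpoch ?a ?Q n * qpoch ?b ?Q n * qpoch ?c ?Q n * qpoch ?d ?Q n * aw_poly_coeff k q n *
     (\<Prod>i=n..<x. 1 - ?f * ?Q ^ i) * (\<Prod>i<n. - (?z * ?Qi ^ i)) * (\<Prod>i=n..<y. 1 - ?z * ?Qi ^ i)"
      unfolding aw_term_def aw_poly_coeff_def using ne by (simp only:)
  qed simp
  finally show ?thesis .
qed

lemma tendsto_qpow [tendsto_intros]:
  assumes "q > 0" "(a \<longlongrightarrow> a0) F"
  shows "((\<lambda>t. qpow q (a t)) \<longlongrightarrow> qpow q a0) F"
  unfolding qpow_def using assms by (auto intro!: tendsto_intros)

lemma tendsto_qpoch [tendsto_intros]:
  assumes "(a \<longlongrightarrow> a0) F"
  shows "((\<lambda>t. qpoch (a t) b n) \<longlongrightarrow> qpoch a0 b n) F"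
  unfolding qpoch_def using assms by (auto intro!: tendsto_intros)

lemma tendsto_aw_poly [tendsto_intros]:
  assumes "q > 0" "(l \<longlongrightarrow> l0) F" "(r \<longlongrightarrow> r0) F" "(w \<longlongrightarrow> w0) F"
  shows "((\<lambda>t. aw_poly y x (l t) (r t) (w t) k q) \<longlongrightarrow> aw_poly y x l0 r0 w0 k q) F"
  unfolding aw_poly_def using assms by (intro tendsto_intros)

text \<open>The formula agrees with the polynomial off finitely many \<open>v\<close>, so the limit
  prescribed at the exceptional points is the value of the polynomial there.\<close>

lemma p_AW_eq_aw_poly:
  assumes q: "q > 0" and v: "v \<noteq> 0"
  shows "p_AW y x lam \<rho> v k q = aw_poly y x lam \<rho> v k q"
proof -
  let ?Q = "qpow q 2" and ?A = "qpow q (\<rho> + lam + k + 1)"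
  have A0: "?A \<noteq> 0" "?Q \<noteq> 0" using q by simp_all
  define S where "S = insert 0 ((\<lambda>i. inverse (?A * ?Q ^ i)) ` {..<min x y} \<union> (\<lambda>i. ?A * ?Q ^ i) ` {..<min x y})"
  have "finite S" by (simp add: S_def)
  then have "\<forall>\<^sub>F w in at v. \<forall>s\<in>S. w \<noteq> s"
    by (intro eventually_ball_finite) (auto intro: eventually_neq_at_within)
  then have "\<forall>\<^sub>F w in at v. aw_poly y x lam \<rho> w k q = p_AW_formula y x lam \<rho> w k q"
  proof (rule eventually_mono)
    fix w assume w: "\<forall>s\<in>S. w \<noteq> s"
    then have w0: "w \<noteq> 0" by (simp add: S_def)
    have "1 - w * ?A * ?Q ^ i \<noteq> 0" "1 - inverse w * ?A * ?Q ^ i \<noteq> 0" if "i < min x y" for i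
    proof -
      have "w \<noteq> inverse (?A * ?Q ^ i)" "w \<noteq> ?A * ?Q ^ i" using w that by (auto simp: S_def)
      then show "1 - w * ?A * ?Q ^ i \<noteq> 0" "1 - inverse w * ?A * ?Q ^ i \<noteq> 0"
        using w0 A0 by (auto simp: field_simps)
    qed
    then have "qpoch (w * ?A) ?Q (min x y) \<noteq> 0" "qpoch (inverse w * ?A) ?Q (min x y) \<noteq> 0"
      unfolding qpoch_def by auto
    then show "aw_poly y x lam \<rho> w k q = p_AW_formula y x lam \<rho> w k q"
      using p_AW_formula_eq_aw_poly[OF q w0] by simp
  qed
  moreover have "((\<lambda>w. aw_poly y x lam \<rho> w k q) \<longlongrightarrow> aw_poly y x lam \<rho> v k q) (at v)"
    using q by (intro tendsto_intros)
  ultimately have "((\<lambda>w. p_AW_formula y x lam \<rho> w k q) \<longlongrightarrow> aw_poly y x lam \<rho> v k q) (at v)"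
    by (rule Lim_transform_eventually[rotated])
  then have "Lim (at v) (\<lambda>w. p_AW_formula y x lam \<rho> w k q) = aw_poly y x lam \<rho> v k q"
    by (intro tendsto_Lim) simp_all
  then show ?thesis
    using p_AW_formula_eq_aw_poly[OF q v] by (auto simp: p_AW_def)
qed

section \<open>Continuity of rates and bond generators\<close>

lemma tendsto_qnum [tendsto_intros]:
  assumes "q > 0" "(a \<longlongrightarrow> a0) F"
  shows "((\<lambda>t. qnum q (a t)) \<longlongrightarrow> qnum q a0) F"
proof -
  have "((\<lambda>t. (q powr a t - q powr (- a t)) * inverse (q - 1 / q)) \<longlongrightarrow> (q powr a0 - q powr (- a0)) * inverse (q - 1 / q)) F"
    using assms by (intro tendsto_mult tendsto_diff tendsto_powr tendsto_const tendsto_minus) auto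
  then show ?thesis by (simp add: qnum_def divide_inverse)
qed

lemma qnum_0 [simp]: "qnum q 0 = 0" by (simp add: qnum_def)

text \<open>The conditions under which no denominator of the two rates across a bond vanishes.\<close>

definition admissible :: "real \<Rightarrow> nat \<Rightarrow> nat \<Rightarrow> bool" where
  "admissible h y1 y2 \<longleftrightarrow> (y1 > 0 \<longrightarrow> h \<noteq> 0 \<and> h \<noteq> 1) \<and> (y2 > 0 \<longrightarrow> h \<noteq> - 1)"

text \<open>Empty sites are split off because admissibility tolerates zero denominators there: the
  rate is then constantly zero, or the convention has removed the critical quotient.\<close>

lemma tendsto_rates:
  assumes q: "q > 0" "q \<noteq> 1" and l: "(l \<longlongrightarrow> l0) F" and adm: "admissible (l0 + 2 * real y1 + k1) y1 y2"
  shows "((\<lambda>t. bond_rate_right q (l t) k1 k2 y1 y2) \<longlongrightarrow> bond_rate_right q l0 k1 k2 y1 y2) F"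
    and "((\<lambda>t. bond_rate_left q (l t) k1 k2 y1 y2) \<longlongrightarrow> bond_rate_left q l0 k1 k2 y1 y2) F"
proof -
  show "((\<lambda>t. bond_rate_right q (l t) k1 k2 y1 y2) \<longlongrightarrow> bond_rate_right q l0 k1 k2 y1 y2) F"
  proof (cases "y1 = 0")
    case False
    then show ?thesis unfolding bond_rate_right_def Let_def using q l adm
      by (intro tendsto_intros) (auto simp: qnum_eq_0_iff admissible_def)
  qed (simp add: bond_rate_right_def)
  show "((\<lambda>t. bond_rate_left q (l t) k1 k2 y1 y2) \<longlongrightarrow> bond_rate_left q l0 k1 k2 y1 y2) F"
  proof (cases "y2 = 0")
    case False
    show ?thesis
    proof (cases "y1 = 0")
      case True
      then show ?thesis unfolding bond_rate_left_def Let_def using q l adm False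
        by (simp, intro tendsto_intros) (auto simp: qnum_eq_0_iff admissible_def)
    next
      case y1: False
      then show ?thesis unfolding bond_rate_left_def Let_def using q l adm False
        by (simp, intro tendsto_intros) (auto simp: qnum_eq_0_iff admissible_def)
    qed
  qed (simp add: bond_rate_left_def)
qed

definition bond_L where
  "bond_L q l \<rho> v k1 k2 y1 y2 x1 x2 =
     (let h = l + 2 * real y1 + k1; g = \<rho> + 2 * real x2 + k2;
          P = aw_poly y1 x1 l g v k1 q * aw_poly y2 x2 h \<rho> v k2 q in
      complex_of_real (bond_rate_left q l k1 k2 y1 y2) * (aw_poly (Suc y1) x1 l g v k1 q * aw_poly (y2 - 1) x2 (h + 2) \<rho> v k2 q - P) +
      complex_of_real (bond_rate_right q l k1 k2 y1 y2) * (aw_poly (y1 - 1) x1 l g v k1 q * aw_poly (Suc y2) x2 (h - 2) \<rho> v k2 q - P))"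

definition bond_R where
  "bond_R q l \<rho> v k1 k2 y1 y2 x1 x2 =
     (let h = l + 2 * real y1 + k1; g = \<rho> + 2 * real x2 + k2;
          P = aw_poly y1 x1 l g v k1 q * aw_poly y2 x2 h \<rho> v k2 q in
      complex_of_real (bond_rate_left q \<rho> k2 k1 x2 x1) * (aw_poly y1 (x1 - 1) l (g + 2) v k1 q * aw_poly y2 (Suc x2) h \<rho> v k2 q - P) +
      complex_of_real (bond_rate_right q \<rho> k2 k1 x2 x1) * (aw_poly y1 (Suc x1) l (g - 2) v k1 q * aw_poly y2 (x2 - 1) h \<rho> v k2 q - P))"

lemma tendsto_bond:
  assumes q: "q > 0" "q \<noteq> 1" and lim: "(l \<longlongrightarrow> l0) F" "(r \<longlongrightarrow> r0) F" "(w \<longlongrightarrow> w0) F"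
    and adm: "admissible (l0 + 2 * real y1 + k1) y1 y2" "admissible (r0 + 2 * real x2 + k2) x2 x1"
  shows "((\<lambda>t. bond_L q (l t) (r t) (w t) k1 k2 y1 y2 x1 x2) \<longlongrightarrow> bond_L q l0 r0 w0 k1 k2 y1 y2 x1 x2) F"
    and "((\<lambda>t. bond_R q (l t) (r t) (w t) k1 k2 y1 y2 x1 x2) \<longlongrightarrow> bond_R q l0 r0 w0 k1 k2 y1 y2 x1 x2) F"
  unfolding bond_L_def bond_R_def Let_def
  by (intro tendsto_intros tendsto_rates q lim adm)+

text \<open>In each list the first three values are zeros of rate denominators. The last two make
  \<open>b\<close> or \<open>b'\<close> (for \<open>l\<close>), respectively \<open>d'\<close> or
  \<open>d\<close> (for \<open>\<rho>\<close>), equal to \<open>Q\<close>.\<close>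

lemma bond_duality_generic:
  assumes q: "q > 0" "q \<noteq> 1" and k: "k1 > 0" "k2 > 0" and v: "v \<notin> \<real>"
    and l: "l \<notin> {- 2 * real y1 - k1, 1 - 2 * real y1 - k1, - 1 - 2 * real y1 - k1, 1 - real y1 - k1, 1 - real y2 - 2 * real y1 - k1 - k2}"
    and r: "\<rho> \<notin> {- 2 * real x2 - k2, 1 - 2 * real x2 - k2, - 1 - 2 * real x2 - k2, 1 - real x2 - k2, 1 - real x1 - 2 * real x2 - k1 - k2}"
  shows "bond_L q l \<rho> v k1 k2 y1 y2 x1 x2 = bond_R q l \<rho> v k1 k2 y1 y2 x1 x2"
proof -
  have v0: "v \<noteq> 0" using v by auto
  have eq: "p_AW_formula y x l \<rho> v k q = aw_poly y x l \<rho> v k q" for y x l \<rho> k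
  proof (rule p_AW_formula_eq_aw_poly[OF q(1) v0])
    have pow: "z * qpow q A * qpow q 2 ^ i = z * qpow q (A + 2 * real i)" for z A i
      by (simp add: qpow_power[OF q(1)] qpow_add[OF q(1)])
    have "v * qpow q A \<noteq> 1" "inverse v * qpow q A \<noteq> 1" for A
      using nonreal_neq(1,2)[OF q(1) v, of A 0] q(1) by simp_all
    then show "qpoch (v * qpow q (\<rho> + l + k + 1)) (qpow q 2) (min x y) \<noteq> 0"
      "qpoch (inverse v * qpow q (\<rho> + l + k + 1)) (qpow q 2) (min x y) \<noteq> 0"
      by (intro qpoch_nonzero; simp only: pow; simp)+
  qed
  show ?thesis
    unfolding bond_L_def bond_R_def Let_def eq[symmetric]
    by (rule two_site_formula[OF q k v]) (use l r in \<open>auto simp: algebra_simps\<close>)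
qed

text \<open>\<open>l\<close> and \<open>\<rho>\<close> are moved together by one real parameter
  \<open>t\<close>, for which only finitely many values are excluded. Admissibility makes both bond
  generators continuous at \<open>t = 0\<close>, so the identity passes to the limit.\<close>

lemma bond_duality_nonreal:
  assumes q: "q > 0" "q \<noteq> 1" and k: "k1 > 0" "k2 > 0" and v: "v \<notin> \<real>"
    and adm: "admissible (l + 2 * real y1 + k1) y1 y2" "admissible (\<rho> + 2 * real x2 + k2) x2 x1"
  shows "bond_L q l \<rho> v k1 k2 y1 y2 x1 x2 = bond_R q l \<rho> v k1 k2 y1 y2 x1 x2"
proof -
  define Sl where "Sl = {- 2 * real y1 - k1, 1 - 2 * real y1 - k1, - 1 - 2 * real y1 - k1, 1 - real y1 - k1, 1 - real y2 - 2 * real y1 - k1 - k2}"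
  define Sr where "Sr = {- 2 * real x2 - k2, 1 - 2 * real x2 - k2, - 1 - 2 * real x2 - k2, 1 - real x2 - k2, 1 - real x1 - 2 * real x2 - k1 - k2}"
  have "finite ((\<lambda>s. s - l) ` Sl \<union> (\<lambda>s. s - \<rho>) ` Sr)" by (simp add: Sl_def Sr_def)
  then have "\<forall>\<^sub>F t in at 0. \<forall>s\<in>(\<lambda>s. s - l) ` Sl \<union> (\<lambda>s. s - \<rho>) ` Sr. t \<noteq> s"
    by (intro eventually_ball_finite) (auto intro: eventually_neq_at_within)
  then have ev: "\<forall>\<^sub>F t in at 0. bond_L q (l + t) (\<rho> + t) v k1 k2 y1 y2 x1 x2 = bond_R q (l + t) (\<rho> + t) v k1 k2 y1 y2 x1 x2"
  proof (rule eventually_mono)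
    fix t assume t: "\<forall>s\<in>(\<lambda>s. s - l) ` Sl \<union> (\<lambda>s. s - \<rho>) ` Sr. t \<noteq> s"
    have "l + t \<notin> Sl" "\<rho> + t \<notin> Sr"
      using t by (force simp: image_iff)+
    then show "bond_L q (l + t) (\<rho> + t) v k1 k2 y1 y2 x1 x2 = bond_R q (l + t) (\<rho> + t) v k1 k2 y1 y2 x1 x2"
      unfolding Sl_def Sr_def by (rule bond_duality_generic[OF q k v])
  qed
  have "((\<lambda>t. l + t) \<longlongrightarrow> l) (at 0)" "((\<lambda>t. \<rho> + t) \<longlongrightarrow> \<rho>) (at 0)"
    by (auto intro!: tendsto_eq_intros)
  note lim = tendsto_bond[OF q this tendsto_const[of v] adm]
  from Lim_transform_eventually[OF lim(1) ev] lim(2) show ?thesis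
    by (intro tendsto_unique[OF trivial_limit_at])
qed

lemma bond_duality:
  assumes q: "q > 0" "q \<noteq> 1" and k: "k1 > 0" "k2 > 0"
    and adm: "admissible (l + 2 * real y1 + k1) y1 y2" "admissible (\<rho> + 2 * real x2 + k2) x2 x1"
  shows "bond_L q l \<rho> v k1 k2 y1 y2 x1 x2 = bond_R q l \<rho> v k1 k2 y1 y2 x1 x2"
proof (cases "v \<in> \<real>")
  case False
  then show ?thesis using bond_duality_nonreal[OF q k _ adm] by simp
next
  case True
  \<comment> \<open>A real \<open>v\<close> is approached vertically, through nonreal
    values.\<close>
  define w where "w n = v + \<i> * complex_of_real (1 / real (Suc n))" for n
  have "w n \<notin> \<real>" for n
    using True by (simp add: w_def complex_is_Real_iff)
  then have eq: "bond_L q l \<rho> (w n) k1 k2 y1 y2 x1 x2 = bond_R q l \<rho> (w n) k1 k2 y1 y2 x1 x2" for n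
    using bond_duality_nonreal[OF q k _ adm] by simp
  have "w \<longlonglongrightarrow> v + \<i> * complex_of_real 0"
    unfolding w_def by (intro tendsto_intros LIMSEQ_Suc[OF lim_1_over_n])
  then have "w \<longlonglongrightarrow> v" by simp
  note lim = tendsto_bond[OF q tendsto_const[of l] tendsto_const[of \<rho>] this adm]
  show ?thesis using LIMSEQ_unique[OF lim(1)] lim(2) unfolding eq by simp
qed

section \<open>From one bond to the whole system\<close>

lemma sum_update_two:
  fixes \<zeta> :: config and k :: "nat \<Rightarrow> real"
  assumes "finite A" "j \<in> A" "j' \<in> A" "j \<noteq> j'" "u + w = \<zeta> j + \<zeta> j'"
  shows "(\<Sum>m\<in>A. 2 * real ((\<zeta>(j := u, j' := w)) m) + k m) = (\<Sum>m\<in>A. 2 * real (\<zeta> m) + k m)"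
proof -
  have split: "(\<Sum>m\<in>A. g m) = g j + (g j' + (\<Sum>m\<in>A - {j} - {j'}. g m))" for g :: "nat \<Rightarrow> real"
    using assms by (simp add: sum.remove[of A j] sum.remove[of "A - {j}" j'])
  have rest: "(\<Sum>m\<in>A - {j} - {j'}. 2 * real ((\<zeta>(j := u, j' := w)) m) + k m) = (\<Sum>m\<in>A - {j} - {j'}. 2 * real (\<zeta> m) + k m)"
    by (rule sum.cong) auto
  have "real u + real w = real (\<zeta> j) + real (\<zeta> j')"
    using assms(5) by (metis of_nat_add)
  then show ?thesis
    unfolding split[of "\<lambda>m. 2 * real ((\<zeta>(j := u, j' := w)) m) + k m"] split[of "\<lambda>m. 2 * real (\<zeta> m) + k m"] rest
    using assms(4) by simp
qed

lemma h_minus_Suc: "h_minus k lam \<zeta> (Suc j) = h_minus k lam \<zeta> j + 2 * real (\<zeta> (Suc j)) + k (Suc j)"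
  by (simp add: h_minus_def)

lemma h_plus_rec: "j \<le> M \<Longrightarrow> h_plus M k \<rho> \<xi> j = h_plus M k \<rho> \<xi> (Suc j) + 2 * real (\<xi> j) + k j"
  by (simp add: h_plus_def sum.atLeast_Suc_atMost)

text \<open>A jump conserves the total on the two sites, so a height that sums over both or neither
  of them is unchanged; index \<open>j\<close> is the only one that separates them.\<close>

lemma h_minus_update:
  assumes "j \<ge> 1" "u + w = \<zeta> j + \<zeta> (Suc j)" "i \<noteq> j"
  shows "h_minus k lam (\<zeta>(j := u, Suc j := w)) i = h_minus k lam \<zeta> i"
proof (cases "i < j")
  case True
  then show ?thesis unfolding h_minus_def by (intro arg_cong2[where f = "(+)"] sum.cong) auto
next
  case False
  then show ?thesis unfolding h_minus_def using assms by (subst sum_update_two) auto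
qed

lemma h_plus_update:
  assumes "Suc j \<le> M" "u + w = \<xi> j + \<xi> (Suc j)" "i \<noteq> Suc j"
  shows "h_plus M k \<rho> (\<xi>(j := u, Suc j := w)) i = h_plus M k \<rho> \<xi> i"
proof (cases "i > j")
  case True
  then show ?thesis using assms(3) unfolding h_plus_def by (intro arg_cong2[where f = "(+)"] sum.cong) auto
next
  case False
  then show ?thesis unfolding h_plus_def using assms by (subst sum_update_two) auto
qed

lemma move_right: "\<eta> j > 0 \<Longrightarrow> move j (Suc j) \<eta> = \<eta>(j := \<eta> j - 1, Suc j := Suc (\<eta> (Suc j)))"
  by (simp add: move_def Let_def)

lemma move_left: "\<eta> (Suc j) > 0 \<Longrightarrow> move (Suc j) j \<eta> = \<eta>(j := Suc (\<eta> j), Suc j := \<eta> (Suc j) - 1)"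
  by (simp add: move_def Let_def fun_upd_twist)

definition aw_other_sites ::
  "nat \<Rightarrow> real \<Rightarrow> (nat \<Rightarrow> real) \<Rightarrow> real \<Rightarrow> real \<Rightarrow> complex \<Rightarrow> nat \<Rightarrow> config \<Rightarrow> config \<Rightarrow> complex" where
  "aw_other_sites M q k lam \<rho> v j \<zeta> \<xi> = (\<Prod>i\<in>{1..M} - {j} - {Suc j}.
     aw_poly (\<zeta> i) (\<xi> i) (h_minus k lam \<zeta> (i - 1)) (h_plus M k \<rho> \<xi> (i + 1)) v (k i) q)"

lemma P_AW_split:
  assumes "q > 0" "v \<noteq> 0" "1 \<le> j" "Suc j \<le> M"
  shows "P_AW M q k lam \<rho> v \<zeta> \<xi> =
    aw_poly (\<zeta> j) (\<xi> j) (h_minus k lam \<zeta> (j - 1)) (h_plus M k \<rho> \<xi> (Suc j)) v (k j) q *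
    aw_poly (\<zeta> (Suc j)) (\<xi> (Suc j)) (h_minus k lam \<zeta> j) (h_plus M k \<rho> \<xi> (Suc (Suc j))) v (k (Suc j)) q *
    aw_other_sites M q k lam \<rho> v j \<zeta> \<xi>"
proof -
  have split: "(\<Prod>i\<in>{1..M}. g i) = g j * g (Suc j) * (\<Prod>i\<in>{1..M} - {j} - {Suc j}. g i)" for g :: "nat \<Rightarrow> complex"
  proof -
    have "(\<Prod>i\<in>{1..M}. g i) = g j * (\<Prod>i\<in>{1..M} - {j}. g i)"
      using assms by (intro prod.remove) auto
    also have "(\<Prod>i\<in>{1..M} - {j}. g i) = g (Suc j) * (\<Prod>i\<in>{1..M} - {j} - {Suc j}. g i)"
      using assms by (intro prod.remove) auto
    finally show ?thesis by (simp only: mult.assoc)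
  qed
  show ?thesis
    unfolding P_AW_def aw_other_sites_def split p_AW_eq_aw_poly[OF assms(1,2)] by simp
qed

lemma aw_other_sites_update:
  assumes j: "1 \<le> j" "Suc j \<le> M"
  shows "u + w = \<zeta> j + \<zeta> (Suc j) \<Longrightarrow> aw_other_sites M q k lam \<rho> v j (\<zeta>(j := u, Suc j := w)) \<xi> = aw_other_sites M q k lam \<rho> v j \<zeta> \<xi>"
    and "u + w = \<xi> j + \<xi> (Suc j) \<Longrightarrow> aw_other_sites M q k lam \<rho> v j \<zeta> (\<xi>(j := u, Suc j := w)) = aw_other_sites M q k lam \<rho> v j \<zeta> \<xi>"
proof -
  assume "u + w = \<zeta> j + \<zeta> (Suc j)"
  then show "aw_other_sites M q k lam \<rho> v j (\<zeta>(j := u, Suc j := w)) \<xi> = aw_other_sites M q k lam \<rho> v j \<zeta> \<xi>"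
    unfolding aw_other_sites_def
    by (intro prod.cong refl arg_cong2[where f = "\<lambda>y l. aw_poly y _ l _ _ _ _"] h_minus_update[OF j(1)]) auto
next
  assume "u + w = \<xi> j + \<xi> (Suc j)"
  then show "aw_other_sites M q k lam \<rho> v j \<zeta> (\<xi>(j := u, Suc j := w)) = aw_other_sites M q k lam \<rho> v j \<zeta> \<xi>"
    unfolding aw_other_sites_def
    by (intro prod.cong refl arg_cong2[where f = "\<lambda>x r. aw_poly _ x _ r _ _ _"] h_plus_update[OF j(2)]) auto
qed

text \<open>For the right process the bond is read from right to left: \<open>Suc j\<close> becomes
  the first site and the height beyond it becomes \<open>l\<close>, so jumps to the right have left
  rates and conversely. The explicit zero at an empty departing site is reproduced because
  \<open>qnum q 0\<close> is zero.\<close>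

lemma rate_eq_bond_rate:
  assumes "1 \<le> j"
  shows "rate_L_plus q k lam \<zeta> j = bond_rate_right q (h_minus k lam \<zeta> (j - 1)) (k j) (k (Suc j)) (\<zeta> j) (\<zeta> (Suc j))"
    and "rate_L_minus q k lam \<zeta> (Suc j) = bond_rate_left q (h_minus k lam \<zeta> (j - 1)) (k j) (k (Suc j)) (\<zeta> j) (\<zeta> (Suc j))"
    and "Suc j \<le> M \<Longrightarrow> rate_R_plus M q k \<rho> \<xi> j = bond_rate_left q (h_plus M k \<rho> \<xi> (Suc (Suc j))) (k (Suc j)) (k j) (\<xi> (Suc j)) (\<xi> j)"
    and "Suc j \<le> M \<Longrightarrow> rate_R_minus M q k \<rho> \<xi> (Suc j) = bond_rate_right q (h_plus M k \<rho> \<xi> (Suc (Suc j))) (k (Suc j)) (k j) (\<xi> (Suc j)) (\<xi> j)"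
proof -
  have h: "h_minus k lam \<zeta> j = h_minus k lam \<zeta> (j - 1) + 2 * real (\<zeta> j) + k j"
    using h_minus_Suc[of k lam \<zeta> "j - 1"] assms by simp
  show "rate_L_plus q k lam \<zeta> j = bond_rate_right q (h_minus k lam \<zeta> (j - 1)) (k j) (k (Suc j)) (\<zeta> j) (\<zeta> (Suc j))"
    by (simp add: rate_L_plus_def bond_rate_right_def Let_def h)
  show "rate_L_minus q k lam \<zeta> (Suc j) = bond_rate_left q (h_minus k lam \<zeta> (j - 1)) (k j) (k (Suc j)) (\<zeta> j) (\<zeta> (Suc j))"
    by (simp add: rate_L_minus_def bond_rate_left_def Let_def h h_minus_Suc algebra_simps)
  assume M: "Suc j \<le> M"
  have g: "h_plus M k \<rho> \<xi> j = h_plus M k \<rho> \<xi> (Suc j) + 2 * real (\<xi> j) + k j"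
     "h_plus M k \<rho> \<xi> (Suc j) = h_plus M k \<rho> \<xi> (Suc (Suc j)) + 2 * real (\<xi> (Suc j)) + k (Suc j)"
    using M by (simp_all add: h_plus_rec)
  show "rate_R_plus M q k \<rho> \<xi> j = bond_rate_left q (h_plus M k \<rho> \<xi> (Suc (Suc j))) (k (Suc j)) (k j) (\<xi> (Suc j)) (\<xi> j)"
    by (simp add: rate_R_plus_def bond_rate_left_def Let_def g algebra_simps)
  show "rate_R_minus M q k \<rho> \<xi> (Suc j) = bond_rate_right q (h_plus M k \<rho> \<xi> (Suc (Suc j))) (k (Suc j)) (k j) (\<xi> (Suc j)) (\<xi> j)"
    by (simp add: rate_R_minus_def bond_rate_right_def Let_def g mult_ac)
qed

lemma bond_term_L:
  assumes q: "q > 0" "v \<noteq> 0" and j: "1 \<le> j" "Suc j \<le> M"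
  shows "complex_of_real (rate_L_plus q k lam \<zeta> j) * (P_AW M q k lam \<rho> v (move j (j + 1) \<zeta>) \<xi> - P_AW M q k lam \<rho> v \<zeta> \<xi>) +
      complex_of_real (rate_L_minus q k lam \<zeta> (j + 1)) * (P_AW M q k lam \<rho> v (move (j + 1) j \<zeta>) \<xi> - P_AW M q k lam \<rho> v \<zeta> \<xi>)
    = aw_other_sites M q k lam \<rho> v j \<zeta> \<xi> *
      bond_L q (h_minus k lam \<zeta> (j - 1)) (h_plus M k \<rho> \<xi> (Suc (Suc j))) v (k j) (k (Suc j)) (\<zeta> j) (\<zeta> (Suc j)) (\<xi> j) (\<xi> (Suc j))"
proof -
  let ?l = "h_minus k lam \<zeta> (j - 1)" and ?r = "h_plus M k \<rho> \<xi> (Suc (Suc j))"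
  let ?h = "?l + 2 * real (\<zeta> j) + k j" and ?g = "?r + 2 * real (\<xi> (Suc j)) + k (Suc j)"
  let ?rest = "aw_other_sites M q k lam \<rho> v j \<zeta> \<xi>"
  have h: "h_minus k lam \<eta> j = h_minus k lam \<eta> (j - 1) + 2 * real (\<eta> j) + k j" for \<eta>
    using h_minus_Suc[of k lam \<eta> "j - 1"] j by simp
  have g: "h_plus M k \<rho> \<xi> (Suc j) = ?g" using j by (simp add: h_plus_rec)
  have upd: "P_AW M q k lam \<rho> v (\<zeta>(j := u, Suc j := w)) \<xi> =
     aw_poly u (\<xi> j) ?l ?g v (k j) q * aw_poly w (\<xi> (Suc j)) (?l + 2 * real u + k j) ?r v (k (Suc j)) q * ?rest"
    if "u + w = \<zeta> j + \<zeta> (Suc j)" for u w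
  proof -
    have e: "(\<zeta>(j := u, Suc j := w)) j = u" "(\<zeta>(j := u, Suc j := w)) (Suc j) = w" by simp_all
    have n: "j - 1 \<noteq> j" using j by simp
    show ?thesis
      unfolding P_AW_split[OF q j] aw_other_sites_update(1)[OF j that] h[of "\<zeta>(j := u, Suc j := w)"] g e
        h_minus_update[OF j(1) that n] ..
  qed
  have id: "P_AW M q k lam \<rho> v \<zeta> \<xi> =
     aw_poly (\<zeta> j) (\<xi> j) ?l ?g v (k j) q * aw_poly (\<zeta> (Suc j)) (\<xi> (Suc j)) ?h ?r v (k (Suc j)) q * ?rest"
    unfolding P_AW_split[OF q j] h g ..
  have plus: "complex_of_real (rate_L_plus q k lam \<zeta> j) * (P_AW M q k lam \<rho> v (move j (j + 1) \<zeta>) \<xi> - P_AW M q k lam \<rho> v \<zeta> \<xi>) =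
    ?rest * (complex_of_real (bond_rate_right q ?l (k j) (k (Suc j)) (\<zeta> j) (\<zeta> (Suc j))) *
      (aw_poly (\<zeta> j - 1) (\<xi> j) ?l ?g v (k j) q * aw_poly (Suc (\<zeta> (Suc j))) (\<xi> (Suc j)) (?h - 2) ?r v (k (Suc j)) q
       - aw_poly (\<zeta> j) (\<xi> j) ?l ?g v (k j) q * aw_poly (\<zeta> (Suc j)) (\<xi> (Suc j)) ?h ?r v (k (Suc j)) q))"
  proof (cases "\<zeta> j = 0")
    case True
    then show ?thesis by (simp add: rate_eq_bond_rate[OF j(1)] bond_rate_right_def)
  next
    case False
    have e: "?l + 2 * real (\<zeta> j - 1) + k j = ?h - 2" using False by (simp add: of_nat_diff)
    have s: "(\<zeta> j - 1) + Suc (\<zeta> (Suc j)) = \<zeta> j + \<zeta> (Suc j)" using False by simp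
    show ?thesis
      unfolding Suc_eq_plus1[symmetric] move_right[of \<zeta> j, OF False[unfolded neq0_conv]] upd[OF s] id e rate_eq_bond_rate[OF j(1)]
      by (simp only: right_diff_distrib mult_ac)
  qed
  have minus: "complex_of_real (rate_L_minus q k lam \<zeta> (j + 1)) * (P_AW M q k lam \<rho> v (move (j + 1) j \<zeta>) \<xi> - P_AW M q k lam \<rho> v \<zeta> \<xi>) =
    ?rest * (complex_of_real (bond_rate_left q ?l (k j) (k (Suc j)) (\<zeta> j) (\<zeta> (Suc j))) *
      (aw_poly (Suc (\<zeta> j)) (\<xi> j) ?l ?g v (k j) q * aw_poly (\<zeta> (Suc j) - 1) (\<xi> (Suc j)) (?h + 2) ?r v (k (Suc j)) q
       - aw_poly (\<zeta> j) (\<xi> j) ?l ?g v (k j) q * aw_poly (\<zeta> (Suc j)) (\<xi> (Suc j)) ?h ?r v (k (Suc j)) q))"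
  proof (cases "\<zeta> (Suc j) = 0")
    case True
    then show ?thesis by (simp add: rate_eq_bond_rate[OF j(1)] bond_rate_left_def)
  next
    case False
    have e: "?l + 2 * real (Suc (\<zeta> j)) + k j = ?h + 2" by simp
    have s: "Suc (\<zeta> j) + (\<zeta> (Suc j) - 1) = \<zeta> j + \<zeta> (Suc j)" using False by simp
    show ?thesis
      unfolding Suc_eq_plus1[symmetric] move_left[of \<zeta> j, OF False[unfolded neq0_conv]] upd[OF s] id e rate_eq_bond_rate[OF j(1)]
      by (simp only: right_diff_distrib mult_ac)
  qed
  show ?thesis
    unfolding plus minus bond_L_def Let_def distrib_left[symmetric] by (rule arg_cong[OF add.commute])
qed

lemma bond_term_R:
  assumes q: "q > 0" "v \<noteq> 0" and j: "1 \<le> j" "Suc j \<le> M"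
  shows "complex_of_real (rate_R_plus M q k \<rho> \<xi> j) * (P_AW M q k lam \<rho> v \<zeta> (move j (j + 1) \<xi>) - P_AW M q k lam \<rho> v \<zeta> \<xi>) +
      complex_of_real (rate_R_minus M q k \<rho> \<xi> (j + 1)) * (P_AW M q k lam \<rho> v \<zeta> (move (j + 1) j \<xi>) - P_AW M q k lam \<rho> v \<zeta> \<xi>)
    = aw_other_sites M q k lam \<rho> v j \<zeta> \<xi> *
      bond_R q (h_minus k lam \<zeta> (j - 1)) (h_plus M k \<rho> \<xi> (Suc (Suc j))) v (k j) (k (Suc j)) (\<zeta> j) (\<zeta> (Suc j)) (\<xi> j) (\<xi> (Suc j))"
proof -
  let ?l = "h_minus k lam \<zeta> (j - 1)" and ?r = "h_plus M k \<rho> \<xi> (Suc (Suc j))"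
  let ?h = "?l + 2 * real (\<zeta> j) + k j" and ?g = "?r + 2 * real (\<xi> (Suc j)) + k (Suc j)"
  let ?rest = "aw_other_sites M q k lam \<rho> v j \<zeta> \<xi>"
  have h: "h_minus k lam \<zeta> j = ?h"
    using h_minus_Suc[of k lam \<zeta> "j - 1"] j by simp
  have g: "h_plus M k \<rho> \<eta> (Suc j) = h_plus M k \<rho> \<eta> (Suc (Suc j)) + 2 * real (\<eta> (Suc j)) + k (Suc j)" for \<eta>
    using j by (simp add: h_plus_rec)
  have upd: "P_AW M q k lam \<rho> v \<zeta> (\<xi>(j := u, Suc j := w)) =
     aw_poly (\<zeta> j) u ?l (?r + 2 * real w + k (Suc j)) v (k j) q * aw_poly (\<zeta> (Suc j)) w ?h ?r v (k (Suc j)) q * ?rest"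
    if "u + w = \<xi> j + \<xi> (Suc j)" for u w
  proof -
    have e: "(\<xi>(j := u, Suc j := w)) j = u" "(\<xi>(j := u, Suc j := w)) (Suc j) = w" by simp_all
    have n: "Suc (Suc j) \<noteq> Suc j" by simp
    show ?thesis
      unfolding P_AW_split[OF q j] aw_other_sites_update(2)[OF j that] h g[of "\<xi>(j := u, Suc j := w)"] e
        h_plus_update[OF j(2) that n] ..
  qed
  have id: "P_AW M q k lam \<rho> v \<zeta> \<xi> =
     aw_poly (\<zeta> j) (\<xi> j) ?l ?g v (k j) q * aw_poly (\<zeta> (Suc j)) (\<xi> (Suc j)) ?h ?r v (k (Suc j)) q * ?rest"
    unfolding P_AW_split[OF q j] h g ..
  have plus: "complex_of_real (rate_R_plus M q k \<rho> \<xi> j) * (P_AW M q k lam \<rho> v \<zeta> (move j (j + 1) \<xi>) - P_AW M q k lam \<rho> v \<zeta> \<xi>) =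
    ?rest * (complex_of_real (bond_rate_left q ?r (k (Suc j)) (k j) (\<xi> (Suc j)) (\<xi> j)) *
      (aw_poly (\<zeta> j) (\<xi> j - 1) ?l (?g + 2) v (k j) q * aw_poly (\<zeta> (Suc j)) (Suc (\<xi> (Suc j))) ?h ?r v (k (Suc j)) q
       - aw_poly (\<zeta> j) (\<xi> j) ?l ?g v (k j) q * aw_poly (\<zeta> (Suc j)) (\<xi> (Suc j)) ?h ?r v (k (Suc j)) q))"
  proof (cases "\<xi> j = 0")
    case True
    then show ?thesis by (simp add: rate_eq_bond_rate[OF j(1)] j bond_rate_left_def)
  next
    case False
    have e: "?r + 2 * real (Suc (\<xi> (Suc j))) + k (Suc j) = ?g + 2" by simp
    have s: "(\<xi> j - 1) + Suc (\<xi> (Suc j)) = \<xi> j + \<xi> (Suc j)" using False by simp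
    show ?thesis
      unfolding Suc_eq_plus1[symmetric] move_right[of \<xi> j, OF False[unfolded neq0_conv]] upd[OF s] id e rate_eq_bond_rate(3)[OF j]
      by (simp only: right_diff_distrib mult_ac)
  qed
  have minus: "complex_of_real (rate_R_minus M q k \<rho> \<xi> (j + 1)) * (P_AW M q k lam \<rho> v \<zeta> (move (j + 1) j \<xi>) - P_AW M q k lam \<rho> v \<zeta> \<xi>) =
    ?rest * (complex_of_real (bond_rate_right q ?r (k (Suc j)) (k j) (\<xi> (Suc j)) (\<xi> j)) *
      (aw_poly (\<zeta> j) (Suc (\<xi> j)) ?l (?g - 2) v (k j) q * aw_poly (\<zeta> (Suc j)) (\<xi> (Suc j) - 1) ?h ?r v (k (Suc j)) q
       - aw_poly (\<zeta> j) (\<xi> j) ?l ?g v (k j) q * aw_poly (\<zeta> (Suc j)) (\<xi> (Suc j)) ?h ?r v (k (Suc j)) q))"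
  proof (cases "\<xi> (Suc j) = 0")
    case True
    then show ?thesis by (simp add: rate_eq_bond_rate[OF j(1)] j bond_rate_right_def)
  next
    case False
    have e: "?r + 2 * real (\<xi> (Suc j) - 1) + k (Suc j) = ?g - 2" using False by (simp add: of_nat_diff)
    have s: "Suc (\<xi> j) + (\<xi> (Suc j) - 1) = \<xi> j + \<xi> (Suc j)" using False by simp
    show ?thesis
      unfolding Suc_eq_plus1[symmetric] move_left[of \<xi> j, OF False[unfolded neq0_conv]] upd[OF s] id e rate_eq_bond_rate(4)[OF j]
      by (simp only: right_diff_distrib mult_ac)
  qed
  show ?thesis
    unfolding plus minus bond_R_def Let_def distrib_left[symmetric] ..
qed

text \<open>If the outer height \<open>h0\<close> exceeds \<open>-1\<close>, so does the middle
  height, which even exceeds 1 once the first site is occupied. If instead the height at the far end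
  of the bond is negative, the middle one is negative, and below \<open>-2\<close> once the second
  site is occupied.\<close>

lemma admissible_cases:
  assumes "k1 > 0" "k2 > 0" and "h0 > - 1 \<or> h0 + 2 * real y1 + k1 + 2 * real y2 + k2 < 0"
  shows "admissible (h0 + 2 * real y1 + k1) y1 y2"
proof (cases "h0 > - 1")
  case True
  then show ?thesis using assms(1) by (auto simp: admissible_def)
next
  case False
  then show ?thesis using assms by (auto simp: admissible_def)
qed

lemma state_space_cases:
  assumes "\<eta> \<in> state_space M k a"
  shows "a > - 1 \<or> a + (\<Sum>i=1..M. 2 * real (\<eta> i) + k i) < 0"
  using assms by (auto simp: state_space_def sum.distrib sum_distrib_left split: if_splits)

text \<open>Heights grow from left to right: for \<open>lam > - 1\<close> the height before the bond
  stays above \<open>-1\<close>, while the bound in the other state space is a bound on the last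
  height, hence on the one after the bond.\<close>

lemma admissible_L:
  assumes k: "\<And>i. i \<in> {1..M} \<Longrightarrow> k i > 0" and \<zeta>: "\<zeta> \<in> state_space M k lam" and j: "1 \<le> j" "Suc j \<le> M"
  shows "admissible (h_minus k lam \<zeta> (j - 1) + 2 * real (\<zeta> j) + k j) (\<zeta> j) (\<zeta> (Suc j))"
proof (rule admissible_cases)
  show "k j > 0" "k (Suc j) > 0" using k[of j] k[of "Suc j"] j by simp_all
  have nonneg: "0 \<le> 2 * real (\<zeta> i) + k i" if "i \<in> {1..M}" for i
    using k[OF that] by simp
  have "0 \<le> (\<Sum>i=1..j - 1. 2 * real (\<zeta> i) + k i)"
    using j by (intro sum_nonneg nonneg) auto
  moreover have "(\<Sum>i=1..Suc j. 2 * real (\<zeta> i) + k i) \<le> (\<Sum>i=1..M. 2 * real (\<zeta> i) + k i)"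
    using j by (intro sum_mono2) (simp_all add: nonneg del: sum.cl_ivl_Suc)
  moreover have "h_minus k lam \<zeta> (j - 1) + 2 * real (\<zeta> j) + k j + 2 * real (\<zeta> (Suc j)) + k (Suc j) = h_minus k lam \<zeta> (Suc j)"
    using h_minus_Suc[of k lam \<zeta> "j - 1"] h_minus_Suc[of k lam \<zeta> j] j by simp
  ultimately show "h_minus k lam \<zeta> (j - 1) > - 1 \<or>
      h_minus k lam \<zeta> (j - 1) + 2 * real (\<zeta> j) + k j + 2 * real (\<zeta> (Suc j)) + k (Suc j) < 0"
    using state_space_cases[OF \<zeta>] unfolding h_minus_def by linarith
qed

lemma admissible_R:
  assumes k: "\<And>i. i \<in> {1..M} \<Longrightarrow> k i > 0" and \<xi>: "\<xi> \<in> state_space M k \<rho>" and j: "1 \<le> j" "Suc j \<le> M"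
  shows "admissible (h_plus M k \<rho> \<xi> (Suc (Suc j)) + 2 * real (\<xi> (Suc j)) + k (Suc j)) (\<xi> (Suc j)) (\<xi> j)"
proof (rule admissible_cases)
  show "k j > 0" "k (Suc j) > 0" using k[of j] k[of "Suc j"] j by simp_all
  have nonneg: "0 \<le> 2 * real (\<xi> i) + k i" if "i \<in> {1..M}" for i
    using k[OF that] by simp
  have "0 \<le> (\<Sum>i=Suc (Suc j)..M. 2 * real (\<xi> i) + k i)"
    using j by (intro sum_nonneg nonneg) simp
  moreover have "(\<Sum>i=j..M. 2 * real (\<xi> i) + k i) \<le> (\<Sum>i=1..M. 2 * real (\<xi> i) + k i)"
    using j by (intro sum_mono2) (simp_all add: nonneg)
  moreover have "h_plus M k \<rho> \<xi> (Suc (Suc j)) + 2 * real (\<xi> (Suc j)) + k (Suc j) + 2 * real (\<xi> j) + k j = h_plus M k \<rho> \<xi> j"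
    using j by (simp add: h_plus_rec)
  ultimately show "h_plus M k \<rho> \<xi> (Suc (Suc j)) > - 1 \<or>
      h_plus M k \<rho> \<xi> (Suc (Suc j)) + 2 * real (\<xi> (Suc j)) + k (Suc j) + 2 * real (\<xi> j) + k j < 0"
    using state_space_cases[OF \<xi>] unfolding h_plus_def by linarith
qed

theorem theorem2p9:
  fixes q lam \<rho> :: real and M :: nat and k :: "nat \<Rightarrow> real" and v :: complex
  assumes "q > 0" and "q \<noteq> 1"
    and "M \<ge> 1"
    and "\<And>j. j \<in> {1..M} \<Longrightarrow> k j > 0"
    and "v \<noteq> 0"
  shows "duality_function
           (state_space M k lam) (ASIP_L M q k lam)
           (state_space M k \<rho>) (ASIP_R M q k \<rho>)
           (P_AW M q k lam \<rho> v)"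
  unfolding duality_function_def ASIP_L_def ASIP_R_def
proof (intro ballI sum.cong refl)
  fix \<zeta> \<xi> j
  assume \<zeta>: "\<zeta> \<in> state_space M k lam" and \<xi>: "\<xi> \<in> state_space M k \<rho>" and "j \<in> {1..M - 1}"
  then have j: "1 \<le> j" "Suc j \<le> M" by auto
  show "complex_of_real (rate_L_plus q k lam \<zeta> j) * (P_AW M q k lam \<rho> v (move j (j + 1) \<zeta>) \<xi> - P_AW M q k lam \<rho> v \<zeta> \<xi>) +
      complex_of_real (rate_L_minus q k lam \<zeta> (j + 1)) * (P_AW M q k lam \<rho> v (move (j + 1) j \<zeta>) \<xi> - P_AW M q k lam \<rho> v \<zeta> \<xi>) =
      complex_of_real (rate_R_plus M q k \<rho> \<xi> j) * (P_AW M q k lam \<rho> v \<zeta> (move j (j + 1) \<xi>) - P_AW M q k lam \<rho> v \<zeta> \<xi>) +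
      complex_of_real (rate_R_minus M q k \<rho> \<xi> (j + 1)) * (P_AW M q k lam \<rho> v \<zeta> (move (j + 1) j \<xi>) - P_AW M q k lam \<rho> v \<zeta> \<xi>)"
    unfolding bond_term_L[OF assms(1,5) j] bond_term_R[OF assms(1,5) j]
    using bond_duality[OF assms(1,2) _ _ admissible_L[OF assms(4) \<zeta> j] admissible_R[OF assms(4) \<xi> j]] assms(4) j
    by simp
qed

end
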